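(* Let $\mathcal V$ be a descent category, $k$ a natural number, and $f:X\to Y$ a morphism of $k$-groupoids in $\mathcal V$. Then $f$ is a weak equivalence if and only if, for every $n\ge0$, the natural morphism $$\mathrm{Map}(\Delta^n\hookrightarrow\Delta^{n+1},f)=X_n\times_{Y_n}Y_{n+1}\longrightarrow \mathrm{Map}(\partial\Delta^n\hookrightarrow\Lambda^{n+1}_{n+1},f)=\mathrm{Map}(\partial\Delta^n,X)\times_{\mathrm{Map}(\partial\Delta^n,Y)}\mathrm{Map}(\Lambda^{n+1}_{n+1},Y)$$ is a cover, where $\Delta^n\hookrightarrow\Delta^{n+1}$ is the face $\partial_{n+1}\Delta^{n+1}$ (spanned by the vertices $0,\dots,n$).
   Context: A descent category is a small category $\mathcal V$ with a subcategory of morphisms called covers such that: $\mathcal V$ has finite limits; pullbacks of covers are covers; if $f$ and $g\circ f$ are covers then $g$ is a cover. A simplicial space is a simplicial object in $\mathcal V$. For a simplicial space $X$ and a finite simplicial set $T$, $\mathrm{Map}(T,X)$ is the finite limit representing simplicial maps $T\to X$ ($\mathrm{Map}(\Delta^n,X)=X_n$). For $f:X\to Y$ and simplicial subset $S\subset T$, $\mathrm{Map}(S\hookrightarrow T,f)=\mathrm{Map}(S,X)\times_{\mathrm{Map}(S,Y)}\mathrm{Map}(T,Y)$. $\Lambda^n_i=\bigcup_{j\ne i}\partial_j\Delta^n$ is the horn, $\partial\Delta^n$ the boundary. A $k$-groupoid is a simplicial space $X$ with $X_n\to\mathrm{Map}(\Lambda^n_i,X)$ a cover for all $n>0$, $0\le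 i\le n$, and an isomorphism for $n>k$. A morphism $g:X\to Y$ is a hypercover if $X_n\to\mathrm{Map}(\partial\Delta^n\hookrightarrow\Delta^n,g)$ is a cover for all $n\ge0$. Let $(P_1Y)_m=\mathrm{Map}(\Delta^m\times\Delta^1,Y)$, with morphisms $P_1Y\to Y$ induced by $\Delta^m\times\{0\}$ and $\Delta^m\times\{1\}$; let $P(f)=X\times_YP_1Y$ (pullback along the first) and $q(f):P(f)\to Y$ the composite with the second. A morphism $f$ of $k$-groupoids is a weak equivalence if $q(f)$ is a hypercover. *)

theory Defs
  imports Main
begin

record ('o,'m) category =
  Obj  :: "'o set"
  Arr  :: "'m set"
  Dom  :: "'m \<Rightarrow> 'o"
  Cod  :: "'m \<Rightarrow> 'o"
  Idm  :: "'o \<Rightarrow> 'm"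
  Comp :: "'m \<Rightarrow> 'm \<Rightarrow> 'm"   (* Comp C g f = g o f *)

definition hom :: "('o,'m) category \<Rightarrow> 'o \<Rightarrow> 'o \<Rightarrow> 'm set" where
  "hom C a b = {f \<in> Arr C. Dom C f = a \<and> Cod C f = b}"

definition is_category :: "('o,'m) category \<Rightarrow> bool" where
  "is_category C \<longleftrightarrow>
     (\<forall>f\<in>Arr C. Dom C f \<in> Obj C \<and> Cod C f \<in> Obj C) \<and>
     (\<forall>a\<in>Obj C. Idm C a \<in> hom C a a) \<and>
     (\<forall>a b c f g. f \<in> hom C a b \<longrightarrow> g \<in> hom C b c \<longrightarrow> Comp C g f \<in> hom C a c) \<and>
     (\<forall>a b f. f \<in> hom C a b \<longrightarrow> Comp C f (Idm C a) = f \<and> Comp C (Idm C b) f = f) \<and>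
     (\<forall>a b c d f g h. f \<in> hom C a b \<longrightarrow> g \<in> hom C b c \<longrightarrow> h \<in> hom C c d \<longrightarrow>
        Comp C h (Comp C g f) = Comp C (Comp C h g) f)"

definition iso :: "('o,'m) category \<Rightarrow> 'm \<Rightarrow> bool" where
  "iso C h \<longleftrightarrow> h \<in> Arr C \<and>
     (\<exists>g \<in> hom C (Cod C h) (Dom C h). Comp C g h = Idm C (Dom C h) \<and> Comp C h g = Idm C (Cod C h))"

definition diagram :: "('o,'m) category \<Rightarrow> 'i set \<Rightarrow> ('i \<Rightarrow> 'o) \<Rightarrow> ('i \<times> 'i \<times> 'm) set \<Rightarrow> bool" where
  "diagram C I D E \<longleftrightarrow> (\<forall>i\<in>I. D i \<in> Obj C) \<and>
     (\<forall>(i,j,u)\<in>E. i \<in> I \<and> j \<in> I \<and> u \<in> hom C (D i) (D j))"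

definition is_cone :: "('o,'m) category \<Rightarrow> 'i set \<Rightarrow> ('i \<Rightarrow> 'o) \<Rightarrow> ('i \<times> 'i \<times> 'm) set
                        \<Rightarrow> 'o \<Rightarrow> ('i \<Rightarrow> 'm) \<Rightarrow> bool" where
  "is_cone C I D E L \<pi> \<longleftrightarrow> L \<in> Obj C \<and> (\<forall>i\<in>I. \<pi> i \<in> hom C L (D i)) \<and>
     (\<forall>(i,j,u)\<in>E. Comp C u (\<pi> i) = \<pi> j)"

definition is_limit :: "('o,'m) category \<Rightarrow> 'i set \<Rightarrow> ('i \<Rightarrow> 'o) \<Rightarrow> ('i \<times> 'i \<times> 'm) set
                        \<Rightarrow> 'o \<Rightarrow> ('i \<Rightarrow> 'm) \<Rightarrow> bool" where
  "is_limit C I D E L \<pi> \<longleftrightarrow> is_cone C I D E L \<pi> \<and>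
     (\<forall>L' \<pi>'. is_cone C I D E L' \<pi>' \<longrightarrow>
        (\<exists>!h. h \<in> hom C L' L \<and> (\<forall>i\<in>I. Comp C (\<pi> i) h = \<pi>' i)))"

text \<open>Finite limits: limits of all finite diagrams (finite graphs, equivalently finite categories).\<close>
definition has_finite_limits :: "('o,'m) category \<Rightarrow> bool" where
  "has_finite_limits C \<longleftrightarrow>
     (\<forall>(I::nat set) (D::nat \<Rightarrow> 'o) (E::(nat \<times> nat \<times> 'm) set).
        finite I \<and> finite E \<and> diagram C I D E \<longrightarrow> (\<exists>L \<pi>. is_limit C I D E L \<pi>))"

definition is_pullback :: "('o,'m) category \<Rightarrow> 'm \<Rightarrow> 'm \<Rightarrow> 'o \<Rightarrow> 'm \<Rightarrow> 'm \<Rightarrow> bool" where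
  "is_pullback C f g P p q \<longleftrightarrow>
     f \<in> Arr C \<and> g \<in> Arr C \<and> Cod C f = Cod C g \<and> P \<in> Obj C \<and>
     p \<in> hom C P (Dom C f) \<and> q \<in> hom C P (Dom C g) \<and> Comp C f p = Comp C g q \<and>
     (\<forall>P' p' q'. P' \<in> Obj C \<and> p' \<in> hom C P' (Dom C f) \<and> q' \<in> hom C P' (Dom C g) \<and>
        Comp C f p' = Comp C g q' \<longrightarrow>
        (\<exists>!h. h \<in> hom C P' P \<and> Comp C p h = p' \<and> Comp C q h = q'))"

definition descent_category :: "('o,'m) category \<Rightarrow> 'm set \<Rightarrow> bool" where
  "descent_category C cov \<longleftrightarrow>
     is_category C \<and> has_finite_limits C \<and> cov \<subseteq> Arr C \<and>
     (\<forall>a\<in>Obj C. Idm C a \<in> cov) \<and>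
     (\<forall>f\<in>cov. \<forall>g\<in>cov. Dom C g = Cod C f \<longrightarrow> Comp C g f \<in> cov) \<and>
     (\<forall>f g P p q. is_pullback C f g P p q \<and> f \<in> cov \<longrightarrow> q \<in> cov) \<and>
     (\<forall>f g. f \<in> cov \<and> g \<in> Arr C \<and> Dom C g = Cod C f \<and> Comp C g f \<in> cov \<longrightarrow> g \<in> cov)"

text \<open>A monotone map [m] \<rightarrow> [n] (only its values on {0..m} matter).\<close>
definition mono_map :: "nat \<Rightarrow> nat \<Rightarrow> (nat \<Rightarrow> nat) \<Rightarrow> bool" where
  "mono_map m n \<theta> \<longleftrightarrow> (\<forall>i\<le>m. \<theta> i \<le> n) \<and> (\<forall>i j. i \<le> j \<longrightarrow> j \<le> m \<longrightarrow> \<theta> i \<le> \<theta> j)"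

text \<open>Lev X n = X_n; Act X \<theta> m n : X_n \<rightarrow> X_m is the structure map of \<theta> : [m] \<rightarrow> [n].\<close>
record ('o,'m) sobj =
  Lev :: "nat \<Rightarrow> 'o"
  Act :: "(nat \<Rightarrow> nat) \<Rightarrow> nat \<Rightarrow> nat \<Rightarrow> 'm"

definition simplicial :: "('o,'m) category \<Rightarrow> ('o,'m) sobj \<Rightarrow> bool" where
  "simplicial C X \<longleftrightarrow>
     (\<forall>n. Lev X n \<in> Obj C) \<and>
     (\<forall>m n \<theta>. mono_map m n \<theta> \<longrightarrow> Act X \<theta> m n \<in> hom C (Lev X n) (Lev X m)) \<and>
     (\<forall>m n \<theta> \<theta>'. mono_map m n \<theta> \<longrightarrow> (\<forall>i\<le>m. \<theta> i = \<theta>' i) \<longrightarrow> Act X \<theta>' m n = Act X \<theta> m n) \<and>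
     (\<forall>n. Act X id n n = Idm C (Lev X n)) \<and>
     (\<forall>l m n \<phi> \<theta>. mono_map l m \<phi> \<longrightarrow> mono_map m n \<theta> \<longrightarrow>
        Act X (\<theta> \<circ> \<phi>) l n = Comp C (Act X \<phi> l m) (Act X \<theta> m n))"

definition smor :: "('o,'m) category \<Rightarrow> ('o,'m) sobj \<Rightarrow> ('o,'m) sobj \<Rightarrow> (nat \<Rightarrow> 'm) \<Rightarrow> bool" where
  "smor C X Y f \<longleftrightarrow>
     (\<forall>n. f n \<in> hom C (Lev X n) (Lev Y n)) \<and>
     (\<forall>m n \<theta>. mono_map m n \<theta> \<longrightarrow> Comp C (f m) (Act X \<theta> m n) = Comp C (Act Y \<theta> m n) (f n))"

section \<open>Finite simplicial sets, as simplicial subsets of nerves of the poset nat \<times> nat\<close>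

text \<open>A k-simplex of the nerve of the poset nat \<times> nat (product order) is a
  non-decreasing list of k+1 vertices.\<close>
definition vle :: "nat \<times> nat \<Rightarrow> nat \<times> nat \<Rightarrow> bool" where
  "vle x y \<longleftrightarrow> fst x \<le> fst y \<and> snd x \<le> snd y"

definition nsimp :: "(nat \<times> nat) list \<Rightarrow> bool" where
  "nsimp xs \<longleftrightarrow> xs \<noteq> [] \<and> (\<forall>i j. i \<le> j \<longrightarrow> j < length xs \<longrightarrow> vle (xs ! i) (xs ! j))"

definition sdim :: "(nat \<times> nat) list \<Rightarrow> nat" where
  "sdim xs = length xs - 1"

definition sact :: "(nat \<Rightarrow> nat) \<Rightarrow> nat \<Rightarrow> (nat \<times> nat) list \<Rightarrow> (nat \<times> nat) list" where
  "sact \<theta> m xs = map (\<lambda>j. xs ! \<theta> j) [0..<Suc m]"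

text \<open>\<Delta>^n (vertices (0,0),...,(n,0)); note \<Delta>^n is the face of \<Delta>^(n+1) spanned by 0..n.\<close>
definition Simp :: "nat \<Rightarrow> (nat \<times> nat) list set" where
  "Simp n = {xs. nsimp xs \<and> set xs \<subseteq> {0..n} \<times> {0}}"

definition Bdry :: "nat \<Rightarrow> (nat \<times> nat) list set" where
  "Bdry n = {xs \<in> Simp n. \<exists>j\<le>n. (j,0) \<notin> set xs}"

definition Horn :: "nat \<Rightarrow> nat \<Rightarrow> (nat \<times> nat) list set" where
  "Horn n i = {xs \<in> Simp n. \<exists>j\<le>n. j \<noteq> i \<and> (j,0) \<notin> set xs}"

definition Prism :: "nat \<Rightarrow> (nat \<times> nat) list set" where
  "Prism m = {xs. nsimp xs \<and> set xs \<subseteq> {0..m} \<times> {0,1}}"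

definition is_map_limit :: "('o,'m) category \<Rightarrow> ('o,'m) sobj \<Rightarrow> (nat \<times> nat) list set
                             \<Rightarrow> 'o \<Rightarrow> ((nat \<times> nat) list \<Rightarrow> 'm) \<Rightarrow> bool" where
  "is_map_limit C X T L \<pi> \<longleftrightarrow>
     is_limit C T (\<lambda>xs. Lev X (sdim xs))
       {(xs, sact \<theta> m xs, Act X \<theta> m (sdim xs)) | xs \<theta> m. xs \<in> T \<and> mono_map m (sdim xs) \<theta>}
       L \<pi>"

text \<open>h : Map(T,X) \<rightarrow> Map(T',X) induced by a simplicial map T' \<rightarrow> T given on vertices by \<phi>.\<close>
definition is_induced :: "('o,'m) category \<Rightarrow> 'o \<Rightarrow> ((nat \<times> nat) list \<Rightarrow> 'm)
     \<Rightarrow> 'o \<Rightarrow> ((nat \<times> nat) list \<Rightarrow> 'm) \<Rightarrow> (nat \<times> nat) list set \<Rightarrow> (nat \<times> nat \<Rightarrow> nat \<times> nat) \<Rightarrow> 'm \<Rightarrow> bool" where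
  "is_induced C L \<pi> L' \<pi>' T' \<phi> h \<longleftrightarrow>
     h \<in> hom C L L' \<and> (\<forall>xs\<in>T'. Comp C (\<pi>' xs) h = \<pi> (map \<phi> xs))"

definition is_fmap :: "('o,'m) category \<Rightarrow> (nat \<Rightarrow> 'm) \<Rightarrow> (nat \<times> nat) list set \<Rightarrow> 'o \<Rightarrow> ((nat \<times> nat) list \<Rightarrow> 'm)
     \<Rightarrow> 'o \<Rightarrow> ((nat \<times> nat) list \<Rightarrow> 'm) \<Rightarrow> 'm \<Rightarrow> bool" where
  "is_fmap C f T L \<pi> L' \<pi>' h \<longleftrightarrow>
     h \<in> hom C L L' \<and> (\<forall>xs\<in>T. Comp C (\<pi>' xs) h = Comp C (f (sdim xs)) (\<pi> xs))"

definition restr_prop :: "('o,'m) category \<Rightarrow> ('o,'m) sobj \<Rightarrow> (nat \<times> nat) list set \<Rightarrow> (nat \<times> nat) list set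
     \<Rightarrow> ('m \<Rightarrow> bool) \<Rightarrow> bool" where
  "restr_prop C X T S Q \<longleftrightarrow>
     (\<forall>L \<pi> L' \<pi>' h. is_map_limit C X T L \<pi> \<and> is_map_limit C X S L' \<pi>' \<and>
        is_induced C L \<pi> L' \<pi>' S id h \<longrightarrow> Q h)"

text \<open>The natural morphism Map(T \<hookrightarrow> T', f) \<rightarrow> Map(S \<hookrightarrow> S', f) (S \<subseteq> T, S' \<subseteq> T', S \<subseteq> S')
  has property Q, for every choice of the representing limits and pullbacks.
  Map(T \<hookrightarrow> T', f) = Map(T,X) \<times>_{Map(T,Y)} Map(T',Y).\<close>
definition rel_prop :: "('o,'m) category \<Rightarrow> ('o,'m) sobj \<Rightarrow> ('o,'m) sobj \<Rightarrow> (nat \<Rightarrow> 'm)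
     \<Rightarrow> (nat \<times> nat) list set \<Rightarrow> (nat \<times> nat) list set \<Rightarrow> (nat \<times> nat) list set \<Rightarrow> (nat \<times> nat) list set
     \<Rightarrow> ('m \<Rightarrow> bool) \<Rightarrow> bool" where
  "rel_prop C X Y f T T' S S' Q \<longleftrightarrow>
     (\<forall>LTX \<pi>TX LTY \<pi>TY LT'Y \<pi>T'Y LSX \<pi>SX LSY \<pi>SY LS'Y \<pi>S'Y fT rT fS rS P1 p1 q1 P2 p2 q2 a b r.
        is_map_limit C X T LTX \<pi>TX \<and> is_map_limit C Y T LTY \<pi>TY \<and> is_map_limit C Y T' LT'Y \<pi>T'Y \<and>
        is_map_limit C X S LSX \<pi>SX \<and> is_map_limit C Y S LSY \<pi>SY \<and> is_map_limit C Y S' LS'Y \<pi>S'Y \<and>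
        is_fmap C f T LTX \<pi>TX LTY \<pi>TY fT \<and> is_induced C LT'Y \<pi>T'Y LTY \<pi>TY T id rT \<and>
        is_fmap C f S LSX \<pi>SX LSY \<pi>SY fS \<and> is_induced C LS'Y \<pi>S'Y LSY \<pi>SY S id rS \<and>
        is_pullback C fT rT P1 p1 q1 \<and> is_pullback C fS rS P2 p2 q2 \<and>
        is_induced C LTX \<pi>TX LSX \<pi>SX S id a \<and> is_induced C LT'Y \<pi>T'Y LS'Y \<pi>S'Y S' id b \<and>
        r \<in> hom C P1 P2 \<and> Comp C p2 r = Comp C a p1 \<and> Comp C q2 r = Comp C b q1
        \<longrightarrow> Q r)"

definition kgroupoid :: "('o,'m) category \<Rightarrow> 'm set \<Rightarrow> nat \<Rightarrow> ('o,'m) sobj \<Rightarrow> bool" where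
  "kgroupoid C cov k X \<longleftrightarrow> simplicial C X \<and>
     (\<forall>n i. 0 < n \<and> i \<le> n \<longrightarrow>
        restr_prop C X (Simp n) (Horn n i) (\<lambda>h. h \<in> cov \<and> (k < n \<longrightarrow> iso C h)))"

text \<open>g : X \<rightarrow> Y is a hypercover: X_n = Map(\<Delta>^n \<hookrightarrow> \<Delta>^n, g) \<rightarrow> Map(\<partial>\<Delta>^n \<hookrightarrow> \<Delta>^n, g) is a cover.\<close>
definition hypercover :: "('o,'m) category \<Rightarrow> 'm set \<Rightarrow> ('o,'m) sobj \<Rightarrow> ('o,'m) sobj \<Rightarrow> (nat \<Rightarrow> 'm) \<Rightarrow> bool" where
  "hypercover C cov X Y g \<longleftrightarrow>
     (\<forall>n. rel_prop C X Y g (Simp n) (Simp n) (Bdry n) (Simp n) (\<lambda>r. r \<in> cov))"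

text \<open>Vertices \<Delta>^m \<times> {0} and \<Delta>^m \<times> {1} as top simplices of \<Delta>^m \<times> \<Delta>^1.\<close>
definition e0 :: "nat \<Rightarrow> (nat \<times> nat) list" where "e0 m = map (\<lambda>j. (j, 0)) [0..<Suc m]"
definition e1 :: "nat \<Rightarrow> (nat \<times> nat) list" where "e1 m = map (\<lambda>j. (j, 1)) [0..<Suc m]"

text \<open>Weak equivalence: for every choice of P_1 Y (levels Map(\<Delta>^m \<times> \<Delta>^1, Y) with
  induced structure maps) and of P(f) = X \<times>_Y P_1 Y (levelwise pullback along the
  evaluation at \<Delta>^m \<times> {0}), the morphism q(f) : P(f) \<rightarrow> Y (evaluation at \<Delta>^m \<times> {1})
  is a hypercover.\<close>
definition weak_equivalence :: "('o,'m) category \<Rightarrow> 'm set \<Rightarrow> ('o,'m) sobj \<Rightarrow> ('o,'m) sobj \<Rightarrow> (nat \<Rightarrow> 'm) \<Rightarrow> bool" where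
  "weak_equivalence C cov X Y f \<longleftrightarrow>
     (\<forall>P1 \<pi>P P a b.
        simplicial C P1 \<and>
        (\<forall>m. is_map_limit C Y (Prism m) (Lev P1 m) (\<pi>P m)) \<and>
        (\<forall>m' m \<theta>. mono_map m' m \<theta> \<longrightarrow>
           is_induced C (Lev P1 m) (\<pi>P m) (Lev P1 m') (\<pi>P m') (Prism m')
             (\<lambda>(x, y). (\<theta> x, y)) (Act P1 \<theta> m' m)) \<and>
        simplicial C P \<and> smor C P X a \<and> smor C P P1 b \<and>
        (\<forall>m. is_pullback C (f m) (\<pi>P m (e0 m)) (Lev P m) (a m) (b m))
        \<longrightarrow> hypercover C cov P Y (\<lambda>m. Comp C (\<pi>P m (e1 m)) (b m)))"

end

theory Submission
  imports Defs
begin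

text \<open>Identify \<open>Map(S \<hookrightarrow> T, f)\<close> with the presheaf of compatible families of generalised elements
  on \<open>C\<close>, and call a map of presheaves a cover if it is relatively representable by covers. Such maps
  compose and are stable under pullback, so attaching a cell along a horn gives one, by the Kan
  condition on \<open>Y\<close>. The map \<open>f\<close> is a weak equivalence iff restriction of \<open>\<Delta>\<^sup>n \<hookrightarrow> \<Delta>\<^sup>n \<times> \<Delta>\<^sup>1\<close> to
  \<open>\<partial>\<Delta>\<^sup>n \<hookrightarrow> \<partial>\<Delta>\<^sup>n \<times> \<Delta>\<^sup>1 \<union> \<Delta>\<^sup>n \<times> {1}\<close> is a cover for all \<open>n\<close>. Filling the prism by its shuffles, all steps
  but the last attach horns in \<open>Y\<close>, and the last step is the map of the theorem; this proves one
  direction. For the other one, add a cone vertex \<open>v\<close>: both \<open>Map(\<Delta>\<^sup>n \<hookrightarrow> \<Delta>\<^sup>n * v, f)\<close> and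
  \<open>Map(\<partial>\<Delta>\<^sup>n \<hookrightarrow> \<partial>\<Delta>\<^sup>n * v, f)\<close> are covered by \<open>Map(\<Delta>\<^sup>n \<hookrightarrow> (\<Delta>\<^sup>n \<times> \<Delta>\<^sup>1) * v, f)\<close>, and covers cancel.\<close>

section \<open>Relative covers\<close>

text \<open>The shuffles alone do not give the converse. In the restriction from the full prism to
  its partial boundary, the map of the theorem acts first and the horn fillings act afterwards. The
  cancellation axiom goes the other way: from the composite and the map that acts first it recovers
  the map that acts last. The cone vertex exchanges the roles. Restriction from the coned prism to
  the cone on its bottom face acts first and is built from horns of \<open>Y\<close> only; what acts
  last is restriction from the cone on the bottom to the cone on its boundary, which is the map of
  the theorem. The last shuffle is special because its free face is the bottom of the prism, where
  values in \<open>X\<close> are prescribed: the new cell of \<open>Y\<close> and the new simplex of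
  \<open>X\<close> must be attached together, which is a relative condition on \<open>f\<close> and
  not a horn of \<open>Y\<close>. In the coned prism the bottom, with its values in
  \<open>X\<close>, arrives in one gluing of the whole prism, justified by the hypothesis on
  \<open>q(f)\<close>; the remaining free faces all contain the cone vertex and carry no values in
  \<open>X\<close>.\<close>

locale descent =
  fixes C :: "('o,'m) category" and cov :: "'m set"
  assumes descent: "descent_category C cov"
begin

abbreviation comp (infixl "\<cdot>" 75) where "g \<cdot> f \<equiv> Comp C g f"

section \<open>Elementary calculus of morphisms, covers and pullbacks\<close>

lemma cat: "is_category C"
  using descent by (simp add: descent_category_def)

lemma comp_in_hom: "f \<in> hom C a b \<Longrightarrow> g \<in> hom C b c \<Longrightarrow> g \<cdot> f \<in> hom C a c"
  using cat unfolding is_category_def by blast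

lemma comp_assoc:
  "f \<in> hom C a b \<Longrightarrow> g \<in> hom C b c \<Longrightarrow> h \<in> hom C c d \<Longrightarrow> h \<cdot> (g \<cdot> f) = h \<cdot> g \<cdot> f"
  using cat unfolding is_category_def by blast

lemma id_in_hom: "a \<in> Obj C \<Longrightarrow> Idm C a \<in> hom C a a"
  using cat unfolding is_category_def by blast

lemma comp_id: "f \<in> hom C a b \<Longrightarrow> f \<cdot> Idm C a = f" "f \<in> hom C a b \<Longrightarrow> Idm C b \<cdot> f = f"
  using cat unfolding is_category_def by blast+

lemma hom_obj: "f \<in> hom C a b \<Longrightarrow> a \<in> Obj C" "f \<in> hom C a b \<Longrightarrow> b \<in> Obj C"
  using cat unfolding is_category_def hom_def by blast+

lemma cov_id: "a \<in> Obj C \<Longrightarrow> Idm C a \<in> cov"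
  using descent unfolding descent_category_def by (elim conjE) (rule bspec)

lemma cov_comp: "f \<in> cov \<Longrightarrow> g \<in> cov \<Longrightarrow> f \<in> hom C a b \<Longrightarrow> g \<in> hom C b c \<Longrightarrow> g \<cdot> f \<in> cov"
proof -
  have "\<forall>f\<in>cov. \<forall>g\<in>cov. Dom C g = Cod C f \<longrightarrow> g \<cdot> f \<in> cov"
    using descent unfolding descent_category_def by (elim conjE)
  moreover assume "f \<in> hom C a b" "g \<in> hom C b c"
  then have "Dom C g = Cod C f" by (simp add: hom_def)
  moreover assume "f \<in> cov" "g \<in> cov"
  ultimately show "g \<cdot> f \<in> cov" by blast
qed

lemma cov_pullback: "is_pullback C f g P p q \<Longrightarrow> f \<in> cov \<Longrightarrow> q \<in> cov"
proof -
  have "\<forall>f g P p q. is_pullback C f g P p q \<and> f \<in> cov \<longrightarrow> q \<in> cov"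
    using descent unfolding descent_category_def by (elim conjE)
  then show "is_pullback C f g P p q \<Longrightarrow> f \<in> cov \<Longrightarrow> q \<in> cov" by blast
qed

lemma cov_cancel: "f \<in> cov \<Longrightarrow> f \<in> hom C a b \<Longrightarrow> g \<in> hom C b c \<Longrightarrow> g \<cdot> f \<in> cov \<Longrightarrow> g \<in> cov"
proof -
  have "\<forall>f g. f \<in> cov \<and> g \<in> Arr C \<and> Dom C g = Cod C f \<and> g \<cdot> f \<in> cov \<longrightarrow> g \<in> cov"
    using descent unfolding descent_category_def by (elim conjE)
  moreover assume "f \<in> hom C a b" "g \<in> hom C b c"
  then have "g \<in> Arr C" "Dom C g = Cod C f" by (simp_all add: hom_def)
  moreover assume "f \<in> cov" "g \<cdot> f \<in> cov"
  ultimately show "g \<in> cov" by blast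
qed

lemma finite_limit_exists:
  fixes I :: "nat set"
  assumes "finite I" "finite E" "diagram C I D E"
  shows "\<exists>L \<pi>. is_limit C I D E L \<pi>"
proof -
  have "has_finite_limits C"
    using descent unfolding descent_category_def by (elim conjE)
  then show ?thesis using assms unfolding has_finite_limits_def by blast
qed

lemma pullback_intro:
  assumes "f \<in> hom C a c" "g \<in> hom C b c" "p \<in> hom C P a" "q \<in> hom C P b" "f \<cdot> p = g \<cdot> q"
    and "\<And>P' p' q'. p' \<in> hom C P' a \<Longrightarrow> q' \<in> hom C P' b \<Longrightarrow> f \<cdot> p' = g \<cdot> q' \<Longrightarrow>
      \<exists>h. h \<in> hom C P' P \<and> p \<cdot> h = p' \<and> q \<cdot> h = q'"
    and "\<And>P' h h'. h \<in> hom C P' P \<Longrightarrow> h' \<in> hom C P' P \<Longrightarrow> p \<cdot> h = p \<cdot> h' \<Longrightarrow> q \<cdot> h = q \<cdot> h' \<Longrightarrow> h = h'"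
  shows "is_pullback C f g P p q"
proof -
  have d: "Dom C f = a" "Dom C g = b" "Cod C f = c" "Cod C g = c" "f \<in> Arr C" "g \<in> Arr C" "P \<in> Obj C"
    using assms(1,2) hom_obj[OF assms(3)] by (auto simp: hom_def)
  show ?thesis
    unfolding is_pullback_def d
  proof (intro conjI allI impI ex_ex1I)
    fix P' p' q'
    assume "P' \<in> Obj C \<and> p' \<in> hom C P' a \<and> q' \<in> hom C P' b \<and> f \<cdot> p' = g \<cdot> q'"
    then show "\<exists>h. h \<in> hom C P' P \<and> p \<cdot> h = p' \<and> q \<cdot> h = q'" using assms(6) by blast
  next
    fix P' p' q' h h'
    assume "h \<in> hom C P' P \<and> p \<cdot> h = p' \<and> q \<cdot> h = q'" "h' \<in> hom C P' P \<and> p \<cdot> h' = p' \<and> q \<cdot> h' = q'"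
    then show "h = h'" using assms(7)[of h P' h'] by simp
  qed (use d assms in simp_all)
qed

lemma pullback_hom:
  assumes "is_pullback C f g P p q" "f \<in> hom C a c" "g \<in> hom C b c"
  shows "p \<in> hom C P a" "q \<in> hom C P b" "f \<cdot> p = g \<cdot> q"
  using assms unfolding is_pullback_def hom_def by simp_all

lemma pullback_ex1:
  assumes "is_pullback C f g P p q" "f \<in> hom C a c" "g \<in> hom C b c"
    and "p' \<in> hom C P' a" "q' \<in> hom C P' b" "f \<cdot> p' = g \<cdot> q'"
  shows "\<exists>!h. h \<in> hom C P' P \<and> p \<cdot> h = p' \<and> q \<cdot> h = q'"
proof -
  have d: "Dom C f = a" "Dom C g = b" "P' \<in> Obj C"
    using assms(2,3) hom_obj[OF assms(4)] by (auto simp: hom_def)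
  have "\<forall>P' p' q'. P' \<in> Obj C \<and> p' \<in> hom C P' a \<and> q' \<in> hom C P' b \<and> f \<cdot> p' = g \<cdot> q' \<longrightarrow>
      (\<exists>!h. h \<in> hom C P' P \<and> p \<cdot> h = p' \<and> q \<cdot> h = q')"
    using assms(1) unfolding is_pullback_def d by (elim conjE)
  then show ?thesis using d assms(4-6) by blast
qed

lemma pullback_ex:
  assumes "is_pullback C f g P p q" "f \<in> hom C a c" "g \<in> hom C b c"
    and "p' \<in> hom C P' a" "q' \<in> hom C P' b" "f \<cdot> p' = g \<cdot> q'"
  obtains h where "h \<in> hom C P' P" "p \<cdot> h = p'" "q \<cdot> h = q'"
  using pullback_ex1[OF assms] that by blast

lemma pullback_eqI:
  assumes "is_pullback C f g P p q" "f \<in> hom C a c" "g \<in> hom C b c"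
    and "h \<in> hom C P' P" "h' \<in> hom C P' P" "p \<cdot> h = p \<cdot> h'" "q \<cdot> h = q \<cdot> h'"
  shows "h = h'"
proof -
  note pq = pullback_hom[OF assms(1-3)]
  have "f \<cdot> (p \<cdot> h) = g \<cdot> (q \<cdot> h)"
    using comp_assoc[OF assms(4) pq(1) assms(2)] comp_assoc[OF assms(4) pq(2) assms(3)] pq(3) by simp
  from pullback_ex1[OF assms(1-3) comp_in_hom[OF assms(4) pq(1)] comp_in_hom[OF assms(4) pq(2)] this]
  obtain k where k: "\<And>y. y \<in> hom C P' P \<and> p \<cdot> y = p \<cdot> h \<and> q \<cdot> y = q \<cdot> h \<Longrightarrow> y = k"
    by (elim ex1E) blast
  show ?thesis by (rule trans[OF k[of h] sym[OF k[of h']]]) (use assms(4-7) in simp_all)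
qed

lemma pullback_exists:
  assumes "f \<in> hom C a c" "g \<in> hom C b c"
  shows "\<exists>P p q. is_pullback C f g P p q"
proof -
  define D where "D = (\<lambda>i::nat. if i = 0 then a else if i = 1 then b else c)"
  define I where "I = {0::nat,1,2}"
  define E where "E = {(0::nat,2::nat,f),(1,2,g)}"
  have "diagram C I D E" "finite I" "finite E"
    using assms hom_obj by (auto simp: diagram_def D_def I_def E_def)
  then obtain P \<pi> where L: "is_limit C I D E P \<pi>"
    using finite_limit_exists by blast
  then have pi: "\<pi> 0 \<in> hom C P a" "\<pi> 1 \<in> hom C P b" "\<pi> 2 \<in> hom C P c" "f \<cdot> \<pi> 0 = \<pi> 2" "g \<cdot> \<pi> 1 = \<pi> 2"
    and U: "\<And>L' \<pi>'. is_cone C I D E L' \<pi>' \<Longrightarrow> \<exists>!h. h \<in> hom C L' P \<and> (\<forall>i\<in>I. \<pi> i \<cdot> h = \<pi>' i)"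
    by (auto simp: is_limit_def is_cone_def I_def D_def E_def)
  have "is_pullback C f g P (\<pi> 0) (\<pi> 1)"
  proof (rule pullback_intro[OF assms pi(1,2)])
    show "f \<cdot> \<pi> 0 = g \<cdot> \<pi> 1" using pi by simp
  next
    fix P' p' q' assume h: "p' \<in> hom C P' a" "q' \<in> hom C P' b" "f \<cdot> p' = g \<cdot> q'"
    have "is_cone C I D E P' (\<lambda>i. if i = 0 then p' else if i = 1 then q' else f \<cdot> p')"
      using h assms hom_obj(1)[OF h(1)] comp_in_hom[OF h(1) assms(1)] comp_in_hom[OF h(2) assms(2)]
      by (auto simp: is_cone_def I_def D_def E_def)
    from U[OF this] show "\<exists>h. h \<in> hom C P' P \<and> \<pi> 0 \<cdot> h = p' \<and> \<pi> 1 \<cdot> h = q'"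
      by (auto simp: I_def)
  next
    fix P' h h' assume h: "h \<in> hom C P' P" "h' \<in> hom C P' P" "\<pi> 0 \<cdot> h = \<pi> 0 \<cdot> h'" "\<pi> 1 \<cdot> h = \<pi> 1 \<cdot> h'"
    have "f \<cdot> (\<pi> 0 \<cdot> h) = \<pi> 2 \<cdot> h" "g \<cdot> (\<pi> 1 \<cdot> h) = \<pi> 2 \<cdot> h"
      using comp_assoc[OF h(1) pi(1) assms(1)] comp_assoc[OF h(1) pi(2) assms(2)] pi(4,5) by simp_all
    moreover have "\<pi> 0 \<cdot> h \<in> hom C P' a" "\<pi> 1 \<cdot> h \<in> hom C P' b" "\<pi> 2 \<cdot> h \<in> hom C P' c"
      by (rule comp_in_hom; fact)+
    ultimately have "is_cone C I D E P' (\<lambda>i. \<pi> i \<cdot> h)"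
      using hom_obj[OF h(1)] by (auto simp: is_cone_def I_def D_def E_def)
    from U[OF this]
    obtain k where k: "\<And>y. y \<in> hom C P' P \<and> (\<forall>i\<in>I. \<pi> i \<cdot> y = \<pi> i \<cdot> h) \<Longrightarrow> y = k"
      by (elim ex1E) blast
    have "\<pi> 2 \<cdot> h = \<pi> 2 \<cdot> h'"
      using comp_assoc[OF h(1) pi(1) assms(1)] comp_assoc[OF h(2) pi(1) assms(1)] pi(4) h(3) by simp
    then have eq: "\<forall>i\<in>I. \<pi> i \<cdot> h' = \<pi> i \<cdot> h" using h by (simp add: I_def)
    show "h = h'" by (rule trans[OF k[of h] sym[OF k[of h']]]) (use h(1,2) eq in simp_all)
  qed
  then show ?thesis by blast
qed

section \<open>Cones on parts of one graph, and covers between the presheaves they form\<close>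

definition out_edges :: "('i \<times> 'i \<times> 'm) set \<Rightarrow> 'i set \<Rightarrow> ('i \<times> 'i \<times> 'm) set" where
  "out_edges E I = {(i,j,u) \<in> E. i \<in> I}"

abbreviation cone where "cone D E I \<equiv> is_cone C I D (out_edges E I)"
abbreviation limit where "limit D E I \<equiv> is_limit C I D (out_edges E I)"

lemma cone_iff: "cone D E I U e \<longleftrightarrow> U \<in> Obj C \<and> (\<forall>i\<in>I. e i \<in> hom C U (D i)) \<and>
    (\<forall>i j u. (i,j,u) \<in> E \<longrightarrow> i \<in> I \<longrightarrow> u \<cdot> e i = e j)"
  unfolding is_cone_def out_edges_def by auto

lemma coneI:
  assumes "U \<in> Obj C" "\<And>i. i \<in> I \<Longrightarrow> e i \<in> hom C U (D i)"
    "\<And>i j u. (i,j,u) \<in> E \<Longrightarrow> i \<in> I \<Longrightarrow> u \<cdot> e i = e j"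
  shows "cone D E I U e"
  using assms by (auto simp: cone_iff)

lemma coneD:
  assumes "cone D E I U e"
  shows "U \<in> Obj C" "i \<in> I \<Longrightarrow> e i \<in> hom C U (D i)" "(i,j,u) \<in> E \<Longrightarrow> i \<in> I \<Longrightarrow> u \<cdot> e i = e j"
  using assms by (auto simp: cone_iff)

definition wf_graph :: "('i \<Rightarrow> 'o) \<Rightarrow> ('i \<times> 'i \<times> 'm) set \<Rightarrow> bool" where
  "wf_graph D E \<longleftrightarrow> (\<forall>(i,j,u)\<in>E. u \<in> hom C (D i) (D j))"

text \<open>One graph serves all index sets, so that restriction of cones is mere inclusion of index
  sets. \<open>out_edges\<close> imposes every edge that leaves \<open>I\<close>, even if it ends
  outside; closedness excludes such edges, and then only the values on \<open>I\<close>
  matter.\<close>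

definition closed :: "('i \<times> 'i \<times> 'm) set \<Rightarrow> 'i set \<Rightarrow> bool" where
  "closed E I \<longleftrightarrow> (\<forall>(i,j,u)\<in>E. i \<in> I \<longrightarrow> j \<in> I)"

lemma wf_graphD: "wf_graph D E \<Longrightarrow> (i,j,u) \<in> E \<Longrightarrow> u \<in> hom C (D i) (D j)"
  by (auto simp: wf_graph_def)

lemma closedD: "closed E I \<Longrightarrow> (i,j,u) \<in> E \<Longrightarrow> i \<in> I \<Longrightarrow> j \<in> I"
  by (auto simp: closed_def)

lemma cone_mono: "cone D E J U e \<Longrightarrow> I \<subseteq> J \<Longrightarrow> cone D E I U e"
  by (auto simp: cone_iff)

lemma cone_comp:
  assumes "wf_graph D E" "cone D E I U e" "h \<in> hom C V U"
  shows "cone D E I V (\<lambda>i. e i \<cdot> h)"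
proof (rule coneI)
  show "V \<in> Obj C" using assms(3) hom_obj by blast
  show "e i \<cdot> h \<in> hom C V (D i)" if "i \<in> I" for i by (rule comp_in_hom[OF assms(3) coneD(2)[OF assms(2) that]])
  show "u \<cdot> (e i \<cdot> h) = e j \<cdot> h" if "(i,j,u) \<in> E" "i \<in> I" for i j u
    using comp_assoc[OF assms(3) coneD(2)[OF assms(2) that(2)] wf_graphD[OF assms(1) that(1)]]
      coneD(3)[OF assms(2) that] by simp
qed

lemma cone_cong:
  assumes "closed E I" "\<And>i. i \<in> I \<Longrightarrow> e i = e' i"
  shows "cone D E I U e \<longleftrightarrow> cone D E I U e'"
  unfolding cone_iff using assms closedD[OF assms(1)] by metis

lemma limit_cone: "limit D E I L e \<Longrightarrow> cone D E I L e"
  by (simp add: is_limit_def)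

lemma limit_ex:
  assumes "limit D E I L e" "cone D E I U x"
  shows "\<exists>h\<in>hom C U L. \<forall>i\<in>I. e i \<cdot> h = x i"
  using assms unfolding is_limit_def by blast

lemma limit_eqI:
  assumes "wf_graph D E" "limit D E I L e" "h \<in> hom C U L" "h' \<in> hom C U L"
    "\<And>i. i \<in> I \<Longrightarrow> e i \<cdot> h = e i \<cdot> h'"
  shows "h = h'"
proof -
  have "cone D E I U (\<lambda>i. e i \<cdot> h)" by (rule cone_comp[OF assms(1) limit_cone[OF assms(2)] assms(3)])
  then have "\<exists>!x. x \<in> hom C U L \<and> (\<forall>i\<in>I. e i \<cdot> x = e i \<cdot> h)" using assms(2) unfolding is_limit_def by blast
  then obtain k where k: "\<And>x. x \<in> hom C U L \<and> (\<forall>i\<in>I. e i \<cdot> x = e i \<cdot> h) \<Longrightarrow> x = k"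
    by (elim ex1E) blast
  show ?thesis by (rule trans[OF k[of h] sym[OF k[of h']]]) (use assms(3-5) in simp_all)
qed

lemma limitI:
  assumes "cone D E I L e"
    "\<And>U x. cone D E I U x \<Longrightarrow> \<exists>h. h \<in> hom C U L \<and> (\<forall>i\<in>I. e i \<cdot> h = x i)"
    "\<And>U h h'. h \<in> hom C U L \<Longrightarrow> h' \<in> hom C U L \<Longrightarrow> (\<And>i. i \<in> I \<Longrightarrow> e i \<cdot> h = e i \<cdot> h') \<Longrightarrow> h = h'"
  shows "limit D E I L e"
  unfolding is_limit_def
  apply (intro conjI allI impI ex_ex1I)
  subgoal by (rule assms(1))
  subgoal by (rule assms(2))
  subgoal by (metis assms(3))
  done

text \<open>By Yoneda \<open>e\<close> is a morphism from \<open>U\<close> to the presheaf of cones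
  on \<open>I\<close>. The object \<open>W\<close>, with \<open>c\<close> and \<open>e'\<close>,
  represents its fibre product with the presheaf of cones on \<open>J\<close>; the last two clauses
  are existence and uniqueness of the morphism into \<open>W\<close>.\<close>

definition cover_ext :: "('i \<Rightarrow> 'o) \<Rightarrow> ('i \<times> 'i \<times> 'm) set \<Rightarrow> 'i set \<Rightarrow> 'i set \<Rightarrow> 'o \<Rightarrow> ('i \<Rightarrow> 'm)
    \<Rightarrow> 'o \<Rightarrow> 'm \<Rightarrow> ('i \<Rightarrow> 'm) \<Rightarrow> bool" where
  "cover_ext D E I J U e W c e' \<longleftrightarrow>
     c \<in> cov \<and> c \<in> hom C W U \<and> cone D E J W e' \<and> (\<forall>i\<in>I. e' i = e i \<cdot> c) \<and>
     (\<forall>V u x. u \<in> hom C V U \<longrightarrow> cone D E J V x \<longrightarrow> (\<forall>i\<in>I. x i = e i \<cdot> u) \<longrightarrow>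
        (\<exists>h. h \<in> hom C V W \<and> c \<cdot> h = u \<and> (\<forall>j\<in>J. e' j \<cdot> h = x j))) \<and>
     (\<forall>V h h'. h \<in> hom C V W \<longrightarrow> h' \<in> hom C V W \<longrightarrow> c \<cdot> h = c \<cdot> h' \<longrightarrow>
        (\<forall>j\<in>J. e' j \<cdot> h = e' j \<cdot> h') \<longrightarrow> h = h')"

text \<open>The restriction map from cones on \<open>J\<close> to cones on \<open>I\<close>, a map of presheaves on \<open>C\<close>, is
  relatively representable by covers. Working with these presheaves makes it unnecessary to
  know that the intermediate ones are representable.\<close>
definition rel_cover :: "('i \<Rightarrow> 'o) \<Rightarrow> ('i \<times> 'i \<times> 'm) set \<Rightarrow> 'i set \<Rightarrow> 'i set \<Rightarrow> bool" where
  "rel_cover D E I J \<longleftrightarrow> (\<forall>U e. cone D E I U e \<longrightarrow> (\<exists>W c e'. cover_ext D E I J U e W c e'))"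

lemma rel_coverE:
  assumes "rel_cover D E I J" "cone D E I U e"
  obtains W c e' where "cover_ext D E I J U e W c e'"
  using assms unfolding rel_cover_def by blast

lemma cover_extD:
  assumes "cover_ext D E I J U e W c e'"
  shows "c \<in> cov" "c \<in> hom C W U" "cone D E J W e'" "\<And>i. i \<in> I \<Longrightarrow> e' i = e i \<cdot> c"
    and "\<And>V u x. u \<in> hom C V U \<Longrightarrow> cone D E J V x \<Longrightarrow> (\<And>i. i \<in> I \<Longrightarrow> x i = e i \<cdot> u) \<Longrightarrow>
       \<exists>h. h \<in> hom C V W \<and> c \<cdot> h = u \<and> (\<forall>j\<in>J. e' j \<cdot> h = x j)"
    and "\<And>V h h'. h \<in> hom C V W \<Longrightarrow> h' \<in> hom C V W \<Longrightarrow> c \<cdot> h = c \<cdot> h' \<Longrightarrow>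
       (\<And>j. j \<in> J \<Longrightarrow> e' j \<cdot> h = e' j \<cdot> h') \<Longrightarrow> h = h'"
  using assms by (simp_all add: cover_ext_def)

lemma cover_extI:
  assumes "c \<in> cov" "c \<in> hom C W U" "cone D E J W e'" "\<And>i. i \<in> I \<Longrightarrow> e' i = e i \<cdot> c"
    "\<And>V u x. u \<in> hom C V U \<Longrightarrow> cone D E J V x \<Longrightarrow> \<forall>i\<in>I. x i = e i \<cdot> u \<Longrightarrow>
       \<exists>h. h \<in> hom C V W \<and> c \<cdot> h = u \<and> (\<forall>j\<in>J. e' j \<cdot> h = x j)"
    "\<And>V h h'. h \<in> hom C V W \<Longrightarrow> h' \<in> hom C V W \<Longrightarrow> c \<cdot> h = c \<cdot> h' \<Longrightarrow>
       \<forall>j\<in>J. e' j \<cdot> h = e' j \<cdot> h' \<Longrightarrow> h = h'"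
  shows "\<exists>W c e'. cover_ext D E I J U e W c e'"
  apply (rule exI[of _ W], rule exI[of _ c], rule exI[of _ e'])
  unfolding cover_ext_def
  by (intro conjI ballI allI impI; (erule (3) assms(6) | rule assms; assumption | rule assms))

lemma rel_cover_refl:
  assumes "wf_graph D E"
  shows "rel_cover D E I I"
  unfolding rel_cover_def
proof (intro allI impI)
  fix U e assume e: "cone D E I U e"
  have U: "U \<in> Obj C" using coneD(1)[OF e] .
  show "\<exists>W c e'. cover_ext D E I I U e W c e'"
  proof (rule cover_extI[OF cov_id[OF U] id_in_hom[OF U] e])
    show "e i = e i \<cdot> Idm C U" if "i \<in> I" for i using comp_id(1)[OF coneD(2)[OF e that]] by simp
  next
    fix V u x assume "u \<in> hom C V U" "\<forall>i\<in>I. x i = e i \<cdot> u"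
    then show "\<exists>h. h \<in> hom C V U \<and> Idm C U \<cdot> h = u \<and> (\<forall>j\<in>I. e j \<cdot> h = x j)"
      using comp_id(2) by (intro exI[of _ u]) simp
  next
    fix V h h' assume "h \<in> hom C V U" "h' \<in> hom C V U" "Idm C U \<cdot> h = Idm C U \<cdot> h'"
    then show "h = h'" by (simp add: comp_id(2))
  qed
qed

text \<open>Pasting of fibre squares: the object that covers \<open>U\<close> for the step from
  \<open>I\<close> to \<open>J\<close> becomes the base of the step from \<open>J\<close> to
  \<open>K\<close>, and covers compose.\<close>

lemma rel_cover_comp:
  assumes wf: "wf_graph D E" and IJ: "I \<subseteq> J" and JK: "J \<subseteq> K"
    and "rel_cover D E I J" "rel_cover D E J K"
  shows "rel_cover D E I K"
  unfolding rel_cover_def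
proof (intro allI impI)
  fix U e assume e: "cone D E I U e"
  obtain W c z1 where ce: "cover_ext D E I J U e W c z1"
    by (rule rel_coverE[OF assms(4) e])
  note W = cover_extD(1-4)[OF ce] and ex = cover_extD(5)[OF ce] and un = cover_extD(6)[OF ce]
  obtain W' c' z2 where ce': "cover_ext D E J K W z1 W' c' z2"
    by (rule rel_coverE[OF assms(5) W(3)])
  note W' = cover_extD(1-4)[OF ce'] and ex' = cover_extD(5)[OF ce'] and un' = cover_extD(6)[OF ce']
  have c: "c \<cdot> c' \<in> cov" "c \<cdot> c' \<in> hom C W' U"
    by (rule cov_comp comp_in_hom; fact)+
  have eq2: "z2 i = e i \<cdot> (c \<cdot> c')" if "i \<in> I" for i
    using W(4)[OF that] W'(4)[of i] IJ that comp_assoc[OF W'(2) W(2) coneD(2)[OF e that]] by auto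
  have ex2: "\<exists>h. h \<in> hom C V W' \<and> c \<cdot> c' \<cdot> h = u \<and> (\<forall>j\<in>K. z2 j \<cdot> h = x j)"
    if u: "u \<in> hom C V U" and x: "cone D E K V x" and eq: "\<forall>i\<in>I. x i = e i \<cdot> u" for V u x
  proof -
    obtain h where h: "h \<in> hom C V W" "c \<cdot> h = u" "\<forall>j\<in>J. z1 j \<cdot> h = x j"
      using ex[OF u cone_mono[OF x JK]] eq by blast
    obtain h' where h': "h' \<in> hom C V W'" "c' \<cdot> h' = h" "\<forall>j\<in>K. z2 j \<cdot> h' = x j"
      using ex'[OF h(1) x] h(3) by metis
    show ?thesis using h' h comp_assoc[OF h'(1) W'(2) W(2)] by auto
  qed
  have un2: "h = h'"
    if h: "h \<in> hom C V W'" "h' \<in> hom C V W'" "c \<cdot> c' \<cdot> h = c \<cdot> c' \<cdot> h'" "\<forall>j\<in>K. z2 j \<cdot> h = z2 j \<cdot> h'" for V h h'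
  proof (rule un'[OF h(1,2)])
    show "z2 j \<cdot> h = z2 j \<cdot> h'" if "j \<in> K" for j using h that by blast
    show "c' \<cdot> h = c' \<cdot> h'"
    proof (rule un[of _ V])
      show "c' \<cdot> h \<in> hom C V W" "c' \<cdot> h' \<in> hom C V W" by (rule comp_in_hom; fact)+
      show "c \<cdot> (c' \<cdot> h) = c \<cdot> (c' \<cdot> h')"
        using h(3) comp_assoc[OF h(1) W'(2) W(2)] comp_assoc[OF h(2) W'(2) W(2)] by simp
      show "z1 j \<cdot> (c' \<cdot> h) = z1 j \<cdot> (c' \<cdot> h')" if "j \<in> J" for j
        using bspec[OF h(4) subsetD[OF JK that]] W'(4)[OF that] comp_assoc[OF h(1) W'(2) coneD(2)[OF W(3) that]]
          comp_assoc[OF h(2) W'(2) coneD(2)[OF W(3) that]] by simp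
    qed
  qed
  show "\<exists>W c e'. cover_ext D E I K U e W c e'"
    by (rule cover_extI[OF c W'(3) eq2 ex2 un2])
qed

text \<open>No edge leaves either closed set, so a cone on \<open>I \<union> J\<close> is a pair of
  cones that agree on \<open>I \<inter> J\<close>. Restriction to \<open>I\<close> is therefore a
  base change of restriction from \<open>J\<close> to \<open>I \<inter> J\<close>, and the same
  \<open>W\<close> and \<open>c\<close> serve.\<close>

lemma rel_cover_union:
  assumes wf: "wf_graph D E" and cl: "closed E I" "closed E J"
    and "rel_cover D E (I \<inter> J) J"
  shows "rel_cover D E I (I \<union> J)"
  unfolding rel_cover_def
proof (intro allI impI)
  fix U e assume e: "cone D E I U e"
  obtain W c z1 where ce: "cover_ext D E (I \<inter> J) J U e W c z1"
    by (rule rel_coverE[OF assms(4) cone_mono[OF e Int_lower1]])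
  note W = cover_extD(1-4)[OF ce] and ex = cover_extD(5)[OF ce] and un = cover_extD(6)[OF ce]
  define z2 where "z2 = (\<lambda>i. if i \<in> J then z1 i else e i \<cdot> c)"
  have eI: "cone D E I W (\<lambda>i. e i \<cdot> c)" by (rule cone_comp[OF wf e W(2)])
  have z2I: "z2 i = e i \<cdot> c" if "i \<in> I" for i using that W(4) by (auto simp: z2_def)
  have z2: "cone D E (I \<union> J) W z2"
  proof (rule coneI)
    show "W \<in> Obj C" using coneD(1)[OF eI] .
    show "z2 i \<in> hom C W (D i)" if "i \<in> I \<union> J" for i
      using that coneD(2)[OF eI] coneD(2)[OF W(3)] by (auto simp: z2_def)
    show "u \<cdot> z2 i = z2 j" if u: "(i,j,u) \<in> E" "i \<in> I \<union> J" for i j u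
    proof (cases "i \<in> J")
      case True
      then show ?thesis using closedD[OF cl(2) u(1)] coneD(3)[OF W(3) u(1)] by (simp add: z2_def)
    next
      case False
      then have "i \<in> I" using u by blast
      then show ?thesis using closedD[OF cl(1) u(1)] coneD(3)[OF eI u(1)] z2I by simp
    qed
  qed
  have ex2: "\<exists>h. h \<in> hom C V W \<and> c \<cdot> h = u \<and> (\<forall>j\<in>I \<union> J. z2 j \<cdot> h = x j)"
    if u: "u \<in> hom C V U" and x: "cone D E (I \<union> J) V x" and eq: "\<forall>i\<in>I. x i = e i \<cdot> u" for V u x
  proof -
    obtain h where h: "h \<in> hom C V W" "c \<cdot> h = u" "\<forall>j\<in>J. z1 j \<cdot> h = x j"
      using ex[OF u cone_mono[OF x]] eq by blast
    have "z2 j \<cdot> h = x j" if "j \<in> I" for j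
      using z2I[OF that] h(2) bspec[OF eq that] comp_assoc[OF h(1) W(2) coneD(2)[OF e that]] by simp
    moreover have "z2 j \<cdot> h = x j" if "j \<in> J" for j
      using h(3) that by (simp add: z2_def)
    ultimately show ?thesis using h(1,2) by (intro exI[of _ h]) blast
  qed
  have un2: "h = h'" if "h \<in> hom C V W" "h' \<in> hom C V W" "c \<cdot> h = c \<cdot> h'"
    "\<forall>j\<in>I \<union> J. z2 j \<cdot> h = z2 j \<cdot> h'" for V h h'
  proof (rule un[OF that(1-3)])
    show "z1 j \<cdot> h = z1 j \<cdot> h'" if "j \<in> J" for j
      using bspec[OF \<open>\<forall>j\<in>I \<union> J. z2 j \<cdot> h = z2 j \<cdot> h'\<close>, of j] that by (simp add: z2_def)
  qed
  show "\<exists>W c e'. cover_ext D E I (I \<union> J) U e W c e'"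
    by (rule cover_extI[OF W(1,2) z2 z2I ex2 un2])
qed

text \<open>When limits represent both presheaves, the fibre product over an element
  \<open>u\<close> of \<open>L1\<close> is the pullback of \<open>r\<close> along \<open>u\<close>,
  and covers are stable under pullback.\<close>

lemma rel_cover_if_cov:
  assumes wf: "wf_graph D E" and IJ: "I \<subseteq> J"
    and L1: "limit D E I L1 z1" and L2: "limit D E J L2 z2"
    and r: "r \<in> hom C L2 L1" "\<And>i. i \<in> I \<Longrightarrow> z1 i \<cdot> r = z2 i" and cov: "r \<in> cov"
  shows "rel_cover D E I J"
  unfolding rel_cover_def
proof (intro allI impI)
  fix U e assume e: "cone D E I U e"
  obtain u where u: "u \<in> hom C U L1" "\<And>i. i \<in> I \<Longrightarrow> z1 i \<cdot> u = e i"
    using limit_ex[OF L1 e] by blast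
  obtain W p c where pb: "is_pullback C r u W p c"
    using pullback_exists[OF r(1) u(1)] by blast
  note pc = pullback_hom[OF pb r(1) u(1)]
  have c: "c \<in> cov" by (rule cov_pullback[OF pb cov])
  have z2: "cone D E J W (\<lambda>j. z2 j \<cdot> p)" by (rule cone_comp[OF wf limit_cone[OF L2] pc(1)])
  have z1h: "\<And>i. i \<in> I \<Longrightarrow> z1 i \<in> hom C L1 (D i)" and z2h: "\<And>i. i \<in> J \<Longrightarrow> z2 i \<in> hom C L2 (D i)"
    using coneD(2)[OF limit_cone[OF L1]] coneD(2)[OF limit_cone[OF L2]] by blast+
  have eq2: "z2 i \<cdot> p = e i \<cdot> c" if "i \<in> I" for i
    using r(2)[OF that] u(2)[OF that] comp_assoc[OF pc(1) r(1) z1h[OF that]] comp_assoc[OF pc(2) u(1) z1h[OF that]] pc(3)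
    by simp
  have ex2: "\<exists>h. h \<in> hom C V W \<and> c \<cdot> h = v \<and> (\<forall>j\<in>J. z2 j \<cdot> p \<cdot> h = x j)"
    if v: "v \<in> hom C V U" and x: "cone D E J V x" and eq: "\<forall>i\<in>I. x i = e i \<cdot> v" for V v x
  proof -
    obtain k where k: "k \<in> hom C V L2" "\<And>j. j \<in> J \<Longrightarrow> z2 j \<cdot> k = x j"
      using limit_ex[OF L2 x] by blast
    have "r \<cdot> k = u \<cdot> v"
    proof (rule limit_eqI[OF wf L1])
      show "r \<cdot> k \<in> hom C V L1" "u \<cdot> v \<in> hom C V L1" by (rule comp_in_hom; fact)+
      show "z1 i \<cdot> (r \<cdot> k) = z1 i \<cdot> (u \<cdot> v)" if "i \<in> I" for i
        using comp_assoc[OF k(1) r(1) z1h[OF that]] comp_assoc[OF v u(1) z1h[OF that]] k(2)[OF subsetD[OF IJ that]]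
          r(2)[OF that] u(2)[OF that] bspec[OF eq that] by simp
    qed
    then obtain h where h: "h \<in> hom C V W" "p \<cdot> h = k" "c \<cdot> h = v"
      using pullback_ex[OF pb r(1) u(1) k(1) v] by blast
    have "z2 j \<cdot> p \<cdot> h = x j" if "j \<in> J" for j
      using k(2)[OF that] h comp_assoc[OF h(1) pc(1) z2h[OF that]] by simp
    then show ?thesis using h by blast
  qed
  have un2: "h = h'" if h: "h \<in> hom C V W" "h' \<in> hom C V W" "c \<cdot> h = c \<cdot> h'"
    "\<forall>j\<in>J. z2 j \<cdot> p \<cdot> h = z2 j \<cdot> p \<cdot> h'" for V h h'
  proof -
    have "p \<cdot> h = p \<cdot> h'"
    proof (rule limit_eqI[OF wf L2])
      show "p \<cdot> h \<in> hom C V L2" "p \<cdot> h' \<in> hom C V L2" by (rule comp_in_hom; fact)+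
      show "z2 j \<cdot> (p \<cdot> h) = z2 j \<cdot> (p \<cdot> h')" if "j \<in> J" for j
        using h(4) that comp_assoc[OF h(1) pc(1) z2h[OF that]] comp_assoc[OF h(2) pc(1) z2h[OF that]] by simp
    qed
    then show ?thesis using pullback_eqI[OF pb r(1) u(1) h(1,2)] h(3) by blast
  qed
  show "\<exists>W c e'. cover_ext D E I J U e W c e'"
    by (rule cover_extI[OF c pc(2) z2 eq2 ex2 un2])
qed

text \<open>Relative representability is applied to the universal cone on \<open>I\<close>: the
  fibre product over the representing object of the base is the whole presheaf of cones on
  \<open>J\<close>, which thereby gets a limit without any assumption on \<open>J\<close>.\<close>

lemma limit_of_rel_cover:
  assumes wf: "wf_graph D E" and IJ: "I \<subseteq> J" and L: "limit D E I L e" and rc: "rel_cover D E I J"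
  shows "\<exists>W c e'. c \<in> cov \<and> c \<in> hom C W L \<and> limit D E J W e' \<and> (\<forall>i\<in>I. e i \<cdot> c = e' i)"
proof -
  obtain W c e' where ce: "cover_ext D E I J L e W c e'"
    by (rule rel_coverE[OF rc limit_cone[OF L]])
  note W = cover_extD(1-4)[OF ce] and ex = cover_extD(5)[OF ce] and un = cover_extD(6)[OF ce]
  have "limit D E J W e'"
  proof (rule limitI[OF W(3)])
    fix U x assume x: "cone D E J U x"
    obtain u where u: "u \<in> hom C U L" "\<And>i. i \<in> I \<Longrightarrow> e i \<cdot> u = x i"
      using limit_ex[OF L cone_mono[OF x IJ]] by blast
    show "\<exists>h. h \<in> hom C U W \<and> (\<forall>j\<in>J. e' j \<cdot> h = x j)" using ex[OF u(1) x] u(2) by metis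
  next
    fix U h h' assume h: "h \<in> hom C U W" "h' \<in> hom C U W" and eq: "\<And>j. j \<in> J \<Longrightarrow> e' j \<cdot> h = e' j \<cdot> h'"
    have "c \<cdot> h = c \<cdot> h'"
    proof (rule limit_eqI[OF wf L])
      show "c \<cdot> h \<in> hom C U L" "c \<cdot> h' \<in> hom C U L" by (rule comp_in_hom; fact)+
      show "e i \<cdot> (c \<cdot> h) = e i \<cdot> (c \<cdot> h')" if "i \<in> I" for i
        using eq[OF subsetD[OF IJ that]] W(4)[OF that] comp_assoc[OF h(1) W(2) coneD(2)[OF limit_cone[OF L] that]]
          comp_assoc[OF h(2) W(2) coneD(2)[OF limit_cone[OF L] that]] by simp
    qed
    then show "h = h'" using un[OF h] eq by blast
  qed
  then show ?thesis using W by (intro exI[of _ W] exI[of _ c] exI[of _ e']) simp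
qed

text \<open>\<open>limit_of_rel_cover\<close> yields a limit on \<open>J\<close> that covers
  \<open>L1\<close> through \<open>c\<close>; by uniqueness of limits \<open>r\<close> differs from
  \<open>c\<close> by an isomorphism over \<open>L1\<close>.\<close>

lemma cov_if_rel_cover:
  assumes wf: "wf_graph D E" and IJ: "I \<subseteq> J"
    and L1: "limit D E I L1 z1" and L2: "limit D E J L2 z2"
    and r: "r \<in> hom C L2 L1" "\<And>i. i \<in> I \<Longrightarrow> z1 i \<cdot> r = z2 i" and rc: "rel_cover D E I J"
  shows "r \<in> cov"
proof -
  obtain W c e' where W: "c \<in> cov" "c \<in> hom C W L1" "limit D E J W e'" "\<And>i. i \<in> I \<Longrightarrow> z1 i \<cdot> c = e' i"
    using limit_of_rel_cover[OF wf IJ L1 rc] by blast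
  obtain h where h: "h \<in> hom C L2 W" "\<And>j. j \<in> J \<Longrightarrow> e' j \<cdot> h = z2 j"
    using limit_ex[OF W(3) limit_cone[OF L2]] by blast
  note z1h = coneD(2)[OF limit_cone[OF L1]] and z2h = coneD(2)[OF limit_cone[OF L2]]
    and e'h = coneD(2)[OF limit_cone[OF W(3)]]
  have over: "c \<cdot> y = r \<cdot> x" if y: "y \<in> hom C V W" and x: "x \<in> hom C V L2"
    and eq: "\<And>j. j \<in> J \<Longrightarrow> e' j \<cdot> y = z2 j \<cdot> x" for V x y
  proof (rule limit_eqI[OF wf L1])
    show "c \<cdot> y \<in> hom C V L1" "r \<cdot> x \<in> hom C V L1"
      by (rule comp_in_hom[OF y W(2)], rule comp_in_hom[OF x r(1)])
    show "z1 i \<cdot> (c \<cdot> y) = z1 i \<cdot> (r \<cdot> x)" if "i \<in> I" for i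
      using comp_assoc[OF y W(2) z1h[OF that]] comp_assoc[OF x r(1) z1h[OF that]] W(4)[OF that] r(2)[OF that]
        eq[OF subsetD[OF IJ that]] by simp
  qed
  have L1o: "L1 \<in> Obj C" and L2o: "L2 \<in> Obj C" using hom_obj[OF r(1)] by blast+
  have "c \<cdot> h = r \<cdot> Idm C L2"
    by (rule over[OF h(1) id_in_hom[OF L2o]]) (simp add: h(2) comp_id(1)[OF z2h])
  then have ch: "c \<cdot> h = r" using comp_id(1)[OF r(1)] by simp
  \<comment> \<open>Exhibiting \<open>r\<close> as a base change of \<open>c\<close> along an
    identity lets pullback stability absorb the isomorphism \<open>h\<close>.\<close>
  have "is_pullback C c (Idm C L1) L2 h r"
  proof (rule pullback_intro[OF W(2) id_in_hom[OF L1o] h(1) r(1)])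
    show "c \<cdot> h = Idm C L1 \<cdot> r" using ch comp_id(2)[OF r(1)] by simp
  next
    fix P' p' q' assume h': "p' \<in> hom C P' W" "q' \<in> hom C P' L1" "c \<cdot> p' = Idm C L1 \<cdot> q'"
    obtain k where k: "k \<in> hom C P' L2" "\<And>j. j \<in> J \<Longrightarrow> z2 j \<cdot> k = e' j \<cdot> p'"
      using limit_ex[OF L2 cone_comp[OF wf limit_cone[OF W(3)] h'(1)]] by blast
    have "h \<cdot> k = p'"
    proof (rule limit_eqI[OF wf W(3)])
      show "h \<cdot> k \<in> hom C P' W" "p' \<in> hom C P' W" by (rule comp_in_hom[OF k(1) h(1)], fact)
      show "e' j \<cdot> (h \<cdot> k) = e' j \<cdot> p'" if "j \<in> J" for j
        using comp_assoc[OF k(1) h(1) e'h[OF that]] h(2)[OF that] k(2)[OF that] by simp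
    qed
    moreover have "c \<cdot> p' = r \<cdot> k"
      by (rule over[OF h'(1) k(1)]) (simp add: k(2))
    then have "r \<cdot> k = q'"
      using h'(3) comp_id(2)[OF h'(2)] by simp
    ultimately show "\<exists>k. k \<in> hom C P' L2 \<and> h \<cdot> k = p' \<and> r \<cdot> k = q'" using k by blast
  next
    fix P' k k' assume k: "k \<in> hom C P' L2" "k' \<in> hom C P' L2" "h \<cdot> k = h \<cdot> k'" "r \<cdot> k = r \<cdot> k'"
    show "k = k'"
    proof (rule limit_eqI[OF wf L2 k(1,2)])
      show "z2 j \<cdot> k = z2 j \<cdot> k'" if "j \<in> J" for j
        using comp_assoc[OF k(1) h(1) e'h[OF that]] comp_assoc[OF k(2) h(1) e'h[OF that]] h(2)[OF that] k(3) by simp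
    qed
  qed
  then show ?thesis by (rule cov_pullback[OF _ W(1)])
qed

text \<open>The cancellation axiom speaks of morphisms of \<open>C\<close>, hence the limits on
  \<open>I\<close> and \<open>J\<close>. The one on \<open>K\<close> is produced by
  \<open>limit_of_rel_cover\<close>, so the largest complex needs no mapping object in
  advance.\<close>

lemma rel_cover_cancel:
  assumes wf: "wf_graph D E" and IJ: "I \<subseteq> J" and JK: "J \<subseteq> K"
    and L1: "limit D E I L1 z1" and L2: "limit D E J L2 z2"
    and IK: "rel_cover D E I K" and JKr: "rel_cover D E J K"
  shows "rel_cover D E I J"
proof -
  obtain r where r: "r \<in> hom C L2 L1" "\<And>i. i \<in> I \<Longrightarrow> z1 i \<cdot> r = z2 i"
    using limit_ex[OF L1 cone_mono[OF limit_cone[OF L2] IJ]] by blast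
  obtain W c e' where W: "c \<in> cov" "c \<in> hom C W L2" "limit D E K W e'" "\<And>i. i \<in> J \<Longrightarrow> z2 i \<cdot> c = e' i"
    using limit_of_rel_cover[OF wf JK L2 JKr] by blast
  have "r \<cdot> c \<in> cov"
  proof (rule cov_if_rel_cover[OF wf _ L1 W(3) _ _ IK])
    show "I \<subseteq> K" "r \<cdot> c \<in> hom C W L1" using IJ JK by (blast, intro comp_in_hom[OF W(2) r(1)])
    show "z1 i \<cdot> (r \<cdot> c) = e' i" if "i \<in> I" for i
      using comp_assoc[OF W(2) r(1) coneD(2)[OF limit_cone[OF L1] that]] r(2)[OF that] W(4)[OF subsetD[OF IJ that]] by simp
  qed
  then have "r \<in> cov" by (rule cov_cancel[OF W(1,2) r(1)])
  from rel_cover_if_cov[OF wf IJ L1 L2 r this] show ?thesis .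
qed

text \<open>Natural bijections between the cones of two diagrams that are given, index by index, by
  reindexing along \<open>g\<close> and composing with \<open>m\<close>.\<close>
definition cone_equiv :: "('i \<Rightarrow> 'o) \<Rightarrow> ('i \<times> 'i \<times> 'm) set \<Rightarrow> 'i set \<Rightarrow> ('j \<Rightarrow> 'o) \<Rightarrow> ('j \<times> 'j \<times> 'm) set \<Rightarrow> 'j set
    \<Rightarrow> ('i \<Rightarrow> 'j) \<Rightarrow> ('i \<Rightarrow> 'm) \<Rightarrow> bool" where
  "cone_equiv D E I D' E' I' g m \<longleftrightarrow>
     (\<forall>i\<in>I. g i \<in> I' \<and> m i \<in> hom C (D' (g i)) (D i)) \<and>
     (\<forall>U e. cone D' E' I' U e \<longrightarrow> cone D E I U (\<lambda>i. m i \<cdot> e (g i))) \<and>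
     (\<forall>U e. cone D E I U e \<longrightarrow> (\<exists>e'. cone D' E' I' U e' \<and> (\<forall>i\<in>I. m i \<cdot> e' (g i) = e i))) \<and>
     (\<forall>U e e'. cone D' E' I' U e \<longrightarrow> cone D' E' I' U e' \<longrightarrow> (\<forall>i\<in>I. m i \<cdot> e (g i) = m i \<cdot> e' (g i)) \<longrightarrow>
        (\<forall>i\<in>I'. e i = e' i))"

lemma cone_equivD:
  assumes "cone_equiv D E I D' E' I' g m"
  shows "\<And>i. i \<in> I \<Longrightarrow> g i \<in> I'" "\<And>i. i \<in> I \<Longrightarrow> m i \<in> hom C (D' (g i)) (D i)"
    "\<And>U e. cone D' E' I' U e \<Longrightarrow> cone D E I U (\<lambda>i. m i \<cdot> e (g i))"
    "\<And>U e. cone D E I U e \<Longrightarrow> \<exists>e'. cone D' E' I' U e' \<and> (\<forall>i\<in>I. m i \<cdot> e' (g i) = e i)"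
    "\<And>U e e'. cone D' E' I' U e \<Longrightarrow> cone D' E' I' U e' \<Longrightarrow> (\<And>i. i \<in> I \<Longrightarrow> m i \<cdot> e (g i) = m i \<cdot> e' (g i)) \<Longrightarrow>
        \<forall>i\<in>I'. e i = e' i"
    "\<And>V V' h x i. h \<in> hom C V V' \<Longrightarrow> cone D' E' I' V' x \<Longrightarrow> i \<in> I \<Longrightarrow> m i \<cdot> x (g i) \<cdot> h = m i \<cdot> (x (g i) \<cdot> h)"
proof -
  show g: "g i \<in> I'" "m i \<in> hom C (D' (g i)) (D i)" if "i \<in> I" for i
    using that assms unfolding cone_equiv_def by blast+
  show "cone D E I U (\<lambda>i. m i \<cdot> e (g i))" if "cone D' E' I' U e" for U e
    using that assms unfolding cone_equiv_def by blast
  show "\<exists>e'. cone D' E' I' U e' \<and> (\<forall>i\<in>I. m i \<cdot> e' (g i) = e i)" if "cone D E I U e" for U e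
    using that assms unfolding cone_equiv_def by blast
  show "\<forall>i\<in>I'. e i = e' i" if "cone D' E' I' U e" "cone D' E' I' U e'"
    "\<And>i. i \<in> I \<Longrightarrow> m i \<cdot> e (g i) = m i \<cdot> e' (g i)" for U e e'
    using that assms unfolding cone_equiv_def by blast
  show "m i \<cdot> x (g i) \<cdot> h = m i \<cdot> (x (g i) \<cdot> h)"
    if "h \<in> hom C V V'" "cone D' E' I' V' x" "i \<in> I" for V V' h x i
    using comp_assoc[OF that(1) coneD(2)[OF that(2) g(1)[OF that(3)]] g(2)[OF that(3)]] by simp
qed

text \<open>The covering object stays the same. Its universal cone is carried through the bijection,
  and injectivity turns equations between translated components into equations between the original
  ones.\<close>

lemma cone_equiv_rel_cover:
  assumes wf: "wf_graph D E" and wf': "wf_graph D' E'"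
    and IJ: "I \<subseteq> J" and IJ': "I' \<subseteq> J'"
    and eqI: "cone_equiv D E I D' E' I' g m" and eqJ: "cone_equiv D E J D' E' J' g m"
    and rc: "rel_cover D E I J"
  shows "rel_cover D' E' I' J'"
  unfolding rel_cover_def
proof (intro allI impI)
  let ?B = "\<lambda>e i. m i \<cdot> e (g i)"
  fix U e assume e: "cone D' E' I' U e"
  note gI = cone_equivD(1,2)[OF eqI] and gJ = cone_equivD(1,2)[OF eqJ] and BI = cone_equivD(3)[OF eqI]
    and BJ = cone_equivD(3)[OF eqJ] and injI = cone_equivD(5)[OF eqI] and injJ = cone_equivD(5)[OF eqJ]
    and BcI = cone_equivD(6)[OF eqI] and BcJ = cone_equivD(6)[OF eqJ]
  obtain W c z1 where ce: "cover_ext D E I J U (?B e) W c z1"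
    by (rule rel_coverE[OF rc BI[OF e]])
  note W = cover_extD(1-4)[OF ce] and ex = cover_extD(5)[OF ce] and un = cover_extD(6)[OF ce]
  obtain z2 where z2: "cone D' E' J' W z2" "\<And>i. i \<in> J \<Longrightarrow> ?B z2 i = z1 i"
    using cone_equivD(4)[OF eqJ W(3)] by blast
  have "\<forall>i\<in>I'. z2 i = e i \<cdot> c"
  proof (rule injI)
    show "cone D' E' I' W z2" using cone_mono[OF z2(1) IJ'] .
    show "cone D' E' I' W (\<lambda>i. e i \<cdot> c)" by (rule cone_comp[OF wf' e W(2)])
    show "?B z2 i = m i \<cdot> (e (g i) \<cdot> c)" if "i \<in> I" for i
      using z2(2)[OF subsetD[OF IJ that]] W(4)[OF that] BcI[OF W(2) e that] by simp
  qed
  then have eq2: "\<And>i. i \<in> I' \<Longrightarrow> z2 i = e i \<cdot> c" by blast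
  have ex2: "\<exists>h. h \<in> hom C V W \<and> c \<cdot> h = u \<and> (\<forall>j\<in>J'. z2 j \<cdot> h = x j)"
    if u: "u \<in> hom C V U" and x: "cone D' E' J' V x" and eq: "\<forall>i\<in>I'. x i = e i \<cdot> u" for V u x
  proof -
    have "?B x i = ?B e i \<cdot> u" if "i \<in> I" for i
      using eq gI(1)[OF that] BcI[OF u e that] by simp
    then obtain h where h: "h \<in> hom C V W" "c \<cdot> h = u" "\<forall>j\<in>J. z1 j \<cdot> h = ?B x j"
      using ex[OF u BJ[OF x]] by metis
    have "\<forall>j\<in>J'. z2 j \<cdot> h = x j"
    proof (rule injJ[OF cone_comp[OF wf' z2(1) h(1)] x])
      show "m i \<cdot> (z2 (g i) \<cdot> h) = ?B x i" if "i \<in> J" for i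
        using BcJ[OF h(1) z2(1) that] z2(2)[OF that] h(3) that by simp
    qed
    then show ?thesis using h by blast
  qed
  have un2: "h = h'" if h: "h \<in> hom C V W" "h' \<in> hom C V W" "c \<cdot> h = c \<cdot> h'"
    "\<forall>j\<in>J'. z2 j \<cdot> h = z2 j \<cdot> h'" for V h h'
  proof (rule un[OF h(1-3)])
    show "z1 j \<cdot> h = z1 j \<cdot> h'" if "j \<in> J" for j
      using BcJ[OF h(1) z2(1) that] BcJ[OF h(2) z2(1) that] z2(2)[OF that] h(4) gJ(1)[OF that] by simp
  qed
  show "\<exists>W c e'. cover_ext D' E' I' J' U e W c e'"
    by (rule cover_extI[OF W(1,2) z2(1) eq2 ex2 un2])
qed

text \<open>\<open>cone_equiv\<close> is asymmetric: only one of the two passages is given component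
  by component, the inverse is merely known to exist. The transfer in this direction therefore
  starts from a chosen preimage \<open>d\<close> of the given cone.\<close>

lemma cone_equiv_rel_cover':
  assumes wf: "wf_graph D E" and wf': "wf_graph D' E'"
    and IJ: "I \<subseteq> J" and IJ': "I' \<subseteq> J'"
    and cl: "closed E I" "closed E J"
    and eqI: "cone_equiv D E I D' E' I' g m" and eqJ: "cone_equiv D E J D' E' J' g m"
    and rc: "rel_cover D' E' I' J'"
  shows "rel_cover D E I J"
  unfolding rel_cover_def
proof (intro allI impI)
  let ?B = "\<lambda>e i. m i \<cdot> e (g i)"
  fix U e assume e: "cone D E I U e"
  note gI = cone_equivD(1,2)[OF eqI] and gJ = cone_equivD(1,2)[OF eqJ]
    and BJ = cone_equivD(3)[OF eqJ] and injI = cone_equivD(5)[OF eqI] and injJ = cone_equivD(5)[OF eqJ]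
    and BcI = cone_equivD(6)[OF eqI] and BcJ = cone_equivD(6)[OF eqJ]
  obtain d where d: "cone D' E' I' U d" "\<And>i. i \<in> I \<Longrightarrow> ?B d i = e i"
    using cone_equivD(4)[OF eqI e] by blast
  obtain W c z1 where ce: "cover_ext D' E' I' J' U d W c z1"
    by (rule rel_coverE[OF rc d(1)])
  note W = cover_extD(1-4)[OF ce] and ex = cover_extD(5)[OF ce] and un = cover_extD(6)[OF ce]
  have "\<forall>i\<in>I. ?B z1 i = e i \<cdot> c"
    using W(4)[OF gI(1)] BcI[OF W(2) d(1)] d(2) by simp
  then have eq2: "\<And>i. i \<in> I \<Longrightarrow> ?B z1 i = e i \<cdot> c" by blast
  have ex2: "\<exists>h. h \<in> hom C V W \<and> c \<cdot> h = u \<and> (\<forall>j\<in>J. ?B z1 j \<cdot> h = x j)"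
    if u: "u \<in> hom C V U" and x: "cone D E J V x" and eq: "\<forall>i\<in>I. x i = e i \<cdot> u" for V u x
  proof -
    obtain y where y: "cone D' E' J' V y" "\<And>i. i \<in> J \<Longrightarrow> ?B y i = x i"
      using cone_equivD(4)[OF eqJ x] by blast
    have "\<forall>i\<in>I'. y i = d i \<cdot> u"
    proof (rule injI[OF cone_mono[OF y(1) IJ'] cone_comp[OF wf' d(1) u]])
      show "?B y i = m i \<cdot> (d (g i) \<cdot> u)" if "i \<in> I" for i
        using y(2)[OF subsetD[OF IJ that]] BcI[OF u d(1) that] d(2)[OF that] bspec[OF eq that] by simp
    qed
    then obtain h where h: "h \<in> hom C V W" "c \<cdot> h = u" "\<forall>j\<in>J'. z1 j \<cdot> h = y j"
      using ex[OF u y(1)] by metis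
    have "\<forall>j\<in>J. ?B z1 j \<cdot> h = x j"
      using BcJ[OF h(1) W(3)] h(3) gJ(1) y(2) by simp
    then show ?thesis using h by blast
  qed
  have un2: "h = h'" if h: "h \<in> hom C V W" "h' \<in> hom C V W" "c \<cdot> h = c \<cdot> h'"
    "\<forall>j\<in>J. ?B z1 j \<cdot> h = ?B z1 j \<cdot> h'" for V h h'
  proof (rule un[OF h(1-3)])
    have "\<forall>j\<in>J'. z1 j \<cdot> h = z1 j \<cdot> h'"
    proof (rule injJ[OF cone_comp[OF wf' W(3) h(1)] cone_comp[OF wf' W(3) h(2)]])
      show "m i \<cdot> (z1 (g i) \<cdot> h) = m i \<cdot> (z1 (g i) \<cdot> h')" if "i \<in> J" for i
        using BcJ[OF h(1) W(3) that] BcJ[OF h(2) W(3) that] h(4) that by simp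
    qed
    then show "z1 j \<cdot> h = z1 j \<cdot> h'" if "j \<in> J'" for j using that by blast
  qed
  show "\<exists>W c e'. cover_ext D E I J U e W c e'"
    by (rule cover_extI[OF W(1,2) BJ[OF W(3)] eq2 ex2 un2])
qed

end

section \<open>Simplicial subsets of nerves\<close>

lemma vle_refl: "vle x x"
  by (simp add: vle_def)

lemma vle_antisym: "vle x y \<Longrightarrow> vle y x \<Longrightarrow> x = y"
  by (simp add: vle_def prod_eq_iff)

lemma nsimp_iff: "nsimp xs \<longleftrightarrow> xs \<noteq> [] \<and> sorted_wrt vle xs"
  unfolding nsimp_def sorted_wrt_iff_nth_less using vle_refl by (metis le_eq_less_or_eq)

lemma nsimp_nth: "nsimp xs \<Longrightarrow> i \<le> j \<Longrightarrow> j \<le> sdim xs \<Longrightarrow> vle (xs ! i) (xs ! j)"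
  unfolding nsimp_def sdim_def by (cases xs) auto

lemma length_sact [simp]: "length (sact \<theta> m xs) = Suc m"
  by (simp add: sact_def)

lemma sdim_sact [simp]: "sdim (sact \<theta> m xs) = m"
  by (simp add: sdim_def)

lemma sact_nth [simp]: "j \<le> m \<Longrightarrow> sact \<theta> m xs ! j = xs ! \<theta> j"
  unfolding sact_def by (simp del: upt_Suc)

lemma sact_ne [simp]: "sact \<theta> m xs \<noteq> []"
  by (metis length_sact list.size(3) nat.distinct(1))

lemma length_sdim: "xs \<noteq> [] \<Longrightarrow> length xs = Suc (sdim xs)"
  by (cases xs) (auto simp: sdim_def)

lemma nth_sdim_in: "xs \<noteq> [] \<Longrightarrow> i \<le> sdim xs \<Longrightarrow> xs ! i \<in> set xs"
  by (simp add: length_sdim)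

lemma slist_eqI:
  assumes "s \<noteq> []" "t \<noteq> []" "sdim s = sdim t" "\<And>i. i \<le> sdim s \<Longrightarrow> s ! i = t ! i"
  shows "s = t"
  using assms by (intro nth_equalityI) (auto simp: length_sdim)

lemma in_set_slist: "s \<noteq> [] \<Longrightarrow> v \<in> set s \<longleftrightarrow> (\<exists>i\<le>sdim s. v = s ! i)"
  by (auto simp: in_set_conv_nth length_sdim less_Suc_eq_le)

lemma mono_mapD: "mono_map m n \<theta> \<Longrightarrow> i \<le> m \<Longrightarrow> \<theta> i \<le> n" "mono_map m n \<theta> \<Longrightarrow> i \<le> j \<Longrightarrow> j \<le> m \<Longrightarrow> \<theta> i \<le> \<theta> j"
  by (auto simp: mono_map_def)

lemma mono_map_comp: "mono_map l m \<phi> \<Longrightarrow> mono_map m n \<theta> \<Longrightarrow> mono_map l n (\<theta> \<circ> \<phi>)"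
  by (auto simp: mono_map_def)

lemma mono_map_id: "mono_map m m id"
  by (simp add: mono_map_def)

lemma sact_comp: "mono_map l m \<phi> \<Longrightarrow> sact \<phi> l (sact \<theta> m xs) = sact (\<theta> \<circ> \<phi>) l xs"
  by (rule slist_eqI) (auto simp: mono_mapD)

lemma sact_id: "xs \<noteq> [] \<Longrightarrow> sact id (sdim xs) xs = xs"
  by (rule slist_eqI) auto

lemma nsimp_sact: "nsimp xs \<Longrightarrow> mono_map m (sdim xs) \<theta> \<Longrightarrow> nsimp (sact \<theta> m xs)"
  unfolding nsimp_def[of "sact _ _ _"] using nsimp_nth mono_mapD by simp

lemma nsimp_ne: "nsimp xs \<Longrightarrow> xs \<noteq> []"
  by (simp add: nsimp_def)

lemma set_sact_subset: "xs \<noteq> [] \<Longrightarrow> mono_map m (sdim xs) \<theta> \<Longrightarrow> set (sact \<theta> m xs) \<subseteq> set xs"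
  using nth_sdim_in mono_mapD by (auto simp: in_set_slist)

definition vpos :: "(nat \<times> nat) list \<Rightarrow> (nat \<times> nat) list \<Rightarrow> nat \<Rightarrow> nat" where
  "vpos s t j = (LEAST i. s ! i = t ! j)"

text \<open>A simplex of a poset nerve is determined by its vertices, so every simplex on vertices
  of \<open>s\<close> arises from \<open>s\<close> by an operator. Taking the least position of each
  vertex makes the operator monotone: an inversion would force two equal vertices by antisymmetry,
  and equal vertices have the same least position.\<close>

lemma vpos:
  assumes s: "nsimp s" and t: "nsimp t" and sub: "set t \<subseteq> set s"
  shows "mono_map (sdim t) (sdim s) (vpos s t)" "sact (vpos s t) (sdim t) s = t"
proof -
  have ex: "\<exists>i\<le>sdim s. s ! i = t ! j" if "j \<le> sdim t" for j
    using nth_sdim_in[OF nsimp_ne[OF t] that] sub in_set_slist[OF nsimp_ne[OF s]] by (metis subsetD)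
  have nth: "s ! vpos s t j = t ! j" if "j \<le> sdim t" for j
    unfolding vpos_def using ex[OF that] by (metis (mono_tags, lifting) LeastI)
  have le: "vpos s t j \<le> sdim s" if "j \<le> sdim t" for j
    unfolding vpos_def using ex[OF that] by (metis (mono_tags, lifting) Least_le order_trans)
  show "mono_map (sdim t) (sdim s) (vpos s t)"
    unfolding mono_map_def
  proof (intro conjI allI impI)
    fix i j assume ij: "i \<le> j" "j \<le> sdim t"
    show "vpos s t i \<le> vpos s t j"
    proof (rule ccontr)
      assume a: "\<not> vpos s t i \<le> vpos s t j"
      then have "vle (t ! j) (t ! i)"
        using nsimp_nth[OF s, of "vpos s t j" "vpos s t i"] le[of i] nth ij by simp
      moreover have "vle (t ! i) (t ! j)" using nsimp_nth[OF t] ij by simp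
      ultimately have "t ! i = t ! j" by (rule vle_antisym[rotated])
      then show False using a by (simp add: vpos_def)
    qed
  qed (use le in blast)
  show "sact (vpos s t) (sdim t) s = t"
    using nth by (intro slist_eqI) (auto simp: nsimp_ne[OF t])
qed

lemma sact_inj:
  assumes "distinct s" "s \<noteq> []" "mono_map m (sdim s) \<theta>" "mono_map m (sdim s) \<theta>'" "sact \<theta> m s = sact \<theta>' m s" "i \<le> m"
  shows "\<theta> i = \<theta>' i"
proof -
  have "s ! \<theta> i = s ! \<theta>' i" using assms(5,6) by (metis sact_nth)
  moreover have "\<theta> i < length s" "\<theta>' i < length s"
    using assms mono_mapD by (auto simp: length_sdim less_Suc_eq_le)
  ultimately show ?thesis using assms(1) nth_eq_iff_index_eq by blast
qed

lemma nsimp_remdups: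
  assumes "nsimp s"
  shows "nsimp (remdups s)"
proof -
  have "sorted_wrt vle xs \<Longrightarrow> sorted_wrt vle (remdups xs)" for xs :: "(nat \<times> nat) list"
    by (induction xs) auto
  then show ?thesis using assms by (simp add: nsimp_iff)
qed

definition subcx :: "(nat \<times> nat) list set \<Rightarrow> bool" where
  "subcx T \<longleftrightarrow> (\<forall>s\<in>T. nsimp s) \<and> (\<forall>s\<in>T. \<forall>\<theta> m. mono_map m (sdim s) \<theta> \<longrightarrow> sact \<theta> m s \<in> T)"

lemma subcxD: "subcx T \<Longrightarrow> s \<in> T \<Longrightarrow> nsimp s" "subcx T \<Longrightarrow> s \<in> T \<Longrightarrow> mono_map m (sdim s) \<theta> \<Longrightarrow> sact \<theta> m s \<in> T"
  by (auto simp: subcx_def)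

text \<open>Membership in a subcomplex thus depends on vertex sets alone, which is what makes the
  encoding by \<open>nerve\<close> possible.\<close>

lemma subcx_face:
  assumes "subcx T" "s \<in> T" "nsimp t" "set t \<subseteq> set s"
  shows "t \<in> T"
  using vpos[OF subcxD(1)[OF assms(1,2)] assms(3,4)] subcxD(2)[OF assms(1,2)] by metis

text \<open>Finiteness is asked of the vertices. It bounds the nondegenerate simplices, whereas the
  complex itself is an infinite set of lists as soon as it is nonempty.\<close>

definition fincx :: "(nat \<times> nat) list set \<Rightarrow> bool" where
  "fincx T \<longleftrightarrow> subcx T \<and> finite (\<Union>(set ` T))"

section \<open>Mapping objects\<close>

context descent
begin

lemma simplicialD:
  assumes "simplicial C X"
  shows "Lev X n \<in> Obj C" "mono_map m n \<theta> \<Longrightarrow> Act X \<theta> m n \<in> hom C (Lev X n) (Lev X m)"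
    "mono_map m n \<theta> \<Longrightarrow> (\<And>i. i \<le> m \<Longrightarrow> \<theta> i = \<theta>' i) \<Longrightarrow> Act X \<theta>' m n = Act X \<theta> m n"
    "Act X id n n = Idm C (Lev X n)"
    "mono_map l m \<phi> \<Longrightarrow> mono_map m n \<theta> \<Longrightarrow> Act X (\<theta> \<circ> \<phi>) l n = Act X \<phi> l m \<cdot> Act X \<theta> m n"
proof -
  note u = assms[unfolded simplicial_def]
  note a = u[THEN conjunct1] u[THEN conjunct2, THEN conjunct1] u[THEN conjunct2, THEN conjunct2, THEN conjunct1]
    u[THEN conjunct2, THEN conjunct2, THEN conjunct2, THEN conjunct1]
    u[THEN conjunct2, THEN conjunct2, THEN conjunct2, THEN conjunct2]
  show "Lev X n \<in> Obj C" "Act X id n n = Idm C (Lev X n)" using a by blast+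
  show "mono_map m n \<theta> \<Longrightarrow> Act X \<theta> m n \<in> hom C (Lev X n) (Lev X m)" using a(2) by blast
  show "mono_map m n \<theta> \<Longrightarrow> (\<And>i. i \<le> m \<Longrightarrow> \<theta> i = \<theta>' i) \<Longrightarrow> Act X \<theta>' m n = Act X \<theta> m n" using a(3) by blast
  show "mono_map l m \<phi> \<Longrightarrow> mono_map m n \<theta> \<Longrightarrow> Act X (\<theta> \<circ> \<phi>) l n = Act X \<phi> l m \<cdot> Act X \<theta> m n" using a(5) by blast
qed

lemma smorD:
  assumes "smor C X Y f"
  shows "f n \<in> hom C (Lev X n) (Lev Y n)" "mono_map m n \<theta> \<Longrightarrow> f m \<cdot> Act X \<theta> m n = Act Y \<theta> m n \<cdot> f n"
  using assms unfolding smor_def by blast+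

definition objs1 :: "('o,'m) sobj \<Rightarrow> (nat \<times> nat) list \<Rightarrow> 'o" where
  "objs1 X s = Lev X (sdim s)"

definition arrs1 :: "('o,'m) sobj \<Rightarrow> ((nat \<times> nat) list \<times> (nat \<times> nat) list \<times> 'm) set" where
  "arrs1 X = {(s, sact \<theta> m s, Act X \<theta> m (sdim s)) | s \<theta> m. mono_map m (sdim s) \<theta>}"

lemma map_limit_iff: "is_map_limit C X T L \<pi> \<longleftrightarrow> limit (objs1 X) (arrs1 X) T L \<pi>"
proof -
  have "{(xs, sact \<theta> m xs, Act X \<theta> m (sdim xs)) | xs \<theta> m. xs \<in> T \<and> mono_map m (sdim xs) \<theta>}
      = out_edges (arrs1 X) T"
    unfolding out_edges_def arrs1_def by blast
  then show ?thesis unfolding is_map_limit_def objs1_def by simp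
qed

lemma wf_graph1: "simplicial C X \<Longrightarrow> wf_graph (objs1 X) (arrs1 X)"
  unfolding wf_graph_def arrs1_def objs1_def using simplicialD(2) by auto

lemma cone1_iff: "cone (objs1 X) (arrs1 X) T U x \<longleftrightarrow> U \<in> Obj C \<and>
    (\<forall>s\<in>T. x s \<in> hom C U (Lev X (sdim s))) \<and>
    (\<forall>s\<in>T. \<forall>\<theta> m. mono_map m (sdim s) \<theta> \<longrightarrow> Act X \<theta> m (sdim s) \<cdot> x s = x (sact \<theta> m s))"
  unfolding cone_iff objs1_def arrs1_def by blast

definition objs2 :: "('o,'m) sobj \<Rightarrow> ('o,'m) sobj \<Rightarrow> (nat \<times> nat) list + (nat \<times> nat) list \<Rightarrow> 'o" where
  "objs2 X Y = case_sum (\<lambda>s. Lev X (sdim s)) (\<lambda>s. Lev Y (sdim s))"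

text \<open>The cones on \<open>S <+> T\<close>, for \<open>S \<subseteq> T\<close>, are the generalised elements of \<open>Map(S \<hookrightarrow> T, f)\<close>.\<close>
definition arrs2 :: "('o,'m) sobj \<Rightarrow> ('o,'m) sobj \<Rightarrow> (nat \<Rightarrow> 'm) \<Rightarrow>
    (((nat \<times> nat) list + (nat \<times> nat) list) \<times> ((nat \<times> nat) list + (nat \<times> nat) list) \<times> 'm) set" where
  "arrs2 X Y f = {(Inl s, Inl (sact \<theta> m s), Act X \<theta> m (sdim s)) | s \<theta> m. mono_map m (sdim s) \<theta>} \<union>
     {(Inr s, Inr (sact \<theta> m s), Act Y \<theta> m (sdim s)) | s \<theta> m. mono_map m (sdim s) \<theta>} \<union>
     {(Inl s, Inr s, f (sdim s)) | s. True}"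

lemma objs2_simps [simp]: "objs2 X Y (Inl s) = Lev X (sdim s)" "objs2 X Y (Inr s) = Lev Y (sdim s)"
  by (simp_all add: objs2_def)

lemma wf_graph2:
  assumes "simplicial C X" "simplicial C Y" "smor C X Y f"
  shows "wf_graph (objs2 X Y) (arrs2 X Y f)"
  unfolding wf_graph_def arrs2_def
  using simplicialD(2)[OF assms(1)] simplicialD(2)[OF assms(2)] smorD(1)[OF assms(3)] by auto

lemma closed2:
  assumes "subcx S" "subcx T" "S \<subseteq> T"
  shows "closed (arrs2 X Y f) (S <+> T)"
  unfolding closed_def arrs2_def using subcxD(2)[OF assms(1)] subcxD(2)[OF assms(2)] assms(3) by auto

lemma cone2_iff: "cone (objs2 X Y) (arrs2 X Y f) (S <+> T) U e \<longleftrightarrow>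
    cone (objs1 X) (arrs1 X) S U (\<lambda>s. e (Inl s)) \<and> cone (objs1 Y) (arrs1 Y) T U (\<lambda>s. e (Inr s)) \<and>
    (\<forall>s\<in>S. f (sdim s) \<cdot> e (Inl s) = e (Inr s))" (is "?l \<longleftrightarrow> ?r")
proof
  assume l: ?l
  note D = coneD[OF l]
  have "Act X \<theta> m (sdim s) \<cdot> e (Inl s) = e (Inl (sact \<theta> m s))" if "s \<in> S" "mono_map m (sdim s) \<theta>" for s \<theta> m
    by (rule D(3)) (use that in \<open>auto simp: arrs2_def\<close>)
  moreover have "Act Y \<theta> m (sdim s) \<cdot> e (Inr s) = e (Inr (sact \<theta> m s))" if "s \<in> T" "mono_map m (sdim s) \<theta>" for s \<theta> m
    by (rule D(3)) (use that in \<open>auto simp: arrs2_def\<close>)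
  moreover have "f (sdim s) \<cdot> e (Inl s) = e (Inr s)" if "s \<in> S" for s
    by (rule D(3)) (use that in \<open>auto simp: arrs2_def\<close>)
  ultimately show ?r
    unfolding cone1_iff using D(1) D(2)[OF InlI] D(2)[OF InrI] by auto
next
  assume r: ?r
  show ?l
  proof (rule coneI)
    show "U \<in> Obj C" using r by (simp add: cone1_iff)
    show "e i \<in> hom C U (objs2 X Y i)" if "i \<in> S <+> T" for i
      using that r by (auto simp: cone1_iff)
    show "u \<cdot> e i = e j" if "(i,j,u) \<in> arrs2 X Y f" "i \<in> S <+> T" for i j u
      using that r unfolding cone1_iff arrs2_def by auto
  qed
qed

text \<open>Degeneracies make the defining diagram infinite, while \<open>has_finite_limits\<close>
  wants a finite diagram indexed by numbers. The limit is formed over the nondegenerate simplices,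
  that is the lists without repetition, numbered by \<open>g\<close>. Any other simplex
  \<open>s\<close> is a degeneracy of \<open>remdups s\<close>, so its component is forced.\<close>

lemma map_limit_exists:
  assumes X: "simplicial C X" and T: "fincx T"
  shows "\<exists>L \<pi>. is_map_limit C X T L \<pi>"
proof -
  have Tc: "subcx T" and Tf: "finite (\<Union>(set ` T))" using T by (auto simp: fincx_def)
  note Tn = subcxD(1)[OF Tc]
  define N where "N = {s \<in> T. distinct s}"
  have "N \<subseteq> {s. set s \<subseteq> \<Union>(set ` T) \<and> distinct s}" by (auto simp: N_def)
  then have fN: "finite N" using finite_subset_distinct[OF Tf] finite_subset by blast
  then obtain g :: "(nat \<times> nat) list \<Rightarrow> nat" where "bij_betw g N {0..<card N}"
    using ex_bij_betw_finite_nat by blast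
  then have ginj: "inj_on g N" by (rule bij_betw_imp_inj_on)
  define g' where "g' = inv_into N g"
  have g'g: "g' (g s) = s" if "s \<in> N" for s
    using inv_into_f_f[OF ginj that] by (simp add: g'_def)
  let ?a = "\<lambda>s t. Act X (vpos s t) (sdim t) (sdim s)"
  have a: "?a s t \<in> hom C (Lev X (sdim s)) (Lev X (sdim t))" if "nsimp s" "nsimp t" "set t \<subseteq> set s" for s t
    by (rule simplicialD(2)[OF X vpos(1)[OF that]])
  define D where "D = (\<lambda>i. Lev X (sdim (g' i)))"
  define E where "E = (\<lambda>(s,t). (g s, g t, ?a s t)) ` {(s,t) \<in> N \<times> N. set t \<subseteq> set s}"
  have NT: "s \<in> T" "nsimp s" "distinct s" if "s \<in> N" for s using that Tn by (auto simp: N_def)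
  have "diagram C (g ` N) D E"
    unfolding diagram_def E_def D_def using simplicialD(1)[OF X] a NT by (auto simp: g'g)
  moreover have "finite E"
    unfolding E_def by (rule finite_imageI, rule finite_subset[of _ "N \<times> N"]) (use fN in auto)
  ultimately obtain L \<rho> where L: "is_limit C (g ` N) D E L \<rho>"
    using finite_limit_exists[of "g ` N"] fN by blast
  then have Lo: "L \<in> Obj C" and \<rho>: "\<And>s. s \<in> N \<Longrightarrow> \<rho> (g s) \<in> hom C L (Lev X (sdim s))"
    and \<rho>E: "\<And>s t. s \<in> N \<Longrightarrow> t \<in> N \<Longrightarrow> set t \<subseteq> set s \<Longrightarrow> ?a s t \<cdot> \<rho> (g s) = \<rho> (g t)"
    unfolding is_limit_def is_cone_def D_def E_def by (auto simp: g'g)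
  let ?r = "remdups"
  have r: "?r s \<in> N" "set (?r s) = set s" "nsimp (?r s)" if "s \<in> T" for s
    using subcx_face[OF Tc that nsimp_remdups[OF Tn[OF that]]] nsimp_remdups[OF Tn[OF that]] by (simp_all add: N_def)
  define \<pi> where "\<pi> = (\<lambda>s. ?a (?r s) s \<cdot> \<rho> (g (?r s)))"
  have ars: "?a (?r s) s \<in> hom C (Lev X (sdim (?r s))) (Lev X (sdim s))" if "s \<in> T" for s
    by (rule a) (use r[OF that] Tn[OF that] in auto)
  have \<pi>: "\<pi> s \<in> hom C L (Lev X (sdim s))" if "s \<in> T" for s
    unfolding \<pi>_def by (rule comp_in_hom[OF \<rho>[OF r(1)[OF that]] ars[OF that]])
  have cone: "cone (objs1 X) (arrs1 X) T L \<pi>"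
    unfolding cone1_iff
  proof (intro conjI ballI allI impI)
    fix s \<theta> m assume s: "s \<in> T" and \<theta>: "mono_map m (sdim s) \<theta>"
    let ?t = "sact \<theta> m s"
    have t: "?t \<in> T" by (rule subcxD(2)[OF Tc s \<theta>])
    have sub: "set ?t \<subseteq> set s" by (rule set_sact_subset[OF nsimp_ne[OF Tn[OF s]] \<theta>])
    note rs = r[OF s] and rt = r[OF t]
    have p1: "mono_map (sdim s) (sdim (?r s)) (vpos (?r s) s)" "sact (vpos (?r s) s) (sdim s) (?r s) = s"
      using vpos[OF rs(3) Tn[OF s]] rs(2) by auto
    have p2: "mono_map (sdim ?t) (sdim (?r ?t)) (vpos (?r ?t) ?t)" "sact (vpos (?r ?t) ?t) (sdim ?t) (?r ?t) = ?t"
      using vpos[OF rt(3) Tn[OF t]] rt(2) by auto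
    have sub2: "set (?r ?t) \<subseteq> set (?r s)" using sub rs(2) rt(2) by simp
    have p3: "mono_map (sdim (?r ?t)) (sdim (?r s)) (vpos (?r s) (?r ?t))"
      "sact (vpos (?r s) (?r ?t)) (sdim (?r ?t)) (?r s) = ?r ?t"
      using vpos[OF rs(3) rt(3) sub2] by auto
    note p2' = p2(1)[unfolded sdim_sact]
    \<comment> \<open>Both operators carry \<open>remdups s\<close> to the same simplex; as
      \<open>remdups s\<close> repeats no vertex, an operator is determined by its result.\<close>
    have eq: "Act X (vpos (?r s) s \<circ> \<theta>) m (sdim (?r s)) = Act X (vpos (?r s) (?r ?t) \<circ> vpos (?r ?t) ?t) m (sdim (?r s))"
    proof (rule simplicialD(3)[OF X])
      show m: "mono_map m (sdim (?r s)) (vpos (?r s) (?r ?t) \<circ> vpos (?r ?t) ?t)"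
        by (rule mono_map_comp[OF p2' p3(1)])
      fix i assume i: "i \<le> m"
      show "(vpos (?r s) (?r ?t) \<circ> vpos (?r ?t) ?t) i = (vpos (?r s) s \<circ> \<theta>) i"
      proof (rule sact_inj[OF _ _ m _ _ i])
        show "distinct (?r s)" by simp
        show "?r s \<noteq> []" by (rule nsimp_ne[OF rs(3)])
        show "mono_map m (sdim (?r s)) (vpos (?r s) s \<circ> \<theta>)" by (rule mono_map_comp[OF \<theta> p1(1)])
        have "sact (vpos (?r s) (?r ?t) \<circ> vpos (?r ?t) ?t) m (?r s) = ?t"
          using sact_comp[OF p2', of "vpos (?r s) (?r ?t)" "?r s"] p3(2) p2(2) by simp
        moreover have "sact (vpos (?r s) s \<circ> \<theta>) m (?r s) = ?t"
          using sact_comp[OF \<theta>, of "vpos (?r s) s" "?r s"] p1(2) by simp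
        ultimately show "sact (vpos (?r s) (?r ?t) \<circ> vpos (?r ?t) ?t) m (?r s) = sact (vpos (?r s) s \<circ> \<theta>) m (?r s)"
          by simp
      qed
    qed
    have "Act X \<theta> m (sdim s) \<cdot> \<pi> s = Act X (vpos (?r s) s \<circ> \<theta>) m (sdim (?r s)) \<cdot> \<rho> (g (?r s))"
      unfolding \<pi>_def simplicialD(5)[OF X \<theta> p1(1)]
      by (rule comp_assoc[OF \<rho>[OF rs(1)] ars[OF s] simplicialD(2)[OF X \<theta>]])
    also have "\<dots> = Act X (vpos (?r ?t) ?t) m (sdim (?r ?t)) \<cdot> (?a (?r s) (?r ?t) \<cdot> \<rho> (g (?r s)))"
      unfolding eq simplicialD(5)[OF X p2' p3(1)]
      by (rule comp_assoc[OF \<rho>[OF rs(1)] a[OF rs(3) rt(3) sub2] simplicialD(2)[OF X p2'], symmetric])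
    also have "\<dots> = \<pi> ?t"
      unfolding \<rho>E[OF rs(1) rt(1) sub2] by (simp add: \<pi>_def)
    finally show "Act X \<theta> m (sdim s) \<cdot> \<pi> s = \<pi> ?t" .
  qed (use Lo \<pi> in auto)
  have \<pi>N: "\<pi> s = \<rho> (g s)" if "s \<in> N" for s
  proof -
    note n = NT[OF that]
    have rr: "?r s = s" using n(3) by (simp add: distinct_remdups_id)
    note v = vpos[OF n(2) n(2) subset_refl]
    have "?a s s = Act X id (sdim s) (sdim s)"
      by (rule simplicialD(3)[OF X mono_map_id], rule sact_inj[OF n(3) nsimp_ne[OF n(2)] mono_map_id v(1)])
        (simp_all add: v(2) sact_id nsimp_ne[OF n(2)])
    then show ?thesis unfolding \<pi>_def rr using simplicialD(4)[OF X] comp_id(2)[OF \<rho>[OF that]] by simp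
  qed
  have "limit (objs1 X) (arrs1 X) T L \<pi>"
  proof (rule limitI[OF cone])
    fix U x assume x: "cone (objs1 X) (arrs1 X) T U x"
    note x1 = x[unfolded cone1_iff]
    have "?a s t \<cdot> x s = x t" if "s \<in> N" "t \<in> N" "set t \<subseteq> set s" for s t
      using vpos[OF NT(2)[OF that(1)] NT(2)[OF that(2)] that(3)] x1 NT(1)[OF that(1)] by metis
    then have "is_cone C (g ` N) D E U (\<lambda>i. x (g' i))"
      unfolding is_cone_def D_def E_def using x1 NT(1) by (auto simp: g'g)
    then have "\<exists>h. h \<in> hom C U L \<and> (\<forall>i\<in>g ` N. \<rho> i \<cdot> h = x (g' i))"
      using L unfolding is_limit_def by blast
    then obtain h where h: "h \<in> hom C U L" "\<And>s. s \<in> N \<Longrightarrow> \<rho> (g s) \<cdot> h = x s"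
      by (auto simp: g'g)
    have "\<pi> s \<cdot> h = x s" if s: "s \<in> T" for s
    proof -
      have v: "mono_map (sdim s) (sdim (?r s)) (vpos (?r s) s)" "sact (vpos (?r s) s) (sdim s) (?r s) = s"
        using vpos[OF r(3)[OF s] Tn[OF s]] r(2)[OF s] by auto
      have "\<pi> s \<cdot> h = ?a (?r s) s \<cdot> x (?r s)"
        unfolding \<pi>_def h(2)[OF r(1)[OF s], symmetric]
        by (rule comp_assoc[OF h(1) \<rho>[OF r(1)[OF s]] ars[OF s], symmetric])
      also have "\<dots> = x s" using x1 NT(1)[OF r(1)[OF s]] v by metis
      finally show ?thesis .
    qed
    then show "\<exists>h. h \<in> hom C U L \<and> (\<forall>s\<in>T. \<pi> s \<cdot> h = x s)" using h(1) by blast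
  next
    fix U h h' assume h: "h \<in> hom C U L" "h' \<in> hom C U L" and eq: "\<And>s. s \<in> T \<Longrightarrow> \<pi> s \<cdot> h = \<pi> s \<cdot> h'"
    have "is_cone C (g ` N) D E U (\<lambda>i. \<rho> i \<cdot> h)"
      unfolding is_cone_def
    proof (intro conjI ballI)
      show "U \<in> Obj C" using hom_obj(1)[OF h(1)] .
      show "\<rho> i \<cdot> h \<in> hom C U (D i)" if "i \<in> g ` N" for i
        using that comp_in_hom[OF h(1) \<rho>] by (auto simp: D_def g'g)
      have "?a s t \<cdot> (\<rho> (g s) \<cdot> h) = \<rho> (g t) \<cdot> h" if "s \<in> N" "t \<in> N" "set t \<subseteq> set s" for s t
        using comp_assoc[OF h(1) \<rho>[OF that(1)] a[OF NT(2)[OF that(1)] NT(2)[OF that(2)] that(3)]] \<rho>E[OF that] by simp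
      then show "case x of (i, j, u) \<Rightarrow> u \<cdot> (\<rho> i \<cdot> h) = \<rho> j \<cdot> h" if "x \<in> E" for x
        using that by (auto simp: E_def)
    qed
    then have "\<exists>!k. k \<in> hom C U L \<and> (\<forall>i\<in>g ` N. \<rho> i \<cdot> k = \<rho> i \<cdot> h)"
      using L unfolding is_limit_def by blast
    then obtain k where k: "\<And>x. x \<in> hom C U L \<and> (\<forall>i\<in>g ` N. \<rho> i \<cdot> x = \<rho> i \<cdot> h) \<Longrightarrow> x = k"
      by (elim ex1E) blast
    have "\<forall>i\<in>g ` N. \<rho> i \<cdot> h' = \<rho> i \<cdot> h" using eq[OF NT(1)] by (simp add: \<pi>N)
    then have "h' = k" using k[of h'] h(2) by blast
    moreover have "h = k" using k[of h] h(1) by blast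
    ultimately show "h = h'" by simp
  qed
  then show ?thesis unfolding map_limit_iff by blast
qed

text \<open>With an empty \<open>X\<close>-part the relative mapping object is just
  \<open>Map(T,Y)\<close>, so statements about \<open>Y\<close> alone fit into the relative
  framework. The value \<open>undefined\<close> is never read.\<close>

lemma limit1_to_limit2:
  assumes "is_map_limit C Y T L \<pi>"
  shows "limit (objs2 X Y) (arrs2 X Y f) ({} <+> T) L (case_sum undefined \<pi>)"
proof -
  have L: "limit (objs1 Y) (arrs1 Y) T L \<pi>" using assms by (simp add: map_limit_iff)
  have c: "cone (objs2 X Y) (arrs2 X Y f) ({} <+> T) U e \<longleftrightarrow> cone (objs1 Y) (arrs1 Y) T U (\<lambda>s. e (Inr s))" for U e
    unfolding cone2_iff by (auto simp: cone1_iff)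
  have I: "(\<forall>i\<in>{} <+> T. P i) \<longleftrightarrow> (\<forall>s\<in>T. P (Inr s))" for P :: "(nat \<times> nat) list + (nat \<times> nat) list \<Rightarrow> bool"
    by auto
  show ?thesis
    unfolding is_limit_def
  proof (intro conjI allI impI)
    show "cone (objs2 X Y) (arrs2 X Y f) ({} <+> T) L (case_sum undefined \<pi>)"
      unfolding c using limit_cone[OF L] by simp
    fix U e assume "cone (objs2 X Y) (arrs2 X Y f) ({} <+> T) U e"
    then show "\<exists>!h. h \<in> hom C U L \<and> (\<forall>i\<in>{} <+> T. case_sum undefined \<pi> i \<cdot> h = e i)"
      unfolding I using L unfolding c is_limit_def by simp
  qed
qed

text \<open>The edges from \<open>Inl s\<close> to \<open>Inr s\<close> state that two morphisms
  into \<open>Map(T,Y)\<close> have equal components; since \<open>LY\<close> is a limit this is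
  equality of the morphisms, which is the pullback condition.\<close>

lemma pullback_limit2:
  assumes X: "simplicial C X" and Y: "simplicial C Y" and f: "smor C X Y f" and sub: "T \<subseteq> T'"
    and LX: "is_map_limit C X T LX \<pi>X" and LY: "is_map_limit C Y T LY \<pi>Y" and LY': "is_map_limit C Y T' LY' \<pi>Y'"
    and fT: "is_fmap C f T LX \<pi>X LY \<pi>Y fT" and rT: "is_induced C LY' \<pi>Y' LY \<pi>Y T id rT"
    and pb: "is_pullback C fT rT P p q"
  shows "limit (objs2 X Y) (arrs2 X Y f) (T <+> T') P (case_sum (\<lambda>s. \<pi>X s \<cdot> p) (\<lambda>s. \<pi>Y' s \<cdot> q))"
proof -
  note LX = LX[unfolded map_limit_iff] and LY = LY[unfolded map_limit_iff] and LY' = LY'[unfolded map_limit_iff]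
  note wX = wf_graph1[OF X] and wY = wf_graph1[OF Y]
  have fTh: "fT \<in> hom C LX LY" and fTe: "\<And>s. s \<in> T \<Longrightarrow> \<pi>Y s \<cdot> fT = f (sdim s) \<cdot> \<pi>X s"
    using fT by (auto simp: is_fmap_def)
  have rTh: "rT \<in> hom C LY' LY" and rTe: "\<And>s. s \<in> T \<Longrightarrow> \<pi>Y s \<cdot> rT = \<pi>Y' s"
    using rT by (auto simp: is_induced_def)
  note pq = pullback_hom[OF pb fTh rTh]
  note \<pi>X = coneD(2)[OF limit_cone[OF LX], unfolded objs1_def] and \<pi>Y = coneD(2)[OF limit_cone[OF LY], unfolded objs1_def]
    and \<pi>Y' = coneD(2)[OF limit_cone[OF LY'], unfolded objs1_def]
  note fh = smorD(1)[OF f]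
  have over: "f (sdim s) \<cdot> (\<pi>X s \<cdot> x) = \<pi>Y s \<cdot> (fT \<cdot> x)" if "x \<in> hom C U LX" "s \<in> T" for s x U
    using comp_assoc[OF that(1) \<pi>X[OF that(2)] fh] comp_assoc[OF that(1) fTh \<pi>Y[OF that(2)]] fTe[OF that(2)] by simp
  have over': "\<pi>Y' s \<cdot> y = \<pi>Y s \<cdot> (rT \<cdot> y)" if "y \<in> hom C U LY'" "s \<in> T" for s y U
    using comp_assoc[OF that(1) rTh \<pi>Y[OF that(2)]] rTe[OF that(2)] by simp
  have dist: "(\<forall>i\<in>T <+> T'. Q i) \<longleftrightarrow> (\<forall>s\<in>T. Q (Inl s)) \<and> (\<forall>s\<in>T'. Q (Inr s))" for Q
    by auto
  show ?thesis
  proof (rule limitI)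
    show "cone (objs2 X Y) (arrs2 X Y f) (T <+> T') P (case_sum (\<lambda>s. \<pi>X s \<cdot> p) (\<lambda>s. \<pi>Y' s \<cdot> q))"
      unfolding cone2_iff using cone_comp[OF wX limit_cone[OF LX] pq(1)] cone_comp[OF wY limit_cone[OF LY'] pq(2)]
        over[OF pq(1)] over'[OF pq(2)] pq(3) by simp
  next
    fix U e assume "cone (objs2 X Y) (arrs2 X Y f) (T <+> T') U e"
    then have e: "cone (objs1 X) (arrs1 X) T U (\<lambda>s. e (Inl s))" "cone (objs1 Y) (arrs1 Y) T' U (\<lambda>s. e (Inr s))"
      and ef: "\<And>s. s \<in> T \<Longrightarrow> f (sdim s) \<cdot> e (Inl s) = e (Inr s)" unfolding cone2_iff by blast+
    obtain x where x: "x \<in> hom C U LX" "\<forall>s\<in>T. \<pi>X s \<cdot> x = e (Inl s)" using limit_ex[OF LX e(1)] by blast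
    obtain y where y: "y \<in> hom C U LY'" "\<forall>s\<in>T'. \<pi>Y' s \<cdot> y = e (Inr s)" using limit_ex[OF LY' e(2)] by blast
    have "fT \<cdot> x = rT \<cdot> y"
    proof (rule limit_eqI[OF wY LY comp_in_hom[OF x(1) fTh] comp_in_hom[OF y(1) rTh]])
      show "\<pi>Y s \<cdot> (fT \<cdot> x) = \<pi>Y s \<cdot> (rT \<cdot> y)" if "s \<in> T" for s
        using over[OF x(1) that] over'[OF y(1) that] bspec[OF x(2) that] bspec[OF y(2) subsetD[OF sub that]] ef[OF that]
        by simp
    qed
    from pullback_ex[OF pb fTh rTh x(1) y(1) this]
    obtain h where h: "h \<in> hom C U P" "p \<cdot> h = x" "q \<cdot> h = y" by blast
    have "\<pi>X s \<cdot> p \<cdot> h = e (Inl s)" if "s \<in> T" for s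
      using comp_assoc[OF h(1) pq(1) \<pi>X[OF that]] h(2) bspec[OF x(2) that] by simp
    moreover have "\<pi>Y' s \<cdot> q \<cdot> h = e (Inr s)" if "s \<in> T'" for s
      using comp_assoc[OF h(1) pq(2) \<pi>Y'[OF that]] h(3) bspec[OF y(2) that] by simp
    ultimately show "\<exists>h. h \<in> hom C U P \<and> (\<forall>i\<in>T <+> T'. case_sum (\<lambda>s. \<pi>X s \<cdot> p) (\<lambda>s. \<pi>Y' s \<cdot> q) i \<cdot> h = e i)"
      using h(1) unfolding dist by (intro exI[of _ h]) simp
  next
    fix U h h' assume h: "h \<in> hom C U P" "h' \<in> hom C U P"
      and eq: "\<And>i. i \<in> T <+> T' \<Longrightarrow> case_sum (\<lambda>s. \<pi>X s \<cdot> p) (\<lambda>s. \<pi>Y' s \<cdot> q) i \<cdot> h = case_sum (\<lambda>s. \<pi>X s \<cdot> p) (\<lambda>s. \<pi>Y' s \<cdot> q) i \<cdot> h'"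
    have eqX: "\<pi>X s \<cdot> p \<cdot> h = \<pi>X s \<cdot> p \<cdot> h'" if "s \<in> T" for s using eq[OF InlI[OF that]] by simp
    have eqY: "\<pi>Y' s \<cdot> q \<cdot> h = \<pi>Y' s \<cdot> q \<cdot> h'" if "s \<in> T'" for s using eq[OF InrI[OF that]] by simp
    show "h = h'"
    proof (rule pullback_eqI[OF pb fTh rTh h])
      show "p \<cdot> h = p \<cdot> h'"
      proof (rule limit_eqI[OF wX LX comp_in_hom[OF h(1) pq(1)] comp_in_hom[OF h(2) pq(1)]])
        show "\<pi>X s \<cdot> (p \<cdot> h) = \<pi>X s \<cdot> (p \<cdot> h')" if "s \<in> T" for s
          using eqX[OF that] comp_assoc[OF h(1) pq(1) \<pi>X[OF that]] comp_assoc[OF h(2) pq(1) \<pi>X[OF that]] by simp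
      qed
      show "q \<cdot> h = q \<cdot> h'"
      proof (rule limit_eqI[OF wY LY' comp_in_hom[OF h(1) pq(2)] comp_in_hom[OF h(2) pq(2)]])
        show "\<pi>Y' s \<cdot> (q \<cdot> h) = \<pi>Y' s \<cdot> (q \<cdot> h')" if "s \<in> T'" for s
          using eqY[OF that] comp_assoc[OF h(1) pq(2) \<pi>Y'[OF that]] comp_assoc[OF h(2) pq(2) \<pi>Y'[OF that]] by simp
      qed
    qed
  qed
qed

lemma induced_exists:
  assumes "simplicial C Y" "S \<subseteq> T" "is_map_limit C Y T L \<pi>" "is_map_limit C Y S L' \<pi>'"
  shows "\<exists>h. is_induced C L \<pi> L' \<pi>' S id h"
  using limit_ex[OF assms(4)[unfolded map_limit_iff] cone_mono[OF limit_cone[OF assms(3)[unfolded map_limit_iff]] assms(2)]]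
  by (auto simp: is_induced_def)

lemma fmap_exists:
  assumes "simplicial C X" "simplicial C Y" "smor C X Y f" "subcx T"
    and "is_map_limit C X T L \<pi>" "is_map_limit C Y T L' \<pi>'"
  shows "\<exists>h. is_fmap C f T L \<pi> L' \<pi>' h"
proof -
  note L = limit_cone[OF assms(5)[unfolded map_limit_iff], unfolded cone1_iff]
  note fh = smorD(1)[OF assms(3)]
  have "cone (objs1 Y) (arrs1 Y) T L (\<lambda>s. f (sdim s) \<cdot> \<pi> s)"
    unfolding cone1_iff
  proof (intro conjI ballI allI impI)
    show "L \<in> Obj C" using L by blast
    show "f (sdim s) \<cdot> \<pi> s \<in> hom C L (Lev Y (sdim s))" if "s \<in> T" for s
      by (rule comp_in_hom[OF _ fh]) (use L that in blast)
    fix s \<theta> m assume s: "s \<in> T" and \<theta>: "mono_map m (sdim s) \<theta>"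
    have \<pi>: "\<pi> s \<in> hom C L (Lev X (sdim s))" "Act X \<theta> m (sdim s) \<cdot> \<pi> s = \<pi> (sact \<theta> m s)"
      using L s \<theta> by blast+
    show "Act Y \<theta> m (sdim s) \<cdot> (f (sdim s) \<cdot> \<pi> s) = f (sdim (sact \<theta> m s)) \<cdot> \<pi> (sact \<theta> m s)"
      using comp_assoc[OF \<pi>(1) fh simplicialD(2)[OF assms(2) \<theta>]] comp_assoc[OF \<pi>(1) simplicialD(2)[OF assms(1) \<theta>] fh]
        smorD(2)[OF assms(3) \<theta>] \<pi>(2) by simp
  qed
  from limit_ex[OF assms(6)[unfolded map_limit_iff] this] show ?thesis by (auto simp: is_fmap_def)
qed

text \<open>\<open>rel_prop\<close> ranges over all choices of limits and pullbacks, so drawing a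
  conclusion from it requires that at least one choice exists.\<close>

lemma limit2_data_exists:
  assumes X: "simplicial C X" and Y: "simplicial C Y" and f: "smor C X Y f" and sub: "T \<subseteq> T'"
    and fin: "fincx T" "fincx T'"
  shows "\<exists>LX \<pi>X LY \<pi>Y LY' \<pi>Y' fT rT P p q. is_map_limit C X T LX \<pi>X \<and> is_map_limit C Y T LY \<pi>Y \<and>
    is_map_limit C Y T' LY' \<pi>Y' \<and> is_fmap C f T LX \<pi>X LY \<pi>Y fT \<and> is_induced C LY' \<pi>Y' LY \<pi>Y T id rT \<and>
    is_pullback C fT rT P p q"
proof -
  obtain LX \<pi>X where LX: "is_map_limit C X T LX \<pi>X" using map_limit_exists[OF X fin(1)] by blast
  obtain LY \<pi>Y where LY: "is_map_limit C Y T LY \<pi>Y" using map_limit_exists[OF Y fin(1)] by blast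
  obtain LY' \<pi>Y' where LY': "is_map_limit C Y T' LY' \<pi>Y'" using map_limit_exists[OF Y fin(2)] by blast
  obtain fT where fT: "is_fmap C f T LX \<pi>X LY \<pi>Y fT"
    using fmap_exists[OF X Y f _ LX LY] fin(1) by (auto simp: fincx_def)
  obtain rT where rT: "is_induced C LY' \<pi>Y' LY \<pi>Y T id rT"
    using induced_exists[OF Y sub LY' LY] by blast
  obtain P p q where "is_pullback C fT rT P p q"
    using pullback_exists[of fT LX LY rT LY'] fT rT unfolding is_fmap_def is_induced_def by blast
  with LX LY LY' fT rT show ?thesis by blast
qed

lemma limit2_exists:
  assumes "simplicial C X" "simplicial C Y" "smor C X Y f" "T \<subseteq> T'" "fincx T" "fincx T'"
  shows "\<exists>L e. limit (objs2 X Y) (arrs2 X Y f) (T <+> T') L e"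
  using limit2_data_exists[OF assms] pullback_limit2[OF assms(1-4)] by meson

lemma rel_prop_if_rel_cover:
  assumes X: "simplicial C X" and Y: "simplicial C Y" and f: "smor C X Y f"
    and sub: "T \<subseteq> T'" "S \<subseteq> S'" "S \<subseteq> T" "S' \<subseteq> T'"
    and rc: "rel_cover (objs2 X Y) (arrs2 X Y f) (S <+> S') (T <+> T')"
  shows "rel_prop C X Y f T T' S S' (\<lambda>r. r \<in> cov)"
  unfolding rel_prop_def
proof (intro allI impI, elim conjE)
  fix LTX \<pi>TX LTY \<pi>TY LT'Y \<pi>T'Y LSX \<pi>SX LSY \<pi>SY LS'Y \<pi>S'Y fT rT fS rS P1 p1 q1 P2 p2 q2 a b r
  assume A: "is_map_limit C X T LTX \<pi>TX" "is_map_limit C Y T LTY \<pi>TY" "is_map_limit C Y T' LT'Y \<pi>T'Y"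
    "is_fmap C f T LTX \<pi>TX LTY \<pi>TY fT" "is_induced C LT'Y \<pi>T'Y LTY \<pi>TY T id rT" "is_pullback C fT rT P1 p1 q1"
  assume B: "is_map_limit C X S LSX \<pi>SX" "is_map_limit C Y S LSY \<pi>SY" "is_map_limit C Y S' LS'Y \<pi>S'Y"
    "is_fmap C f S LSX \<pi>SX LSY \<pi>SY fS" "is_induced C LS'Y \<pi>S'Y LSY \<pi>SY S id rS" "is_pullback C fS rS P2 p2 q2"
  assume a: "is_induced C LTX \<pi>TX LSX \<pi>SX S id a" and b: "is_induced C LT'Y \<pi>T'Y LS'Y \<pi>S'Y S' id b"
  assume r: "r \<in> hom C P1 P2" "p2 \<cdot> r = a \<cdot> p1" "q2 \<cdot> r = b \<cdot> q1"
  note l1 = pullback_limit2[OF X Y f sub(1) A] and l2 = pullback_limit2[OF X Y f sub(2) B]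
  have A': "fT \<in> hom C LTX LTY" "rT \<in> hom C LT'Y LTY" and B': "fS \<in> hom C LSX LSY" "rS \<in> hom C LS'Y LSY"
    and ab: "a \<in> hom C LTX LSX" "b \<in> hom C LT'Y LS'Y"
    and ae: "\<And>s. s \<in> S \<Longrightarrow> \<pi>SX s \<cdot> a = \<pi>TX s" and be: "\<And>s. s \<in> S' \<Longrightarrow> \<pi>S'Y s \<cdot> b = \<pi>T'Y s"
    using A(4,5) B(4,5) a b by (auto simp: is_fmap_def is_induced_def)
  note pq1 = pullback_hom[OF A(6) A'] and pq2 = pullback_hom[OF B(6) B']
  note \<pi>SX = coneD(2)[OF limit_cone[OF B(1)[unfolded map_limit_iff]]] and \<pi>S'Y = coneD(2)[OF limit_cone[OF B(3)[unfolded map_limit_iff]]]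
  show "r \<in> cov"
  proof (rule cov_if_rel_cover[OF wf_graph2[OF X Y f] _ l2 l1 r(1) _ rc])
    show "S <+> S' \<subseteq> T <+> T'" using sub by auto
    fix i assume "i \<in> S <+> S'"
    then show "case_sum (\<lambda>s. \<pi>SX s \<cdot> p2) (\<lambda>s. \<pi>S'Y s \<cdot> q2) i \<cdot> r = case_sum (\<lambda>s. \<pi>TX s \<cdot> p1) (\<lambda>s. \<pi>T'Y s \<cdot> q1) i"
    proof
      fix s assume s: "s \<in> S" "i = Inl s"
      then show ?thesis
        using comp_assoc[OF r(1) pq2(1) \<pi>SX[OF s(1)]] comp_assoc[OF pq1(1) ab(1) \<pi>SX[OF s(1)]] r(2) ae[OF s(1)] by simp
    next
      fix s assume s: "s \<in> S'" "i = Inr s"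
      then show ?thesis
        using comp_assoc[OF r(1) pq2(2) \<pi>S'Y[OF s(1)]] comp_assoc[OF pq1(2) ab(2) \<pi>S'Y[OF s(1)]] r(3) be[OF s(1)] by simp
    qed
  qed
qed

lemma rel_cover_if_rel_prop:
  assumes X: "simplicial C X" and Y: "simplicial C Y" and f: "smor C X Y f"
    and sub: "T \<subseteq> T'" "S \<subseteq> S'" "S \<subseteq> T" "S' \<subseteq> T'"
    and fin: "fincx S" "fincx T" "fincx S'" "fincx T'"
    and rp: "rel_prop C X Y f T T' S S' (\<lambda>r. r \<in> cov)"
  shows "rel_cover (objs2 X Y) (arrs2 X Y f) (S <+> S') (T <+> T')"
proof -
  obtain LTX \<pi>TX LTY \<pi>TY LT'Y \<pi>T'Y fT rT P1 p1 q1 where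
    A: "is_map_limit C X T LTX \<pi>TX" "is_map_limit C Y T LTY \<pi>TY" "is_map_limit C Y T' LT'Y \<pi>T'Y"
    "is_fmap C f T LTX \<pi>TX LTY \<pi>TY fT" "is_induced C LT'Y \<pi>T'Y LTY \<pi>TY T id rT" "is_pullback C fT rT P1 p1 q1"
    using limit2_data_exists[OF X Y f sub(1) fin(2,4)] by (elim exE conjE)
  obtain LSX \<pi>SX LSY \<pi>SY LS'Y \<pi>S'Y fS rS P2 p2 q2 where
    B: "is_map_limit C X S LSX \<pi>SX" "is_map_limit C Y S LSY \<pi>SY" "is_map_limit C Y S' LS'Y \<pi>S'Y"
    "is_fmap C f S LSX \<pi>SX LSY \<pi>SY fS" "is_induced C LS'Y \<pi>S'Y LSY \<pi>SY S id rS" "is_pullback C fS rS P2 p2 q2"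
    using limit2_data_exists[OF X Y f sub(2) fin(1,3)] by (elim exE conjE)
  obtain a where a: "is_induced C LTX \<pi>TX LSX \<pi>SX S id a" using induced_exists[OF X sub(3) A(1) B(1)] by blast
  obtain b where b: "is_induced C LT'Y \<pi>T'Y LS'Y \<pi>S'Y S' id b" using induced_exists[OF Y sub(4) A(3) B(3)] by blast
  note l1 = pullback_limit2[OF X Y f sub(1) A] and l2 = pullback_limit2[OF X Y f sub(2) B]
  have A': "fT \<in> hom C LTX LTY" "rT \<in> hom C LT'Y LTY" and B': "fS \<in> hom C LSX LSY" "rS \<in> hom C LS'Y LSY"
    and ab: "a \<in> hom C LTX LSX" "b \<in> hom C LT'Y LS'Y"
    and ae: "\<And>s. s \<in> S \<Longrightarrow> \<pi>SX s \<cdot> a = \<pi>TX s" and be: "\<And>s. s \<in> S' \<Longrightarrow> \<pi>S'Y s \<cdot> b = \<pi>T'Y s"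
    using A(4,5) B(4,5) a b by (auto simp: is_fmap_def is_induced_def)
  note pq1 = pullback_hom[OF A(6) A'] and pq2 = pullback_hom[OF B(6) B']
  note wX = wf_graph1[OF X] and wY = wf_graph1[OF Y] and w2 = wf_graph2[OF X Y f]
  note lSX = B(1)[unfolded map_limit_iff] and lS'Y = B(3)[unfolded map_limit_iff]
  note \<pi>SX = coneD(2)[OF limit_cone[OF lSX]] and \<pi>S'Y = coneD(2)[OF limit_cone[OF lS'Y]]
  have IJ: "S <+> S' \<subseteq> T <+> T'" using sub by auto
  obtain r where r: "r \<in> hom C P1 P2" and re: "\<forall>i\<in>S <+> S'. case_sum (\<lambda>s. \<pi>SX s \<cdot> p2) (\<lambda>s. \<pi>S'Y s \<cdot> q2) i \<cdot> r
      = case_sum (\<lambda>s. \<pi>TX s \<cdot> p1) (\<lambda>s. \<pi>T'Y s \<cdot> q1) i"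
    using limit_ex[OF l2 cone_mono[OF limit_cone[OF l1] IJ]] by blast
  have rp2: "p2 \<cdot> r = a \<cdot> p1"
  proof (rule limit_eqI[OF wX lSX comp_in_hom[OF r pq2(1)] comp_in_hom[OF pq1(1) ab(1)]])
    fix s assume s: "s \<in> S"
    show "\<pi>SX s \<cdot> (p2 \<cdot> r) = \<pi>SX s \<cdot> (a \<cdot> p1)"
      using bspec[OF re InlI[OF s]] comp_assoc[OF r pq2(1) \<pi>SX[OF s]] comp_assoc[OF pq1(1) ab(1) \<pi>SX[OF s]] ae[OF s] by simp
  qed
  have rq2: "q2 \<cdot> r = b \<cdot> q1"
  proof (rule limit_eqI[OF wY lS'Y comp_in_hom[OF r pq2(2)] comp_in_hom[OF pq1(2) ab(2)]])
    fix s assume s: "s \<in> S'"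
    show "\<pi>S'Y s \<cdot> (q2 \<cdot> r) = \<pi>S'Y s \<cdot> (b \<cdot> q1)"
      using bspec[OF re InrI[OF s]] comp_assoc[OF r pq2(2) \<pi>S'Y[OF s]] comp_assoc[OF pq1(2) ab(2) \<pi>S'Y[OF s]] be[OF s] by simp
  qed
  have "r \<in> cov"
    by (rule rp[unfolded rel_prop_def, rule_format, OF conjI[OF A(1) conjI[OF A(2) conjI[OF A(3) conjI[OF B(1)
      conjI[OF B(2) conjI[OF B(3) conjI[OF A(4) conjI[OF A(5) conjI[OF B(4)
      conjI[OF B(5) conjI[OF A(6) conjI[OF B(6) conjI[OF a conjI[OF b conjI[OF r conjI[OF rp2 rq2]]]]]]]]]]]]]]]]])
  then show ?thesis
    using rel_cover_if_cov[OF w2 IJ l2 l1 r] re by blast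
qed

text \<open>The point where the Kan condition on \<open>Y\<close> becomes a relative cover.\<close>

lemma rel_cover_if_restr_prop:
  assumes X: "simplicial C X" and Y: "simplicial C Y" and f: "smor C X Y f"
    and sub: "S \<subseteq> T" and fin: "fincx S" "fincx T"
    and rp: "restr_prop C Y T S (\<lambda>h. h \<in> cov)"
  shows "rel_cover (objs2 X Y) (arrs2 X Y f) ({} <+> S) ({} <+> T)"
proof -
  obtain L \<pi> where L: "is_map_limit C Y T L \<pi>" using map_limit_exists[OF Y fin(2)] by blast
  obtain L' \<pi>' where L': "is_map_limit C Y S L' \<pi>'" using map_limit_exists[OF Y fin(1)] by blast
  obtain h where h: "is_induced C L \<pi> L' \<pi>' S id h" using induced_exists[OF Y sub L L'] by blast
  then have cov: "h \<in> cov" using rp L L' unfolding restr_prop_def by blast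
  have "h \<in> hom C L L'" "\<And>s. s \<in> S \<Longrightarrow> \<pi>' s \<cdot> h = \<pi> s" using h by (auto simp: is_induced_def)
  then show ?thesis
    using sub by (intro rel_cover_if_cov[OF wf_graph2[OF X Y f] _ limit1_to_limit2[OF L'] limit1_to_limit2[OF L] _ _ cov]) auto
qed

end

section \<open>Attaching cells\<close>

text \<open>\<open>Q\<close> plays the role of an abstract simplicial complex, and combinatorics is
  done on vertex sets instead of lists. Members of \<open>Q\<close> that are empty or not chains
  contribute no simplex.\<close>

definition nerve :: "(nat \<times> nat) set set \<Rightarrow> (nat \<times> nat) list set" where
  "nerve Q = {xs. nsimp xs \<and> set xs \<in> Q}"

definition downclosed :: "'a set set \<Rightarrow> bool" where
  "downclosed Q \<longleftrightarrow> (\<forall>A\<in>Q. \<forall>B\<subseteq>A. B \<in> Q)"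

lemma downclosedD: "downclosed Q \<Longrightarrow> A \<in> Q \<Longrightarrow> B \<subseteq> A \<Longrightarrow> B \<in> Q"
  by (auto simp: downclosed_def)

lemma downclosed_Un: "downclosed P \<Longrightarrow> downclosed Q \<Longrightarrow> downclosed (P \<union> Q)"
  by (auto simp: downclosed_def)

lemma downclosed_Pow: "downclosed (Pow A)"
  by (auto simp: downclosed_def)

lemma subcx_nerve: "downclosed Q \<Longrightarrow> subcx (nerve Q)"
  unfolding subcx_def nerve_def
  using downclosedD[OF _ _ set_sact_subset[OF nsimp_ne]] by (auto intro: nsimp_sact)

lemma fincx_nerve: "downclosed Q \<Longrightarrow> Q \<subseteq> Pow V \<Longrightarrow> finite V \<Longrightarrow> fincx (nerve Q)"
  unfolding fincx_def by (rule conjI, erule subcx_nerve, rule finite_subset[of _ V]) (auto simp: nerve_def)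

lemma nerve_mono: "P \<subseteq> Q \<Longrightarrow> nerve P \<subseteq> nerve Q"
  by (auto simp: nerve_def)

lemma nerve_Un: "nerve (P \<union> Q) = nerve P \<union> nerve Q"
  by (auto simp: nerve_def)

lemma nerve_Int: "nerve (P \<inter> Q) = nerve P \<inter> nerve Q"
  by (auto simp: nerve_def)

definition vchain :: "(nat \<times> nat) set \<Rightarrow> bool" where
  "vchain A \<longleftrightarrow> (\<forall>x\<in>A. \<forall>y\<in>A. vle x y \<or> vle y x)"

lemma vchain_nsimp:
  assumes "nsimp xs"
  shows "vchain (set xs)"
  unfolding vchain_def
proof (intro ballI)
  fix x y assume "x \<in> set xs" "y \<in> set xs"
  then obtain i j where "x = xs ! i" "y = xs ! j" "i \<le> sdim xs" "j \<le> sdim xs"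
    using in_set_slist[OF nsimp_ne[OF assms]] by blast
  then show "vle x y \<or> vle y x" using nsimp_nth[OF assms] nat_le_linear by metis
qed

lemma nerve_subset_chainI:
  assumes "\<And>A. A \<in> P \<Longrightarrow> A \<noteq> {} \<Longrightarrow> vchain A \<Longrightarrow> A \<in> Q"
  shows "nerve P \<subseteq> nerve Q"
  using assms vchain_nsimp nsimp_ne unfolding nerve_def by (auto simp del: set_empty simp: set_empty[symmetric])

lemma vchain_list:
  assumes "finite A" "vchain A" "A \<noteq> {}"
  obtains c where "set c = A" "distinct c" "nsimp c"
proof -
  obtain xs where xs: "set xs = A" "distinct xs" using finite_distinct_list[OF assms(1)] by blast
  \<comment> \<open>The coordinate sum is strictly increasing for the product order, so sorting by
    it lists a chain in increasing order.\<close>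
  define k where "k = (\<lambda>x :: nat \<times> nat. fst x + snd x)"
  define c where "c = sort_key k xs"
  have c: "set c = A" "distinct c" "sorted (map k c)" using xs by (simp_all add: c_def)
  have "nsimp c"
    unfolding nsimp_def
  proof (intro conjI allI impI)
    show "c \<noteq> []" using c(1) assms(3) by auto
    fix i j assume ij: "i \<le> j" "j < length c"
    then have "k (c ! i) \<le> k (c ! j)" using sorted_nth_mono[OF c(3) ij(1)] by simp
    moreover have "vle (c ! i) (c ! j) \<or> vle (c ! j) (c ! i)"
      using assms(2) c(1) ij unfolding vchain_def by (metis le_less_trans nth_mem)
    ultimately show "vle (c ! i) (c ! j)" by (auto simp: vle_def k_def)
  qed
  then show thesis using that c by blast
qed

lemma map_sact: "s \<noteq> [] \<Longrightarrow> mono_map m (sdim s) \<theta> \<Longrightarrow> map \<phi> (sact \<theta> m s) = sact \<theta> m (map \<phi> s)"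
  using mono_mapD(1) by (intro nth_equalityI) (auto simp: length_sdim less_Suc_eq_le simp del: upt_Suc)

lemma sdim_map [simp]: "sdim (map \<phi> s) = sdim s"
  by (simp add: sdim_def)

text \<open>The order has to be reflected as well as preserved: simplices of the image must lift
  back to simplices.\<close>

lemma map_nerve:
  assumes inj: "inj_on \<phi> V" and ord: "\<And>x y. x \<in> V \<Longrightarrow> y \<in> V \<Longrightarrow> vle (\<phi> x) (\<phi> y) \<longleftrightarrow> vle x y" and Q: "Q \<subseteq> Pow V"
  shows "map \<phi> ` nerve Q = nerve ((`) \<phi> ` Q)"
proof
  have "sorted_wrt vle (map \<phi> xs) \<longleftrightarrow> sorted_wrt vle xs" if "set xs \<subseteq> V" for xs
    unfolding sorted_wrt_map
    using that by (auto simp: ord subset_iff elim!: sorted_wrt_mono_rel[rotated])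
  then have n: "nsimp (map \<phi> xs) \<longleftrightarrow> nsimp xs" if "set xs \<subseteq> V" for xs
    using that by (simp add: nsimp_iff)
  show "map \<phi> ` nerve Q \<subseteq> nerve ((`) \<phi> ` Q)"
    using n Q by (auto simp: nerve_def)
  show "nerve ((`) \<phi> ` Q) \<subseteq> map \<phi> ` nerve Q"
  proof
    fix ys assume "ys \<in> nerve ((`) \<phi> ` Q)"
    then obtain A where A: "nsimp ys" "A \<in> Q" "set ys = \<phi> ` A" by (auto simp: nerve_def)
    define xs where "xs = map (inv_into V \<phi>) ys"
    have AV: "A \<subseteq> V" using A(2) Q by blast
    have "set xs = inv_into V \<phi> ` \<phi> ` A" using A(3) by (simp add: xs_def)
    then have "set xs = A" using inv_into_image_cancel[OF inj AV] by simp
    moreover have "map \<phi> xs = ys"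
      unfolding xs_def map_map using A(3) image_mono[OF AV, of \<phi>]
      by (intro map_idI) (auto simp: f_inv_into_f)
    ultimately show "ys \<in> map \<phi> ` nerve Q" using n[of xs] A AV by (auto simp: nerve_def)
  qed
qed

abbreviation base :: "nat \<Rightarrow> (nat \<times> nat) set" where
  "base n \<equiv> {0..n} \<times> {0}"

lemma base_subset_iff: "base n \<subseteq> A \<longleftrightarrow> (\<forall>j\<le>n. (j,0) \<in> A)"
  by auto

lemma Simp_nerve: "Simp n = nerve (Pow (base n))"
  by (auto simp: Simp_def nerve_def)

lemma Horn_nerve: "Horn n i = nerve {A. A \<subseteq> base n \<and> (\<exists>j\<le>n. j \<noteq> i \<and> (j,0) \<notin> A)}"
  by (auto simp: Horn_def Simp_def nerve_def)

lemma Bdry_nerve: "Bdry n = nerve {A. A \<subseteq> base n \<and> \<not> base n \<subseteq> A}"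
  by (auto simp: Bdry_def Simp_def nerve_def)

lemma Prism_nerve: "Prism n = nerve (Pow ({0..n} \<times> {0,1}))"
  by (auto simp: Prism_def nerve_def)

lemma fincx_Simp: "fincx (Simp n)"
  unfolding Simp_nerve by (rule fincx_nerve[OF downclosed_Pow subset_refl]) simp

lemma fincx_Horn: "fincx (Horn n i)"
  unfolding Horn_nerve by (rule fincx_nerve[of _ "base n"]) (auto simp: downclosed_def)

lemma fincx_Bdry: "fincx (Bdry n)"
  unfolding Bdry_nerve by (rule fincx_nerve[of _ "base n"]) (auto simp: downclosed_def)

lemma fincx_Prism: "fincx (Prism n)"
  unfolding Prism_nerve by (rule fincx_nerve[OF downclosed_Pow subset_refl]) simp

lemma fincx_subcx: "fincx T \<Longrightarrow> subcx T"
  by (simp add: fincx_def)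

lemma Bdry_subset_Simp: "Bdry n \<subseteq> Simp n"
  by (auto simp: Bdry_def)

lemma Horn_subset_Simp: "Horn n i \<subseteq> Simp n"
  by (auto simp: Horn_def)

lemma Bdry_subset_Horn: "Bdry n \<subseteq> Horn (Suc n) (Suc n)"
  unfolding Bdry_nerve Horn_nerve
proof (rule nerve_mono, rule subsetI)
  fix A assume "A \<in> {A. A \<subseteq> base n \<and> \<not> base n \<subseteq> A}"
  then obtain j where j: "A \<subseteq> base n" "j \<le> n" "(j,0) \<notin> A" using base_subset_iff[of n A] by blast
  moreover have "base n \<subseteq> base (Suc n)" by auto
  ultimately have "A \<subseteq> base (Suc n)" by blast
  then show "A \<in> {A. A \<subseteq> base (Suc n) \<and> (\<exists>j\<le>Suc n. j \<noteq> Suc n \<and> (j,0) \<notin> A)}"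
    using j by (auto intro!: exI[of _ j])
qed

lemma Simp_subset_Suc: "Simp n \<subseteq> Simp (Suc n)"
  unfolding Simp_nerve by (rule nerve_mono) auto

text \<open>For \<open>v\<close> outside the vertices of \<open>Q\<close> this is the cone on
  \<open>Q\<close> with apex \<open>v\<close>, the unconed faces included. The apex itself belongs
  to it exactly if \<open>{}\<close> is in \<open>Q\<close>.\<close>

definition join :: "nat \<times> nat \<Rightarrow> (nat \<times> nat) set set \<Rightarrow> (nat \<times> nat) set set" where
  "join v Q = {A. A - {v} \<in> Q}"

lemma downclosed_join: "downclosed Q \<Longrightarrow> downclosed (join v Q)"
  unfolding downclosed_def join_def by (metis Diff_mono mem_Collect_eq order_refl)

lemma join_Pow: "join v (Pow A) = Pow (insert v A)"
  by (auto simp: join_def)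

lemma join_mono: "P \<subseteq> Q \<Longrightarrow> join v P \<subseteq> join v Q"
  by (auto simp: join_def)

section \<open>Horn and cone attachments as relative covers\<close>

locale kan_target = descent C cov
  for C :: "('o,'m) category" and cov :: "'m set" +
  fixes X Y :: "('o,'m) sobj" and f :: "nat \<Rightarrow> 'm"
  assumes X: "simplicial C X" and Y: "simplicial C Y" and f: "smor C X Y f"
    and kan: "0 < n \<Longrightarrow> i \<le> n \<Longrightarrow> restr_prop C Y (Simp n) (Horn n i) (\<lambda>h. h \<in> cov)"
begin

text \<open>The smaller pair comes first: the map that is a cover is the restriction to
  \<open>Map(S \<hookrightarrow> T, f)\<close> from the mapping object of the larger pair.\<close>

abbreviation rc :: "(nat \<times> nat) list set \<Rightarrow> (nat \<times> nat) list set \<Rightarrow> (nat \<times> nat) list set \<Rightarrow> (nat \<times> nat) list set \<Rightarrow> bool" where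
  "rc S T S' T' \<equiv> rel_cover (objs2 X Y) (arrs2 X Y f) (S <+> T) (S' <+> T')"

lemma wf: "wf_graph (objs2 X Y) (arrs2 X Y f)"
  by (rule wf_graph2[OF X Y f])

lemma rc_trans:
  assumes "rc S T S' T'" "rc S' T' S'' T''" "S \<subseteq> S'" "S' \<subseteq> S''" "T \<subseteq> T'" "T' \<subseteq> T''"
  shows "rc S T S'' T''"
  by (rule rel_cover_comp[OF wf _ _ assms(1,2)]) (use assms in auto)

text \<open>The \<open>X\<close>-part and the \<open>Y\<close>-part may grow at the same time, as
  the last shuffle of the prism requires.\<close>

lemma rc_attach:
  assumes "subcx S" "subcx T" "S \<subseteq> T" "subcx S'" "subcx T'" "S' \<subseteq> T'"
    and "rc (S \<inter> S') (T \<inter> T') S' T'"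
  shows "rc S T (S \<union> S') (T \<union> T')"
proof -
  have I: "(S \<inter> S') <+> (T \<inter> T') = (S <+> T) \<inter> (S' <+> T')" by auto
  have U: "(S \<union> S') <+> (T \<union> T') = (S <+> T) \<union> (S' <+> T')" by auto
  show ?thesis
    unfolding U by (rule rel_cover_union[OF wf closed2[OF assms(1-3)] closed2[OF assms(4-6)] assms(7)[unfolded I]])
qed

text \<open>Mapping objects depend on a complex only up to isomorphism, here a renaming of vertices.
  The components are identities, present because \<open>cone_equiv\<close> asks for a morphism at
  each index.\<close>

lemma relabel_equiv:
  assumes S: "subcx S" and T: "subcx T" and ST: "S \<subseteq> T" and V: "\<Union>(set ` T) \<subseteq> V" and inj: "inj_on \<phi> V"
    and nT: "\<And>s. s \<in> T \<Longrightarrow> nsimp (map \<phi> s)"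
  shows "cone_equiv (objs2 X Y) (arrs2 X Y f) (S <+> T) (objs2 X Y) (arrs2 X Y f) (map \<phi> ` S <+> map \<phi> ` T)
    (map_sum (map \<phi>) (map \<phi>)) (\<lambda>i. Idm C (objs2 X Y i))"
proof -
  let ?D = "objs2 X Y" and ?E = "arrs2 X Y f" and ?g = "map_sum (map \<phi>) (map \<phi>)"
  let ?I = "S <+> T" and ?I' = "map \<phi> ` S <+> map \<phi> ` T"
  define \<psi> where "\<psi> = inv_into V \<phi>"
  have \<psi>: "map \<psi> (map \<phi> s) = s" if "s \<in> T" for s
    using that V inv_into_f_f[OF inj] by (auto simp: \<psi>_def intro!: map_idI)
  have Dg: "?D (?g i) = ?D i" for i by (cases i) simp_all
  have obj: "?D i \<in> Obj C" for i using simplicialD(1)[OF X] simplicialD(1)[OF Y] by (cases i) auto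
  have gI: "?g i \<in> ?I'" if "i \<in> ?I" for i using that by auto
  have id: "Idm C (?D i) \<cdot> e (?g i) = e (?g i)" if "cone ?D ?E ?I' U e" "i \<in> ?I" for e U i
    using comp_id(2)[OF coneD(2)[OF that(1) gI[OF that(2)]]] by (simp add: Dg)
  have ms: "sact \<theta> m (map \<phi> s) = map \<phi> (sact \<theta> m s)" if "s \<in> T" "mono_map m (sdim s) \<theta>" for s \<theta> m
    using map_sact[OF nsimp_ne[OF subcxD(1)[OF T that(1)]] that(2)] by simp
  have down: "cone ?D ?E ?I U (\<lambda>i. e (?g i))" if "cone ?D ?E ?I' U e" for U e
    using that unfolding cone2_iff cone1_iff using ST by (auto simp: ms subset_iff)
  have up: "cone ?D ?E ?I' U (\<lambda>i. e (map_sum (map \<psi>) (map \<psi>) i))" if "cone ?D ?E ?I U e" for U e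
    using that unfolding cone2_iff cone1_iff
    using ST subcxD(2)[OF S] subcxD(2)[OF T] by (auto simp: ms \<psi> subset_iff simp del: map_map)
  show ?thesis
    unfolding cone_equiv_def
  proof (intro conjI ballI allI impI)
    fix i assume i: "i \<in> ?I"
    show "?g i \<in> ?I'" by (rule gI[OF i])
    show "Idm C (?D i) \<in> hom C (?D (?g i)) (?D i)" unfolding Dg by (rule id_in_hom[OF obj])
  next
    fix U e assume e: "cone ?D ?E ?I' U e"
    have "cone ?D ?E ?I U (\<lambda>i. Idm C (?D i) \<cdot> e (?g i)) \<longleftrightarrow> cone ?D ?E ?I U (\<lambda>i. e (?g i))"
      by (rule cone_cong[OF closed2[OF S T ST]]) (rule id[OF e])
    then show "cone ?D ?E ?I U (\<lambda>i. Idm C (?D i) \<cdot> e (?g i))" using down[OF e] by blast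
  next
    fix U e assume e: "cone ?D ?E ?I U e"
    have "e (map_sum (map \<psi>) (map \<psi>) (?g i)) = e i" if "i \<in> ?I" for i
      using that \<psi> ST by (auto simp: subset_iff simp del: map_map)
    then show "\<exists>e'. cone ?D ?E ?I' U e' \<and> (\<forall>i\<in>?I. Idm C (?D i) \<cdot> e' (?g i) = e i)"
      using up[OF e] id[OF up[OF e]] by (intro exI[of _ "\<lambda>i. e (map_sum (map \<psi>) (map \<psi>) i)"]) simp
  next
    fix U e e' i
    assume e: "cone ?D ?E ?I' U e" and e': "cone ?D ?E ?I' U e'"
      and eq: "\<forall>i\<in>?I. Idm C (?D i) \<cdot> e (?g i) = Idm C (?D i) \<cdot> e' (?g i)" and i: "i \<in> ?I'"
    have "e (?g j) = e' (?g j)" if "j \<in> ?I" for j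
      using bspec[OF eq that] id[OF e that] id[OF e' that] by simp
    moreover obtain j where "j \<in> ?I" "i = ?g j" using i by fastforce
    ultimately show "e i = e' i" by simp
  qed
qed

lemma relabel:
  assumes "subcx S" "subcx T" "S \<subseteq> T" "subcx S'" "subcx T'" "S' \<subseteq> T'" "S \<subseteq> S'" "T \<subseteq> T'"
    and "\<Union>(set ` T') \<subseteq> V" "inj_on \<phi> V" "\<And>s. s \<in> T' \<Longrightarrow> nsimp (map \<phi> s)"
  shows "rc (map \<phi> ` S) (map \<phi> ` T) (map \<phi> ` S') (map \<phi> ` T') \<longleftrightarrow> rc S T S' T'"
proof -
  have i: "cone_equiv (objs2 X Y) (arrs2 X Y f) (S <+> T) (objs2 X Y) (arrs2 X Y f) (map \<phi> ` S <+> map \<phi> ` T)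
    (map_sum (map \<phi>) (map \<phi>)) (\<lambda>i. Idm C (objs2 X Y i))"
    by (rule relabel_equiv[OF assms(1-3) _ assms(10)]) (use assms(8,9,11) in blast)+
  have j: "cone_equiv (objs2 X Y) (arrs2 X Y f) (S' <+> T') (objs2 X Y) (arrs2 X Y f) (map \<phi> ` S' <+> map \<phi> ` T')
    (map_sum (map \<phi>) (map \<phi>)) (\<lambda>i. Idm C (objs2 X Y i))"
    by (rule relabel_equiv[OF assms(4-6,9-11)])
  have s: "S <+> T \<subseteq> S' <+> T'" "map \<phi> ` S <+> map \<phi> ` T \<subseteq> map \<phi> ` S' <+> map \<phi> ` T'" using assms(7,8) by auto
  show ?thesis
    using cone_equiv_rel_cover[OF wf wf s i j]
      cone_equiv_rel_cover'[OF wf wf s closed2[OF assms(1-3)] closed2[OF assms(4-6)] i j] by blast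
qed

text \<open>\<open>horn\<close> says that exactly two nonempty faces of the simplex on
  \<open>A0\<close> are absent from \<open>Q\<close>, namely \<open>A0\<close> and the face opposite
  \<open>w\<close>. Listing the chain \<open>A0\<close> in increasing order identifies the
  attachment with a standard horn whose index is the position of \<open>w\<close>, and the Kan
  condition on \<open>Y\<close> applies. The empty face is exempted because it is the vertex set of
  no simplex.\<close>

lemma horn_attach:
  assumes A0: "finite A0" "vchain A0" "w \<in> A0" "A0 \<noteq> {w}"
    and Q: "downclosed Q" and S: "subcx S" "S \<subseteq> nerve Q"
    and horn: "\<And>A. A \<subseteq> A0 \<Longrightarrow> A \<noteq> {} \<Longrightarrow> A \<in> Q \<longleftrightarrow> \<not> A0 - {w} \<subseteq> A"
  shows "rc S (nerve Q) S (nerve (Q \<union> Pow A0))"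
proof -
  obtain c where c: "set c = A0" "distinct c" "nsimp c" using vchain_list[OF A0(1,2)] A0(3) by blast
  define n where "n = sdim c"
  have len: "length c = Suc n" using length_sdim[OF nsimp_ne[OF c(3)]] by (simp add: n_def)
  obtain i0 where i0: "i0 \<le> n" "c ! i0 = w" using in_set_slist[OF nsimp_ne[OF c(3)], of w] c(1) A0(3) by (auto simp: n_def)
  have "n \<noteq> 0"
  proof
    assume "n = 0"
    then have "c = [w]" using len i0 by (cases c) auto
    then show False using c(1) A0(4) by simp
  qed
  then have n: "0 < n" by simp
  define \<phi> where "\<phi> = (\<lambda>(i::nat, _::nat). c ! i)"
  have \<phi>: "\<phi> (i, k) = c ! i" for i k by (simp add: \<phi>_def)
  have inj: "inj_on \<phi> (base n)"
    using c(2) len by (auto simp: inj_on_def \<phi> nth_eq_iff_index_eq)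
  have ord: "vle (\<phi> x) (\<phi> y) \<longleftrightarrow> vle x y" if xy: "x \<in> base n" "y \<in> base n" for x y
  proof -
    obtain i j where ij: "x = (i,0)" "y = (j,0)" "i \<le> n" "j \<le> n" using xy by auto
    show ?thesis
    proof (cases "i \<le> j")
      case True
      then show ?thesis using nsimp_nth[OF c(3), of i j] ij by (simp add: \<phi> n_def vle_def)
    next
      case False
      then have "vle (c ! j) (c ! i)" using nsimp_nth[OF c(3), of j i] ij by (simp add: n_def)
      moreover have "c ! i \<noteq> c ! j" using False ij c(2) len by (simp add: nth_eq_iff_index_eq)
      ultimately have "\<not> vle (c ! i) (c ! j)" using vle_antisym by blast
      then show ?thesis using ij False by (simp add: \<phi> vle_def)
    qed
  qed
  have im: "\<phi> ` base n = A0" using c(1) in_set_slist[OF nsimp_ne[OF c(3)]] by (force simp: \<phi> n_def image_def)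
  have mn: "map \<phi> ` nerve R = nerve ((`) \<phi> ` R)" if "R \<subseteq> Pow (base n)" for R
    by (rule map_nerve[OF inj ord that])
  have pre: "\<phi> ` (base n \<inter> \<phi> -` B) = B" if "B \<subseteq> A0" for B using that im by auto
  have 1: "map \<phi> ` Simp n = nerve (Pow A0)"
    unfolding Simp_nerve mn[OF subset_refl] image_Pow_surj[OF im] ..
  let ?H = "{A. A \<subseteq> base n \<and> (\<exists>j\<le>n. j \<noteq> i0 \<and> (j,0) \<notin> A)}"
  have HP: "?H \<subseteq> Pow (base n)" by auto
  have 2: "map \<phi> ` Horn n i0 = nerve Q \<inter> nerve (Pow A0)"
    unfolding Horn_nerve mn[OF HP] nerve_Int[symmetric]
  proof (intro equalityI nerve_subset_chainI)
    fix B assume "B \<in> (`) \<phi> ` ?H" "B \<noteq> {}"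
    then obtain A j where A: "B = \<phi> ` A" "A \<subseteq> base n" "j \<le> n" "j \<noteq> i0" "(j,0) \<notin> A" by auto
    have "c ! j \<notin> B"
    proof
      assume "c ! j \<in> B"
      then obtain x where "x \<in> A" "\<phi> x = \<phi> (j,0)" using A(1) \<phi> by auto
      then show False using inj_onD[OF inj, of x "(j,0)"] A by auto
    qed
    moreover have "c ! j \<in> A0 - {w}"
      using c(1,2) len A(3,4) i0 nth_eq_iff_index_eq[OF c(2), of j i0] by (auto simp: less_Suc_eq_le)
    moreover have BA: "B \<subseteq> A0" using A(1,2) im by blast
    ultimately show "B \<in> Q \<inter> Pow A0" using horn[OF BA \<open>B \<noteq> {}\<close>] by blast
  next
    fix B assume B: "B \<in> Q \<inter> Pow A0" "B \<noteq> {}"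
    then have "\<not> A0 - {w} \<subseteq> B" using horn[of B] by blast
    then obtain x where x: "x \<in> A0" "x \<noteq> w" "x \<notin> B" by blast
    then obtain j where j: "j \<le> n" "x = c ! j" using c(1) in_set_slist[OF nsimp_ne[OF c(3)]] by (auto simp: n_def)
    have "base n \<inter> \<phi> -` B \<in> ?H"
      using j x i0 by (auto simp: \<phi> intro!: exI[of _ j])
    moreover have "B = \<phi> ` (base n \<inter> \<phi> -` B)" using pre[of B] B by blast
    ultimately show "B \<in> (`) \<phi> ` ?H" by blast
  qed
  have nT: "nsimp (map \<phi> s)" if "s \<in> Simp n" for s
    using imageI[OF that, of "map \<phi>"] unfolding 1 by (simp add: nerve_def)
  have s0: "subcx {}" by (simp add: subcx_def)
  have "rc {} (Horn n i0) {} (Simp n)"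
    by (rule rel_cover_if_restr_prop[OF X Y f Horn_subset_Simp fincx_Horn fincx_Simp kan[OF n i0(1)]])
  then have "rc (map \<phi> ` {}) (map \<phi> ` Horn n i0) (map \<phi> ` {}) (map \<phi> ` Simp n)"
    by (subst relabel[where V = "base n"])
      (use s0 fincx_Horn fincx_Simp Horn_subset_Simp inj nT in \<open>auto simp: fincx_subcx Simp_def\<close>)
  \<comment> \<open>The cell is attached with empty \<open>X\<close>-part, so gluing leaves
    \<open>S\<close> unchanged.\<close>
  then have "rc (S \<inter> {}) (nerve Q \<inter> nerve (Pow A0)) {} (nerve (Pow A0))"
    unfolding 1 2 by simp
  from rc_attach[OF S(1) subcx_nerve[OF Q] S(2) s0 subcx_nerve[OF downclosed_Pow] _ this]
  show ?thesis by (simp add: nerve_Un)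
qed

text \<open>The cone on \<open>Q\<close> is enlarged to the cone on \<open>Q'\<close> by one simplex
  \<open>B\<close> at a time. All proper faces of \<open>B\<close> and their cones are already
  present, so just \<open>B\<close> and \<open>insert v B\<close> are new: this is the horn at the
  last vertex \<open>v\<close>. A \<open>B\<close> that is not a chain adds nothing to the nerve.
  \<open>{} \<in> Q\<close> supplies the apex and makes \<open>B\<close> nonempty.\<close>

lemma join_attach:
  assumes V: "finite V" "v \<notin> V" "\<And>x. x \<in> V \<Longrightarrow> vle x v"
    and Q': "downclosed Q'" "Q' \<subseteq> Pow V"
  shows "downclosed Q \<Longrightarrow> {} \<in> Q \<Longrightarrow> Q \<subseteq> Q' \<Longrightarrow> subcx S \<Longrightarrow> S \<subseteq> nerve (join v Q) \<Longrightarrow>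
    rc S (nerve (join v Q)) S (nerve (join v Q'))"
proof (induction "card (Q' - Q)" arbitrary: Q rule: less_induct)
  case less
  have fQ': "finite Q'" using finite_subset[OF Q'(2)] V(1) by simp
  show ?case
  proof (cases "Q = Q'")
    case True
    then show ?thesis using rel_cover_refl[OF wf] by simp
  next
    case False
    then obtain B0 where B0: "B0 \<in> Q' - Q" using less.prems(3) by blast
    \<comment> \<open>Least cardinality puts every proper subset of \<open>B\<close> into
      \<open>Q\<close>.\<close>
    define B where "B = arg_min card (\<lambda>B. B \<in> Q' - Q)"
    have B: "B \<in> Q' - Q" and Bmin: "\<And>A. A \<in> Q' - Q \<Longrightarrow> card B \<le> card A"
      unfolding B_def using arg_min_natI[of "\<lambda>B. B \<in> Q' - Q" B0 card] arg_min_nat_le[of "\<lambda>B. B \<in> Q' - Q" _ card] B0 by blast+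
    have BV: "B \<subseteq> V" "finite B" using B Q' V(1) finite_subset by blast+
    have Bsub: "A \<in> Q" if "A \<subset> B" for A
    proof (rule ccontr)
      assume "A \<notin> Q"
      moreover have "A \<in> Q'" using downclosedD[OF Q'(1)] B that by blast
      ultimately have "card B \<le> card A" using Bmin by blast
      then show False using psubset_card_mono[OF BV(2) that] by simp
    qed
    have vB: "v \<notin> B" using BV V(2) by blast
    have dQ1: "downclosed (insert B Q)"
      unfolding downclosed_def using downclosedD[OF less.prems(1)] Bsub by blast
    have jQ1: "join v (insert B Q) = join v Q \<union> Pow (insert v B)"
    proof -
      have "A - {v} \<in> insert B Q \<longleftrightarrow> A - {v} \<in> Q \<or> A \<subseteq> insert v B" for A
      proof -
        have "A \<subseteq> insert v B \<longleftrightarrow> A - {v} \<subset> B \<or> A - {v} = B" by blast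
        then show ?thesis using Bsub[of "A - {v}"] unfolding insert_iff by blast
      qed
      then show ?thesis by (auto simp: join_def)
    qed
    have step: "rc S (nerve (join v Q)) S (nerve (join v (insert B Q)))"
    proof (cases "vchain B")
      case True
      have ch: "vchain (insert v B)" using True V(3) BV(1) vle_refl unfolding vchain_def by blast
      have "B \<noteq> {}" using B less.prems(2) by blast
      show ?thesis
        unfolding jQ1
      proof (rule horn_attach[OF _ ch, of v])
        show "finite (insert v B)" "v \<in> insert v B" "insert v B \<noteq> {v}" using BV(2) \<open>B \<noteq> {}\<close> vB by auto
        show "downclosed (join v Q)" by (rule downclosed_join[OF less.prems(1)])
        fix A assume "A \<subseteq> insert v B"
        then have "A - {v} \<subset> B \<or> A - {v} = B" by blast
        then show "A \<in> join v Q \<longleftrightarrow> \<not> insert v B - {v} \<subseteq> A"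
          using Bsub B vB by (auto simp: join_def)
      qed (use less.prems in auto)
    next
      case False
      have "nerve (join v (insert B Q)) \<subseteq> nerve (join v Q)"
      proof (rule nerve_subset_chainI)
        fix A assume A: "A \<in> join v (insert B Q)" "vchain A"
        then have "A - {v} \<noteq> B" using False unfolding vchain_def by blast
        then show "A \<in> join v Q" using A by (auto simp: join_def)
      qed
      moreover have "nerve (join v Q) \<subseteq> nerve (join v (insert B Q))" by (intro nerve_mono join_mono) blast
      ultimately have "nerve (join v (insert B Q)) = nerve (join v Q)" by blast
      then show ?thesis using rel_cover_refl[OF wf] by simp
    qed
    have sub: "nerve (join v Q) \<subseteq> nerve (join v (insert B Q))" by (intro nerve_mono join_mono) blast
    have "rc S (nerve (join v (insert B Q))) S (nerve (join v Q'))"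
    proof (rule less.hyps)
      have "Q' - insert B Q \<subset> Q' - Q" using B by blast
      then show "card (Q' - insert B Q) < card (Q' - Q)" by (rule psubset_card_mono[rotated]) (use fQ' in simp)
    qed (use dQ1 less.prems B sub in auto)
    moreover have "nerve (join v (insert B Q)) \<subseteq> nerve (join v Q')"
      by (intro nerve_mono join_mono) (use less.prems B in blast)
    ultimately show ?thesis using rc_trans[OF step _ subset_refl subset_refl sub] by blast
  qed
qed

text \<open>\<open>Horn (Suc n) (Suc n)\<close> is the cone on the boundary of the face
  \<open>0..n\<close> with the last vertex as apex, and any vertex above that face can replace the
  apex. The renaming fixes \<open>base n\<close>, hence the \<open>X\<close>-part. It is applied to
  the end \<open>(n,1)\<close> of the last shuffle and to the cone vertex
  \<open>(Suc n,1)\<close>.\<close>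

lemma relabel_last_vertex:
  assumes v: "snd v = 1" "n \<le> fst v"
  shows "rc (Bdry n) (nerve (join v {A. A \<subseteq> base n \<and> \<not> base n \<subseteq> A})) (Simp n) (nerve (Pow (insert v (base n))))
    \<longleftrightarrow> rc (Bdry n) (Horn (Suc n) (Suc n)) (Simp n) (Simp (Suc n))"
proof -
  define \<phi> where "\<phi> = (\<lambda>(i::nat, k::nat). if i \<le> n then (i, k) else v)"
  have inj: "inj_on \<phi> (base (Suc n))" using v by (auto simp: inj_on_def \<phi>_def)
  have ord: "vle (\<phi> x) (\<phi> y) \<longleftrightarrow> vle x y" if "x \<in> base (Suc n)" "y \<in> base (Suc n)" for x y
    using that v by (auto simp: \<phi>_def vle_def split: if_splits)
  have v0: "v \<notin> base n" using v by auto
  have bs: "base (Suc n) = insert (Suc n, 0) (base n)" by auto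
  have \<phi>0: "\<phi> x = x" if "x \<in> base n" for x using that by (auto simp: \<phi>_def)
  have \<phi>S: "\<phi> (Suc n, 0) = v" by (simp add: \<phi>_def)
  have im: "\<phi> ` base (Suc n) = insert v (base n)"
    unfolding bs image_insert \<phi>S using \<phi>0 by simp
  have mn: "map \<phi> ` nerve R = nerve ((`) \<phi> ` R)" if "R \<subseteq> Pow (base (Suc n))" for R
    by (rule map_nerve[OF inj ord that])
  have fixS: "map \<phi> ` S = S" if "S \<subseteq> Simp n" for S
  proof -
    have "map \<phi> s = s" if "s \<in> S" for s
      using that \<open>S \<subseteq> Simp n\<close> \<phi>0 by (intro map_idI) (auto simp: Simp_def)
    then show ?thesis by simp
  qed
  have 1: "map \<phi> ` Simp (Suc n) = nerve (Pow (insert v (base n)))"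
    unfolding Simp_nerve mn[OF subset_refl] image_Pow_surj[OF im] ..
  let ?H = "{A. A \<subseteq> base (Suc n) \<and> (\<exists>j\<le>Suc n. j \<noteq> Suc n \<and> (j,0) \<notin> A)}"
  let ?B = "{A. A \<subseteq> base n \<and> \<not> base n \<subseteq> A}"
  have HP: "?H \<subseteq> Pow (base (Suc n))" by auto
  have "(`) \<phi> ` ?H = join v ?B"
  proof (intro equalityI subsetI)
    fix B assume "B \<in> (`) \<phi> ` ?H"
    then obtain A j where A: "B = \<phi> ` A" "A \<subseteq> base (Suc n)" "j \<le> n" "(j,0) \<notin> A" by (auto simp: le_Suc_eq)
    have "B \<subseteq> insert v (base n)" using A(1,2) im by blast
    moreover have "(j,0) \<notin> B"
    proof
      assume "(j,0) \<in> B"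
      moreover have "\<phi> (j,0) = (j,0)" using A(3) by (simp add: \<phi>_def)
      ultimately obtain x where "x \<in> A" "\<phi> x = \<phi> (j,0)" using A(1) by force
      then show False using inj_onD[OF inj, of x "(j,0)"] A by auto
    qed
    ultimately have "B - {v} \<subseteq> base n" "\<not> base n \<subseteq> B - {v}"
      using base_subset_iff[of n "B - {v}"] A(3) by blast+
    then show "B \<in> join v ?B" unfolding join_def by blast
  next
    fix B assume "B \<in> join v ?B"
    then have B: "B \<subseteq> insert v (base n)" "\<not> base n \<subseteq> B" using v0 unfolding join_def by blast+
    then obtain j where j: "j \<le> n" "(j,0) \<notin> B" using base_subset_iff[of n B] by blast
    have "base (Suc n) \<inter> \<phi> -` B \<in> ?H" using j by (auto simp: \<phi>_def intro!: exI[of _ j])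
    moreover have "B = \<phi> ` (base (Suc n) \<inter> \<phi> -` B)" using B(1)[folded im] by blast
    ultimately show "B \<in> (`) \<phi> ` ?H" by blast
  qed
  then have 2: "map \<phi> ` Horn (Suc n) (Suc n) = nerve (join v ?B)"
    unfolding Horn_nerve mn[OF HP] by simp
  have nT: "nsimp (map \<phi> s)" if "s \<in> Simp (Suc n)" for s
    using imageI[OF that, of "map \<phi>"] unfolding 1 by (simp add: nerve_def)
  have "rc (map \<phi> ` Bdry n) (map \<phi> ` Horn (Suc n) (Suc n)) (map \<phi> ` Simp n) (map \<phi> ` Simp (Suc n))
    \<longleftrightarrow> rc (Bdry n) (Horn (Suc n) (Suc n)) (Simp n) (Simp (Suc n))"
    by (rule relabel[where V = "base (Suc n)"])
      (use fincx_Bdry fincx_Horn fincx_Simp Bdry_subset_Horn Simp_subset_Suc Bdry_subset_Simp Horn_subset_Simp inj nT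
        in \<open>auto simp: fincx_subcx Simp_def\<close>)
  then show ?thesis unfolding 1 2 fixS[OF Bdry_subset_Simp] fixS[OF subset_refl] .
qed

end

section \<open>Filling the prism\<close>

abbreviation prism_verts :: "nat \<Rightarrow> (nat \<times> nat) set" where
  "prism_verts n \<equiv> {0..n} \<times> {0,1}"

text \<open>The first alternative describes the boundary of the simplex times the interval, whose
  simplices miss a column; the second describes the end at level 1.\<close>

definition prism_bdry :: "nat \<Rightarrow> (nat \<times> nat) set set" where
  "prism_bdry n = {A. A \<subseteq> prism_verts n \<and> (\<not> {0..n} \<subseteq> fst ` A \<or> A \<subseteq> {0..n} \<times> {1})}"

text \<open>The maximal chain that climbs from level 0 to level 1 in column
  \<open>i\<close>.\<close>

definition shuffle :: "nat \<Rightarrow> nat \<Rightarrow> (nat \<times> nat) set" where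
  "shuffle n i = {0..i} \<times> {0} \<union> {i..n} \<times> {1}"

text \<open>The bound is strict: \<open>stage n n\<close> lacks only the last shuffle, and
  \<open>stage n (Suc n)\<close> has them all. The filling starts with shuffle 0 because its face
  opposite \<open>(0,0)\<close> is the given end at level 1.\<close>

definition stage :: "nat \<Rightarrow> nat \<Rightarrow> (nat \<times> nat) set set" where
  "stage n i = prism_bdry n \<union> (\<Union>j<i. Pow (shuffle n j))"

lemma stage_0: "stage n 0 = prism_bdry n"
  by (simp add: stage_def)

lemma stage_Suc: "stage n (Suc i) = stage n i \<union> Pow (shuffle n i)"
  by (auto simp: stage_def lessThan_Suc)

lemma downclosed_prism_bdry: "downclosed (prism_bdry n)"
  unfolding downclosed_def
proof (intro ballI allI impI)
  fix A B assume A: "A \<in> prism_bdry n" and B: "B \<subseteq> A"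
  have "fst ` B \<subseteq> fst ` A" using B by (rule image_mono)
  then show "B \<in> prism_bdry n" using A B unfolding prism_bdry_def by blast
qed

lemma downclosed_stage: "downclosed (stage n i)"
  by (induction i) (simp_all add: stage_0 stage_Suc downclosed_prism_bdry downclosed_Un downclosed_Pow)

lemma shuffle_subset: "i \<le> n \<Longrightarrow> shuffle n i \<subseteq> prism_verts n"
  by (auto simp: shuffle_def)

lemma stage_subset:
  assumes "i \<le> Suc n"
  shows "stage n i \<subseteq> Pow (prism_verts n)"
  unfolding stage_def
proof (intro Un_least UN_least)
  show "prism_bdry n \<subseteq> Pow (prism_verts n)" by (auto simp: prism_bdry_def)
  show "Pow (shuffle n j) \<subseteq> Pow (prism_verts n)" if "j \<in> {..<i}" for j
    using shuffle_subset[of j n] assms that by (intro Pow_mono) simp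
qed

lemma vchain_shuffle: "vchain (shuffle n i)"
  by (auto simp: vchain_def shuffle_def vle_def)

lemma finite_shuffle: "finite (shuffle n i)"
  by (simp add: shuffle_def)

lemma in_shuffle: "(i,0) \<in> shuffle n i" "i \<le> n \<Longrightarrow> (i,1) \<in> shuffle n i"
  by (simp_all add: shuffle_def)

text \<open>A face opposite a vertex in a column other than \<open>i\<close> misses that column. The
  face opposite \<open>(i,0)\<close> lies at level 1 if \<open>i = 0\<close>, and otherwise in the
  preceding shuffle. The face opposite \<open>(i,1)\<close> meets every column and contains
  \<open>(i,0)\<close>, which is not at level 1 and belongs to no earlier shuffle, so it is
  new.\<close>

lemma stage_horn:
  assumes i: "i \<le> n" and A: "A \<subseteq> shuffle n i"
  shows "A \<in> stage n i \<longleftrightarrow> \<not> shuffle n i - {(i,1)} \<subseteq> A"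
proof
  assume "A \<in> stage n i"
  have i0: "(i,0) \<in> shuffle n i - {(i,1)}" by (simp add: shuffle_def)
  from \<open>A \<in> stage n i\<close> consider "\<not> {0..n} \<subseteq> fst ` A" | "A \<subseteq> {0..n} \<times> {1}" | j where "j < i" "A \<subseteq> shuffle n j"
    by (auto simp: stage_def prism_bdry_def)
  then show "\<not> shuffle n i - {(i,1)} \<subseteq> A"
  proof cases
    case 1
    then obtain j where "j \<in> {0..n}" "j \<notin> fst ` A" by blast
    then have j: "j \<le> n" "j \<notin> fst ` A" by simp_all
    then have "(j,0) \<notin> A" "(j,1) \<notin> A" by force+
    moreover have "(j,0) \<in> shuffle n i - {(i,1)} \<or> (j,1) \<in> shuffle n i - {(i,1)}"
      using j(1) by (auto simp: shuffle_def)
    ultimately show ?thesis by blast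
  next
    case 2
    then have "(i,0) \<notin> A" by auto
    then show ?thesis using i0 by blast
  next
    case 3
    then have "(i,0) \<notin> A" by (auto simp: shuffle_def)
    then show ?thesis using i0 by blast
  qed
next
  assume "\<not> shuffle n i - {(i,1)} \<subseteq> A"
  then obtain j k where x: "(j,k) \<in> shuffle n i" "(j,k) \<noteq> (i,1)" "(j,k) \<notin> A" by force
  have AV: "A \<subseteq> prism_verts n" using A shuffle_subset[OF i] by blast
  have jn: "j \<le> n" using x(1) i by (auto simp: shuffle_def)
  show "A \<in> stage n i"
  proof (cases "j = i")
    case False
    then have "(j,k') \<notin> A" for k' using A x by (auto simp: shuffle_def)
    then have "j \<notin> fst ` A" by force
    then show ?thesis using jn AV by (auto simp: stage_def prism_bdry_def)
  next
    case True
    then have k: "k = 0" using x by (auto simp: shuffle_def)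
    show ?thesis
    proof (cases i)
      case 0
      then have "A \<subseteq> {0..n} \<times> {1}" using A x True k by (fastforce simp: shuffle_def)
      then show ?thesis using AV by (auto simp: stage_def prism_bdry_def)
    next
      case (Suc l)
      have "A \<subseteq> shuffle n l"
      proof
        fix y assume y: "y \<in> A"
        then have "y \<in> shuffle n i" "y \<noteq> (i,0)" using A x True k by auto
        then show "y \<in> shuffle n l" using Suc by (auto simp: shuffle_def)
      qed
      then show ?thesis using Suc by (auto simp: stage_def)
    qed
  qed
qed

text \<open>The last column \<open>i\<close> that the chain uses at level 0 determines a shuffle: a
  vertex at level 1 is comparable with \<open>(i,0)\<close> only if its column is at least
  \<open>i\<close>.\<close>

lemma chain_in_stage:
  assumes A: "A \<subseteq> prism_verts n" "vchain A"
  shows "A \<in> stage n (Suc n)"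
proof (cases "A \<subseteq> {0..n} \<times> {1}")
  case True
  then show ?thesis using A by (auto simp: stage_def prism_bdry_def)
next
  case False
  define J where "J = {j. (j,0) \<in> A}"
  have J: "finite J" "J \<noteq> {}" "J \<subseteq> {0..n}"
    using A False by (auto simp: J_def intro: finite_subset[of _ "{0..n}"])
  define i where "i = Max J"
  have i: "(i,0) \<in> A" "i \<le> n" using Max_in[OF J(1,2)] J(3) by (auto simp: i_def J_def)
  have "A \<subseteq> shuffle n i"
  proof
    fix x assume x: "x \<in> A"
    then obtain j k where jk: "x = (j,k)" "j \<le> n" "k = 0 \<or> k = 1" using A by auto
    show "x \<in> shuffle n i"
    proof (cases "k = 0")
      case True
      then have "j \<le> i" unfolding i_def using Max_ge[OF J(1)] x jk by (simp add: J_def)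
      then show ?thesis using True jk by (simp add: shuffle_def)
    next
      case False
      then have "k = 1" using jk by blast
      moreover have "vle (i,0) x \<or> vle x (i,0)" using A(2) i(1) x by (auto simp: vchain_def)
      ultimately show ?thesis using jk by (auto simp: shuffle_def vle_def)
    qed
  qed
  then show ?thesis using i(2) by (auto simp: stage_def less_Suc_eq_le)
qed

lemma nerve_stage_top: "nerve (stage n (Suc n)) = Prism n"
proof
  show "nerve (stage n (Suc n)) \<subseteq> Prism n"
    unfolding Prism_nerve by (rule nerve_mono[OF stage_subset]) simp
  show "Prism n \<subseteq> nerve (stage n (Suc n))"
    unfolding Prism_nerve by (rule nerve_subset_chainI) (use chain_in_stage in auto)
qed

lemma Bdry_subset_prism_bdry: "Bdry n \<subseteq> nerve (prism_bdry n)"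
  unfolding Bdry_nerve
proof (rule nerve_mono, rule subsetI)
  fix A assume "A \<in> {A. A \<subseteq> base n \<and> \<not> base n \<subseteq> A}"
  then obtain j where A: "A \<subseteq> base n" "j \<le> n" "(j,0) \<notin> A" using base_subset_iff[of n A] by blast
  then have "j \<notin> fst ` A" by auto
  then show "A \<in> prism_bdry n" using A by (auto simp: prism_bdry_def)
qed

lemma Simp_subset_Prism: "Simp n \<subseteq> Prism n"
  by (auto simp: Simp_def Prism_def)

lemma stage_mono: "i \<le> j \<Longrightarrow> stage n i \<subseteq> stage n j"
  unfolding stage_def by auto

section \<open>The two implications for a fixed dimension\<close>

context kan_target
begin

text \<open>Shuffles below \<open>n\<close> have their free face in the interior of the prism and
  are attached as horns of \<open>Y\<close> over a fixed \<open>X\<close>-part. The free face of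
  shuffle \<open>n\<close> is the bottom, so that cell is attached together with
  \<open>Simp n\<close> in the \<open>X\<close>-part; its horn is the one at the last vertex
  \<open>(n,1)\<close>, and the hypothesis applies.\<close>

lemma hypercover_map_if:
  assumes rhs: "rc (Bdry n) (Horn (Suc n) (Suc n)) (Simp n) (Simp (Suc n))"
  shows "rc (Bdry n) (nerve (prism_bdry n)) (Simp n) (Prism n)"
proof -
  have B: "Bdry n \<subseteq> nerve (stage n i)" for i
    using Bdry_subset_prism_bdry nerve_mono[OF stage_mono[of 0 i n]] by (auto simp: stage_0)
  have sB: "subcx (Bdry n)" using fincx_Bdry fincx_subcx by blast
  have fill: "i \<le> n \<Longrightarrow> rc (Bdry n) (nerve (prism_bdry n)) (Bdry n) (nerve (stage n i))" for i
  proof (induction i)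
    case 0
    then show ?case using rel_cover_refl[OF wf] by (simp add: stage_0)
  next
    case (Suc i)
    have "rc (Bdry n) (nerve (stage n i)) (Bdry n) (nerve (stage n i \<union> Pow (shuffle n i)))"
    proof (rule horn_attach[OF _ vchain_shuffle _ _ downclosed_stage sB B])
      show "finite (shuffle n i)" by (rule finite_shuffle)
      show "(i,1) \<in> shuffle n i" using Suc.prems by (intro in_shuffle) simp
      show "shuffle n i \<noteq> {(i,1)}" using in_shuffle(1)[of i n] by fastforce
      show "A \<in> stage n i \<longleftrightarrow> \<not> shuffle n i - {(i,1)} \<subseteq> A" if "A \<subseteq> shuffle n i" for A
        by (rule stage_horn[OF _ that]) (use Suc.prems in simp)
    qed
    note st = this
    have "rc (Bdry n) (nerve (prism_bdry n)) (Bdry n) (nerve (stage n i))"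
      by (rule Suc.IH) (use Suc.prems in simp)
    moreover have "nerve (prism_bdry n) \<subseteq> nerve (stage n i)"
      using nerve_mono[OF stage_mono[of 0 i n]] by (simp add: stage_0)
    ultimately show ?case
      unfolding stage_Suc by (rule rc_trans[OF _ st subset_refl subset_refl _ nerve_mono[OF Un_upper1]])
  qed
  let ?B = "{A. A \<subseteq> base n \<and> \<not> base n \<subseteq> A}"
  have sh: "shuffle n n = insert (n,1) (base n)" by (auto simp: shuffle_def)
  have last: "rc (Bdry n) (nerve (join (n,1) ?B)) (Simp n) (nerve (Pow (shuffle n n)))"
    unfolding sh using relabel_last_vertex[of "(n,1)" n] rhs by simp
  \<comment> \<open>What is already filled of the last shuffle is the cone with apex
    \<open>(n,1)\<close> on the boundary of the bottom.\<close>
  have "nerve (join (n,1) ?B) = nerve (stage n n \<inter> Pow (shuffle n n))"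
  proof (intro equalityI nerve_mono subsetI)
    fix A assume "A \<in> join (n,1) ?B"
    then have "A \<subseteq> shuffle n n" "\<not> shuffle n n - {(n,1)} \<subseteq> A" unfolding sh by (auto simp: join_def)
    then show "A \<in> stage n n \<inter> Pow (shuffle n n)" using stage_horn[of n n A] by simp
  next
    fix A assume "A \<in> stage n n \<inter> Pow (shuffle n n)"
    then have "A \<subseteq> shuffle n n" "\<not> shuffle n n - {(n,1)} \<subseteq> A" using stage_horn[of n n A] by auto
    then show "A \<in> join (n,1) ?B" unfolding sh by (auto simp: join_def)
  qed
  then have "rc (Bdry n \<inter> Simp n) (nerve (stage n n) \<inter> nerve (Pow (shuffle n n))) (Simp n) (nerve (Pow (shuffle n n)))"
    using last Bdry_subset_Simp by (simp add: nerve_Int inf_absorb1)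
  then have "rc (Bdry n) (nerve (stage n n)) (Bdry n \<union> Simp n) (nerve (stage n n) \<union> nerve (Pow (shuffle n n)))"
  proof (rule rc_attach[OF sB subcx_nerve[OF downclosed_stage] B, rotated -1])
    show "Simp n \<subseteq> nerve (Pow (shuffle n n))" unfolding Simp_nerve by (rule nerve_mono) (auto simp: shuffle_def)
  qed (use fincx_Simp fincx_subcx subcx_nerve downclosed_Pow in blast)+
  moreover have "Bdry n \<union> Simp n = Simp n" using Bdry_subset_Simp by blast
  moreover have "nerve (stage n n) \<union> nerve (Pow (shuffle n n)) = Prism n"
    unfolding nerve_Un[symmetric] stage_Suc[symmetric] by (rule nerve_stage_top)
  ultimately have "rc (Bdry n) (nerve (stage n n)) (Simp n) (Prism n)" by simp
  then show ?thesis
    using Bdry_subset_Simp nerve_mono[OF stage_mono[of 0 n n]] nerve_mono[OF stage_mono[of n "Suc n" n]]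
    by (intro rc_trans[OF fill[OF le_refl]]) (auto simp: stage_0 nerve_stage_top)
qed

text \<open>The coned prism covers the cone on the boundary of the bottom in three moves:
  \<open>s1\<close> cones off the partial boundary of the prism by horns at \<open>v\<close>,
  \<open>s2\<close> glues in the prism by the hypothesis, and \<open>s3\<close> cones off the
  shuffles by horns at \<open>(i,1)\<close>. It also covers the cone on the bottom, so the remaining
  restriction is a cover by cancellation.\<close>

lemma hypercover_map_only_if:
  assumes we: "rc (Bdry n) (nerve (prism_bdry n)) (Simp n) (Prism n)"
  shows "rc (Bdry n) (Horn (Suc n) (Suc n)) (Simp n) (Simp (Suc n))"
proof -
  \<comment> \<open>A vertex above the whole prism, at level 1 as \<open>relabel_last_vertex\<close>
    demands; \<open>Suc n\<close> in place of \<open>n\<close> keeps it off the prism.\<close>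
  define v where "v = (Suc n, 1::nat)"
  let ?V = "prism_verts n" and ?B = "{A. A \<subseteq> base n \<and> \<not> base n \<subseteq> A}"
  have vV: "v \<notin> ?V" and vle: "\<And>x. x \<in> ?V \<Longrightarrow> vle x v" and fV: "finite ?V" by (auto simp: v_def vle_def)
  have sB: "subcx (Bdry n)" and sS: "subcx (Simp n)" and sP: "subcx (Prism n)"
    using fincx_Bdry fincx_Simp fincx_Prism fincx_subcx by blast+
  have dB: "downclosed ?B" by (auto simp: downclosed_def)
  have BPB: "?B \<subseteq> prism_bdry n"
  proof
    fix A assume "A \<in> ?B"
    then obtain j where A: "A \<subseteq> base n" "j \<le> n" "(j,0) \<notin> A" using base_subset_iff[of n A] by blast
    then have "j \<notin> fst ` A" by auto
    then show "A \<in> prism_bdry n" using A by (auto simp: prism_bdry_def)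
  qed
  have PBV: "prism_bdry n \<subseteq> Pow ?V" by (auto simp: prism_bdry_def)
  have join_self: "A \<in> join v Q" if "A \<in> Q" "downclosed Q" for A Q
    using downclosedD[OF that(2,1)] by (auto simp: join_def)
  have BjB: "Bdry n \<subseteq> nerve (join v ?B)"
    unfolding Bdry_nerve by (rule nerve_mono) (use join_self[OF _ dB] in blast)
  let ?PB = "nerve (join v (prism_bdry n))"
  have jPB: "nerve (join v ?B) \<subseteq> ?PB" by (intro nerve_mono join_mono BPB)
  have s1: "rc (Bdry n) (nerve (join v ?B)) (Bdry n) ?PB"
    by (rule join_attach[OF fV vV vle downclosed_prism_bdry PBV dB _ BPB sB BjB]) auto
  have int: "?PB \<inter> Prism n = nerve (prism_bdry n)"
    unfolding Prism_nerve nerve_Int[symmetric]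
  proof (rule arg_cong[where f = nerve], intro equalityI subsetI)
    fix A assume A: "A \<in> join v (prism_bdry n) \<inter> Pow ?V"
    then have "A - {v} = A" using vV by blast
    then show "A \<in> prism_bdry n" using A by (simp add: join_def)
  next
    fix A assume "A \<in> prism_bdry n"
    then show "A \<in> join v (prism_bdry n) \<inter> Pow ?V" using PBV join_self[OF _ downclosed_prism_bdry] by blast
  qed
  \<comment> \<open>The hypothesis, read as an attachment along the intersection. This is the only
    move in which the \<open>X\<close>-part grows.\<close>
  have "rc (Bdry n \<inter> Simp n) (?PB \<inter> Prism n) (Simp n) (Prism n)"
    using we int Bdry_subset_Simp by (simp add: inf_absorb1)
  from rc_attach[OF sB subcx_nerve[OF downclosed_join[OF downclosed_prism_bdry]] subset_trans[OF BjB jPB] sS sP Simp_subset_Prism this]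
  have s2: "rc (Bdry n) ?PB (Simp n) (?PB \<union> Prism n)"
    using Bdry_subset_Simp by (simp add: Un_absorb1)
  \<comment> \<open>\<open>K 0\<close> is the result of the gluing. The unconed prism stays present
    throughout, so that the face of a coned shuffle opposite \<open>v\<close> is always
    available.\<close>
  define K where "K = (\<lambda>i. join v (stage n i) \<union> Pow ?V)"
  have dK: "downclosed (K i)" for i
    unfolding K_def by (intro downclosed_Un downclosed_join downclosed_stage downclosed_Pow)
  have SK: "Simp n \<subseteq> nerve (K i)" for i
    unfolding Simp_nerve K_def by (rule nerve_mono) auto
  have K0: "?PB \<union> Prism n = nerve (K 0)"
    unfolding K_def stage_0 nerve_Un Prism_nerve ..
  have Kmono: "nerve (K i) \<subseteq> nerve (K j)" if "i \<le> j" for i j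
    unfolding K_def by (intro nerve_mono Un_mono join_mono stage_mono[OF that] subset_refl)
  have fill: "i \<le> Suc n \<Longrightarrow> rc (Simp n) (nerve (K 0)) (Simp n) (nerve (K i))" for i
  proof (induction i)
    case 0
    then show ?case using rel_cover_refl[OF wf] by simp
  next
    case (Suc i)
    then have i: "i \<le> n" by simp
    have vs: "v \<notin> shuffle n i" using vV shuffle_subset[OF i] by blast
    have KS: "K (Suc i) = K i \<union> Pow (insert v (shuffle n i))"
      unfolding K_def stage_Suc using vs by (auto simp: join_def)
    have "rc (Simp n) (nerve (K i)) (Simp n) (nerve (K (Suc i)))"
      unfolding KS
    proof (rule horn_attach[OF _ _ _ _ dK sS SK])
      show "finite (insert v (shuffle n i))" using finite_shuffle by simp
      show "(i,1) \<in> insert v (shuffle n i)" using in_shuffle(2)[OF i] by blast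
      show "insert v (shuffle n i) \<noteq> {(i,1)}" using in_shuffle(1)[of i n] by fastforce
      show "vchain (insert v (shuffle n i))"
        using vchain_shuffle[of n i] vle shuffle_subset[OF i] vle_refl unfolding vchain_def by blast
      fix A assume A: "A \<subseteq> insert v (shuffle n i)"
      have "A - {v} \<subseteq> shuffle n i" using A by blast
      note sh = stage_horn[OF i this]
      \<comment> \<open>If \<open>v\<close> is in \<open>A\<close>, this is
        \<open>stage_horn\<close> for \<open>A - {v}\<close>. Otherwise both sides hold:
        \<open>A\<close> is a face of the unconed prism, and it lacks the vertex \<open>v\<close>,
        which differs from \<open>(i,1)\<close>.\<close>
      show "A \<in> K i \<longleftrightarrow> \<not> insert v (shuffle n i) - {(i,1)} \<subseteq> A"
      proof (cases "v \<in> A")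
        case True
        then have "A \<notin> Pow ?V" using vV by blast
        then have "A \<in> K i \<longleftrightarrow> A - {v} \<in> stage n i" by (simp add: K_def join_def)
        moreover have "shuffle n i - {(i,1)} \<subseteq> A - {v} \<longleftrightarrow> insert v (shuffle n i) - {(i,1)} \<subseteq> A"
          using True vs by blast
        ultimately show ?thesis using sh by simp
      next
        case False
        then have "A \<subseteq> ?V" using A shuffle_subset[OF i] by blast
        moreover have "v \<noteq> (i,1)" using i by (simp add: v_def)
        ultimately show ?thesis using False by (auto simp: K_def)
      qed
    qed
    from rc_trans[OF Suc.IH this subset_refl subset_refl Kmono Kmono] show ?case
      using i by simp
  qed
  let ?top = "nerve (Pow (insert v ?V))"
  have Ktop: "nerve (K (Suc n)) = ?top"
  proof (intro equalityI)
    show "nerve (K (Suc n)) \<subseteq> ?top"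
      unfolding K_def using stage_subset[of "Suc n" n] by (intro nerve_mono) (auto simp: join_def)
    show "?top \<subseteq> nerve (K (Suc n))"
    proof (rule nerve_subset_chainI)
      fix A assume A: "A \<in> Pow (insert v ?V)" "vchain A"
      then have "A - {v} \<in> stage n (Suc n)" by (intro chain_in_stage) (auto simp: vchain_def)
      then show "A \<in> K (Suc n)" by (simp add: K_def join_def)
    qed
  qed
  have s3: "rc (Simp n) (?PB \<union> Prism n) (Simp n) ?top"
    using fill[OF le_refl] unfolding K0 Ktop .
  have "?PB \<union> Prism n \<subseteq> ?top" using Kmono[of 0 "Suc n"] unfolding K0 Ktop by simp
  then have IK: "rc (Bdry n) (nerve (join v ?B)) (Simp n) ?top"
    using rc_trans[OF rc_trans[OF s1 s2] s3] jPB Bdry_subset_Simp by blast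
  let ?J = "nerve (Pow (insert v (base n)))"
  have SJ: "Simp n \<subseteq> ?J" unfolding Simp_nerve by (rule nerve_mono) auto
  \<comment> \<open>The cone on the bottom is enlarged to the cone on the prism; the
    \<open>X\<close>-part \<open>Simp n\<close> stays fixed and only horns of \<open>Y\<close>
    occur.\<close>
  have "Pow (base n) \<subseteq> Pow ?V" by (rule Pow_mono) auto
  from join_attach[OF fV vV vle downclosed_Pow subset_refl downclosed_Pow Pow_bottom this sS]
  have JK: "rc (Simp n) ?J (Simp n) ?top" using SJ unfolding join_Pow by blast
  have IJ: "nerve (join v ?B) \<subseteq> ?J" by (rule nerve_mono) (auto simp: join_def)
  have JT: "?J \<subseteq> ?top" by (rule nerve_mono) auto
  \<comment> \<open>Cancellation takes place between actual morphisms, so the two smaller pairs need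
    mapping objects, which exist by finiteness.\<close>
  have fI: "fincx (nerve (join v ?B))"
    by (rule fincx_nerve[OF downclosed_join[OF dB], where V = "insert v (base n)"]) (auto simp: join_def)
  have fJ: "fincx ?J" by (rule fincx_nerve[OF downclosed_Pow subset_refl]) simp
  obtain L1 z1 where L1: "limit (objs2 X Y) (arrs2 X Y f) (Bdry n <+> nerve (join v ?B)) L1 z1"
    using limit2_exists[OF X Y f BjB fincx_Bdry fI] by blast
  obtain L2 z2 where L2: "limit (objs2 X Y) (arrs2 X Y f) (Simp n <+> ?J) L2 z2"
    using limit2_exists[OF X Y f SJ fincx_Simp fJ] by blast
  have "rc (Bdry n) (nerve (join v ?B)) (Simp n) ?J"
    by (rule rel_cover_cancel[OF wf _ _ L1 L2 IK JK]) (use IJ JT Bdry_subset_Simp in auto)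
  then show ?thesis
    using relabel_last_vertex[of v n] by (simp add: v_def)
qed

end

section \<open>The path object\<close>

definition flat :: "(nat \<times> nat) list \<Rightarrow> (nat \<times> nat) list" where
  "flat t = map (\<lambda>(i,_). (i,0)) t"

definition lift :: "(nat \<times> nat) list \<Rightarrow> (nat \<times> nat) list" where
  "lift t = map (\<lambda>(i,_). (i,1)) t"

text \<open>The simplex of the prism over a standard simplex of dimension \<open>sdim t\<close> with
  identity first component and the levels of \<open>t\<close>. A simplex \<open>t\<close> is its
  image under \<open>flat t\<close> times the identity, so values at \<open>t\<close> reduce to
  values at \<open>graph_of t\<close> over \<open>flat t\<close>.\<close>

definition graph_of :: "(nat \<times> nat) list \<Rightarrow> (nat \<times> nat) list" where
  "graph_of t = map (\<lambda>j. (j, snd (t ! j))) [0..<length t]"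

text \<open>The image of a simplex \<open>t\<close> of \<open>\<Delta>\<^sup>k \<times> \<Delta>\<^sup>1\<close> under \<open>s \<times> id\<close>, for a \<open>k\<close>-simplex \<open>s\<close>.\<close>
definition sub_fst :: "(nat \<times> nat) list \<Rightarrow> (nat \<times> nat) list \<Rightarrow> (nat \<times> nat) list" where
  "sub_fst s t = map (\<lambda>(j,k). (fst (s ! j), k)) t"

definition lower :: "(nat \<Rightarrow> nat) \<Rightarrow> nat \<times> nat \<Rightarrow> nat \<times> nat" where
  "lower \<theta> = (\<lambda>(x, y). (\<theta> x, y))"

definition on_top :: "(nat \<times> nat) list \<Rightarrow> bool" where
  "on_top t \<longleftrightarrow> (\<forall>x\<in>set t. snd x = 1)"

text \<open>The product of \<open>M\<close> with the interval, inside the prism;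
  \<open>lid n\<close> below is its end at level 1 over the whole simplex.\<close>

definition cyl :: "nat \<Rightarrow> (nat \<times> nat) list set \<Rightarrow> (nat \<times> nat) list set" where
  "cyl n M = {t \<in> Prism n. flat t \<in> M}"

definition lid :: "nat \<Rightarrow> (nat \<times> nat) list set" where
  "lid n = {t \<in> Prism n. on_top t}"

lemma sdim_simps [simp]: "sdim (flat t) = sdim t" "sdim (lift t) = sdim t" "sdim (graph_of t) = sdim t"
    "sdim (sub_fst s t) = sdim t" "sdim (e0 m) = m" "sdim (e1 m) = m"
  by (simp_all add: sdim_def flat_def lift_def graph_of_def sub_fst_def e0_def e1_def)

lemma ne_simps [simp]: "flat t = [] \<longleftrightarrow> t = []" "lift t = [] \<longleftrightarrow> t = []" "graph_of t = [] \<longleftrightarrow> t = []"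
    "sub_fst s t = [] \<longleftrightarrow> t = []" "e0 m \<noteq> []" "e1 m \<noteq> []"
  by (simp_all add: flat_def lift_def graph_of_def sub_fst_def e0_def e1_def)

lemma nth_simps:
  assumes "i \<le> sdim t" "t \<noteq> []"
  shows "flat t ! i = (fst (t ! i), 0)" "lift t ! i = (fst (t ! i), 1)" "graph_of t ! i = (i, snd (t ! i))"
    "sub_fst s t ! i = (fst (s ! fst (t ! i)), snd (t ! i))" "map \<phi> t ! i = \<phi> (t ! i)"
  using assms by (simp_all add: flat_def lift_def graph_of_def sub_fst_def length_sdim split_beta less_Suc_eq_le del: upt_Suc)

lemma e_nth [simp]: "i \<le> m \<Longrightarrow> e0 m ! i = (i,0)" "i \<le> m \<Longrightarrow> e1 m ! i = (i,1)"
  by (simp_all add: e0_def e1_def del: upt_Suc)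

lemma nsimpI:
  assumes "t \<noteq> []" "\<And>i j. i \<le> j \<Longrightarrow> j \<le> sdim t \<Longrightarrow> vle (t ! i) (t ! j)"
  shows "nsimp t"
  using assms by (simp add: nsimp_def length_sdim less_Suc_eq_le)

lemma PrismD:
  assumes "t \<in> Prism m"
  shows "nsimp t" "t \<noteq> []" "\<And>i. i \<le> sdim t \<Longrightarrow> fst (t ! i) \<le> m" "\<And>i. i \<le> sdim t \<Longrightarrow> snd (t ! i) \<le> 1"
    "\<And>i j. i \<le> j \<Longrightarrow> j \<le> sdim t \<Longrightarrow> fst (t ! i) \<le> fst (t ! j)" "\<And>i j. i \<le> j \<Longrightarrow> j \<le> sdim t \<Longrightarrow> snd (t ! i) \<le> snd (t ! j)"
proof -
  show n: "nsimp t" and ne: "t \<noteq> []" using assms by (auto simp: Prism_def nsimp_def)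
  have "t ! i \<in> {0..m} \<times> {0,1}" if "i \<le> sdim t" for i
    using nth_sdim_in[OF ne that] assms by (auto simp: Prism_def)
  then show "fst (t ! i) \<le> m" "snd (t ! i) \<le> 1" if "i \<le> sdim t" for i using that by fastforce+
  show "fst (t ! i) \<le> fst (t ! j)" "snd (t ! i) \<le> snd (t ! j)" if "i \<le> j" "j \<le> sdim t" for i j
    using nsimp_nth[OF n that] by (simp_all add: vle_def)
qed

lemma PrismI:
  assumes "t \<noteq> []" "\<And>i. i \<le> sdim t \<Longrightarrow> fst (t ! i) \<le> m" "\<And>i. i \<le> sdim t \<Longrightarrow> snd (t ! i) \<le> 1"
    "\<And>i j. i \<le> j \<Longrightarrow> j \<le> sdim t \<Longrightarrow> fst (t ! i) \<le> fst (t ! j)" "\<And>i j. i \<le> j \<Longrightarrow> j \<le> sdim t \<Longrightarrow> snd (t ! i) \<le> snd (t ! j)"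
  shows "t \<in> Prism m"
proof -
  have "nsimp t" using assms by (intro nsimpI) (auto simp: vle_def)
  moreover have "x \<in> {0..m} \<times> {0,1}" if x: "x \<in> set t" for x
  proof -
    obtain i where i: "i \<le> sdim t" "x = t ! i" using x in_set_slist[OF assms(1)] by blast
    have "fst x \<le> m" "snd x = 0 \<or> snd x = 1" using assms(2,3)[OF i(1)] i(2) by auto
    then show ?thesis by (cases x) auto
  qed
  ultimately show ?thesis by (auto simp: Prism_def)
qed

lemma SimpD:
  assumes "s \<in> Simp n"
  shows "s \<in> Prism n" "nsimp s" "s \<noteq> []" "\<And>i. i \<le> sdim s \<Longrightarrow> snd (s ! i) = 0"
proof -
  show "s \<in> Prism n" using assms Simp_subset_Prism by blast
  then show "nsimp s" and ne: "s \<noteq> []" using PrismD by blast+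
  show "snd (s ! i) = 0" if "i \<le> sdim s" for i
    using nth_sdim_in[OF ne that] assms by (auto simp: Simp_def)
qed

lemma SimpI:
  assumes "s \<in> Prism n" "\<And>i. i \<le> sdim s \<Longrightarrow> snd (s ! i) = 0"
  shows "s \<in> Simp n"
proof -
  have "snd x = 0" if "x \<in> set s" for x
    using that in_set_slist[OF PrismD(2)[OF assms(1)]] assms(2) by auto
  then show ?thesis using assms(1) by (auto simp: Simp_def Prism_def)
qed

lemma on_top_nth: "t \<noteq> [] \<Longrightarrow> on_top t \<longleftrightarrow> (\<forall>i\<le>sdim t. snd (t ! i) = 1)"
  by (simp add: on_top_def all_set_conv_all_nth length_sdim less_Suc_eq_le)

lemma e_in_Prism: "e0 m \<in> Prism m" "e1 m \<in> Prism m"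
  by (rule PrismI; simp)+

lemma graph_of_in_Prism: "t \<in> Prism n \<Longrightarrow> graph_of t \<in> Prism (sdim t)"
  using PrismD[of t n] by (intro PrismI) (auto simp: nth_simps)

lemma flat_in_Simp: "t \<in> Prism n \<Longrightarrow> flat t \<in> Simp n"
  using PrismD[of t n] by (intro SimpI PrismI) (auto simp: nth_simps)

lemma lift_in_lid: "s \<in> Simp n \<Longrightarrow> lift s \<in> lid n"
  unfolding lid_def using PrismD[OF SimpD(1)[of s n]]
  by (intro CollectI conjI PrismI) (auto simp: nth_simps on_top_nth)

lemma map_lower_in_Prism: "t \<in> Prism m \<Longrightarrow> mono_map m k \<theta> \<Longrightarrow> map (lower \<theta>) t \<in> Prism k"
  using PrismD[of t m] mono_mapD[of m k \<theta>]
  by (intro PrismI) (auto simp: nth_simps lower_def split_beta)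

lemma sub_fst_in_Prism: "s \<in> Prism n \<Longrightarrow> t \<in> Prism (sdim s) \<Longrightarrow> sub_fst s t \<in> Prism n"
  using PrismD[of s n] PrismD[of t "sdim s"] by (intro PrismI) (auto simp: nth_simps)

lemma sub_fst_graph_of: "t \<noteq> [] \<Longrightarrow> sub_fst (flat t) (graph_of t) = t"
  by (rule slist_eqI) (auto simp: nth_simps prod_eq_iff)

lemma sub_fst_e0: "s \<in> Simp n \<Longrightarrow> sub_fst s (e0 (sdim s)) = s"
  using SimpD(3,4)[of s n] by (intro slist_eqI) (auto simp: nth_simps prod_eq_iff)

lemma sub_fst_e1: "s \<noteq> [] \<Longrightarrow> sub_fst s (e1 (sdim s)) = lift s"
  by (rule slist_eqI) (auto simp: nth_simps)

lemma lift_flat: "t \<noteq> [] \<Longrightarrow> on_top t \<Longrightarrow> lift (flat t) = t"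
  by (rule slist_eqI) (auto simp: nth_simps on_top_nth prod_eq_iff)

lemma flat_lift: "s \<in> Simp n \<Longrightarrow> flat (lift s) = s"
  using SimpD(3,4)[of s n] by (intro slist_eqI) (auto simp: nth_simps prod_eq_iff)

lemma flat_Simp: "s \<in> Simp n \<Longrightarrow> flat s = s"
  using SimpD(3,4)[of s n] by (intro slist_eqI) (auto simp: nth_simps prod_eq_iff)

lemma on_top_lift: "on_top (lift s)"
  by (auto simp: on_top_def lift_def)

lemma graph_of_Simp: "s \<in> Simp n \<Longrightarrow> graph_of s = e0 (sdim s)"
  using SimpD(3,4)[of s n] by (intro slist_eqI) (auto simp: nth_simps)

lemma graph_of_on_top: "t \<noteq> [] \<Longrightarrow> on_top t \<Longrightarrow> graph_of t = e1 (sdim t)"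
  by (intro slist_eqI) (auto simp: nth_simps on_top_nth)

lemma flat_sact: "t \<noteq> [] \<Longrightarrow> mono_map m (sdim t) \<theta> \<Longrightarrow> flat (sact \<theta> m t) = sact \<theta> m (flat t)"
  unfolding flat_def by (rule map_sact)

lemma lift_sact: "t \<noteq> [] \<Longrightarrow> mono_map m (sdim t) \<theta> \<Longrightarrow> lift (sact \<theta> m t) = sact \<theta> m (lift t)"
  unfolding lift_def by (rule map_sact)

lemma sub_fst_sact: "t \<noteq> [] \<Longrightarrow> mono_map m (sdim t) \<theta> \<Longrightarrow> sub_fst s (sact \<theta> m t) = sact \<theta> m (sub_fst s t)"
  unfolding sub_fst_def by (rule map_sact)

lemma on_top_sact: "t \<noteq> [] \<Longrightarrow> on_top t \<Longrightarrow> mono_map m (sdim t) \<theta> \<Longrightarrow> on_top (sact \<theta> m t)"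
  by (auto simp: on_top_nth mono_mapD)

lemma sub_fst_lower: "t \<in> Prism m \<Longrightarrow> sub_fst (sact \<theta> m s) t = sub_fst s (map (lower \<theta>) t)"
  using PrismD(2,3)[of t m] by (intro slist_eqI) (auto simp: nth_simps lower_def split_beta)

lemma flat_sub_fst:
  assumes "s \<in> Simp n" "t \<in> Prism (sdim s)"
  shows "flat (sub_fst s t) = sact (\<lambda>l. fst (t ! l)) (sdim t) s"
  using SimpD(4)[OF assms(1)] PrismD(2,3)[OF assms(2)]
  by (intro slist_eqI) (auto simp: nth_simps prod_eq_iff)

lemma graph_of_sub_fst: "t \<noteq> [] \<Longrightarrow> graph_of (sub_fst s t) = graph_of t"
  by (rule slist_eqI) (auto simp: nth_simps)

lemma map_lower_graph_of: "t \<noteq> [] \<Longrightarrow> map (lower (\<lambda>l. fst (t ! l))) (graph_of t) = t"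
  by (rule slist_eqI) (auto simp: nth_simps lower_def prod_eq_iff)

lemma mono_fst_nth: "t \<in> Prism k \<Longrightarrow> mono_map (sdim t) k (\<lambda>l. fst (t ! l))"
  using PrismD[of t k] by (simp add: mono_map_def)

lemma sact_e: "mono_map m n \<theta> \<Longrightarrow> sact \<theta> m (e0 n) = map (lower \<theta>) (e0 m)"
    "mono_map m n \<theta> \<Longrightarrow> sact \<theta> m (e1 n) = map (lower \<theta>) (e1 m)"
  by (rule slist_eqI; auto simp: nth_simps lower_def mono_mapD)+

lemma subcx_Prism: "subcx (Prism n)"
  using fincx_Prism fincx_subcx by blast

lemma sact_in_Prism: "t \<in> Prism n \<Longrightarrow> mono_map m (sdim t) \<theta> \<Longrightarrow> sact \<theta> m t \<in> Prism n"
  using subcxD(2)[OF subcx_Prism] .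

text \<open>The data over which \<open>weak_equivalence\<close> quantifies: \<open>Q\<close> is a
  choice of \<open>P_1 Y\<close> with projections \<open>\<rho>\<close>, and \<open>P\<close> is a
  choice of \<open>P(f)\<close>.\<close>

locale path_object = descent C cov
  for C :: "('o,'m) category" and cov :: "'m set" +
  fixes X Y :: "('o,'m) sobj" and f :: "nat \<Rightarrow> 'm"
    and Q :: "('o,'m) sobj" and \<rho> :: "nat \<Rightarrow> (nat \<times> nat) list \<Rightarrow> 'm"
    and P :: "('o,'m) sobj" and a b :: "nat \<Rightarrow> 'm"
  assumes X: "simplicial C X" and Y: "simplicial C Y" and f: "smor C X Y f"
    and Q: "simplicial C Q" and Qlim: "\<And>m. is_map_limit C Y (Prism m) (Lev Q m) (\<rho> m)"
    and Qact: "\<And>m' m \<theta>. mono_map m' m \<theta> \<Longrightarrow>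
      is_induced C (Lev Q m) (\<rho> m) (Lev Q m') (\<rho> m') (Prism m') (lower \<theta>) (Act Q \<theta> m' m)"
    and P: "simplicial C P" and a: "smor C P X a" and b: "smor C P Q b"
    and pb: "\<And>m. is_pullback C (f m) (\<rho> m (e0 m)) (Lev P m) (a m) (b m)"
begin

definition q :: "nat \<Rightarrow> 'm" where "q m = \<rho> m (e1 m) \<cdot> b m"

lemmas Ql = Qlim[unfolded map_limit_iff]
lemmas wY = wf_graph1[OF Y]

lemma \<rho>_hom: "t \<in> Prism m \<Longrightarrow> \<rho> m t \<in> hom C (Lev Q m) (Lev Y (sdim t))"
  using limit_cone[OF Ql, unfolded cone1_iff] by blast

lemma \<rho>_Act: "t \<in> Prism m \<Longrightarrow> mono_map k (sdim t) \<theta> \<Longrightarrow> Act Y \<theta> k (sdim t) \<cdot> \<rho> m t = \<rho> m (sact \<theta> k t)"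
  using limit_cone[OF Ql, unfolded cone1_iff] by blast

lemma \<rho>_lower: "mono_map m' m \<theta> \<Longrightarrow> t \<in> Prism m' \<Longrightarrow> \<rho> m' t \<cdot> Act Q \<theta> m' m = \<rho> m (map (lower \<theta>) t)"
  using Qact unfolding is_induced_def by blast

lemmas ah = smorD(1)[OF a] and bh = smorD(1)[OF b] and fh = smorD(1)[OF f]

lemma \<rho>_e_hom: "\<rho> m (e0 m) \<in> hom C (Lev Q m) (Lev Y m)" "\<rho> m (e1 m) \<in> hom C (Lev Q m) (Lev Y m)"
  using \<rho>_hom[OF e_in_Prism(1)] \<rho>_hom[OF e_in_Prism(2)] by simp_all

lemma f_a: "f m \<cdot> a m = \<rho> m (e0 m) \<cdot> b m"
  using pullback_hom(3)[OF pb fh \<rho>_e_hom(1)] .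

lemma \<rho>_b_hom: "t \<in> Prism m \<Longrightarrow> \<rho> m t \<cdot> b m \<in> hom C (Lev P m) (Lev Y (sdim t))"
  by (rule comp_in_hom[OF bh \<rho>_hom])

lemma \<rho>_b_Act:
  assumes "mono_map k m \<theta>" "t \<in> Prism k"
  shows "\<rho> m (map (lower \<theta>) t) \<cdot> b m = \<rho> k t \<cdot> b k \<cdot> Act P \<theta> k m"
proof -
  have "\<rho> m (map (lower \<theta>) t) \<cdot> b m = \<rho> k t \<cdot> (Act Q \<theta> k m \<cdot> b m)"
    unfolding \<rho>_lower[OF assms, symmetric]
    by (rule comp_assoc[OF bh simplicialD(2)[OF Q assms(1)] \<rho>_hom[OF assms(2)], symmetric])
  also have "\<dots> = \<rho> k t \<cdot> b k \<cdot> Act P \<theta> k m"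
    unfolding smorD(2)[OF b assms(1), symmetric]
    by (rule comp_assoc[OF simplicialD(2)[OF P assms(1)] bh \<rho>_hom[OF assms(2)]])
  finally show ?thesis .
qed

lemma q_smor: "smor C P Y q"
  unfolding smor_def
proof (intro conjI allI impI)
  show "q n \<in> hom C (Lev P n) (Lev Y n)" for n
    unfolding q_def by (rule comp_in_hom[OF bh \<rho>_e_hom(2)])
  fix m n \<theta> assume \<theta>: "mono_map m n \<theta>"
  have "q m \<cdot> Act P \<theta> m n = \<rho> n (sact \<theta> m (e1 n)) \<cdot> b n"
    unfolding q_def sact_e(2)[OF \<theta>] \<rho>_b_Act[OF \<theta> e_in_Prism(2)] ..
  also have "\<dots> = Act Y \<theta> m n \<cdot> \<rho> n (e1 n) \<cdot> b n"
    using \<rho>_Act[OF e_in_Prism(2), of m n \<theta>] \<theta> by simp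
  also have "\<dots> = Act Y \<theta> m n \<cdot> q n"
    unfolding q_def by (rule comp_assoc[OF bh \<rho>_e_hom(2) simplicialD(2)[OF Y \<theta>], symmetric])
  finally show "q m \<cdot> Act P \<theta> m n = Act Y \<theta> m n \<cdot> q n" .
qed

abbreviation coneP where "coneP \<equiv> cone (objs2 P Y) (arrs2 P Y q)"
abbreviation coneX where "coneX \<equiv> cone (objs2 X Y) (arrs2 X Y f)"

text \<open>With \<open>arr\<close>, this says how a cone for \<open>P\<close> and \<open>q\<close>
  yields a cone for \<open>X\<close> and \<open>f\<close> on the cylinder: a value in
  \<open>X\<close> is read through \<open>a\<close>, a simplex at level 1 from the given values in
  \<open>Y\<close>, and any other one by evaluating the path over \<open>flat t\<close> at
  \<open>graph_of t\<close>.\<close>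

definition idx :: "(nat \<times> nat) list + (nat \<times> nat) list \<Rightarrow> (nat \<times> nat) list + (nat \<times> nat) list" where
  "idx = case_sum Inl (\<lambda>t. if on_top t then Inr (flat t) else Inl (flat t))"

definition arr :: "(nat \<times> nat) list + (nat \<times> nat) list \<Rightarrow> 'm" where
  "arr = case_sum (\<lambda>s. a (sdim s))
    (\<lambda>t. if on_top t then Idm C (Lev Y (sdim t)) else \<rho> (sdim t) (graph_of t) \<cdot> b (sdim t))"

definition path_val :: "((nat \<times> nat) list + (nat \<times> nat) list \<Rightarrow> 'm) \<Rightarrow> (nat \<times> nat) list \<Rightarrow> 'm" where
  "path_val e t = \<rho> (sdim t) (graph_of t) \<cdot> b (sdim t) \<cdot> e (Inl (flat t))"

context
  fixes n :: nat and M :: "(nat \<times> nat) list set"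
  assumes M: "subcx M" "M \<subseteq> Simp n"
begin

lemma conePD:
  assumes "coneP (M <+> Simp n) U e"
  shows "U \<in> Obj C" "s \<in> M \<Longrightarrow> e (Inl s) \<in> hom C U (Lev P (sdim s))" "t \<in> Simp n \<Longrightarrow> e (Inr t) \<in> hom C U (Lev Y (sdim t))"
    "s \<in> M \<Longrightarrow> mono_map m (sdim s) \<theta> \<Longrightarrow> Act P \<theta> m (sdim s) \<cdot> e (Inl s) = e (Inl (sact \<theta> m s))"
    "t \<in> Simp n \<Longrightarrow> mono_map m (sdim t) \<theta> \<Longrightarrow> Act Y \<theta> m (sdim t) \<cdot> e (Inr t) = e (Inr (sact \<theta> m t))"
    "s \<in> M \<Longrightarrow> q (sdim s) \<cdot> e (Inl s) = e (Inr s)"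
  using assms unfolding cone2_iff cone1_iff by blast+

lemma coneXD:
  assumes "coneX (M <+> (cyl n M \<union> lid n)) U e"
  shows "U \<in> Obj C" "s \<in> M \<Longrightarrow> e (Inl s) \<in> hom C U (Lev X (sdim s))"
    "t \<in> cyl n M \<union> lid n \<Longrightarrow> e (Inr t) \<in> hom C U (Lev Y (sdim t))"
    "s \<in> M \<Longrightarrow> mono_map m (sdim s) \<theta> \<Longrightarrow> Act X \<theta> m (sdim s) \<cdot> e (Inl s) = e (Inl (sact \<theta> m s))"
    "t \<in> cyl n M \<union> lid n \<Longrightarrow> mono_map m (sdim t) \<theta> \<Longrightarrow> Act Y \<theta> m (sdim t) \<cdot> e (Inr t) = e (Inr (sact \<theta> m t))"
    "s \<in> M \<Longrightarrow> f (sdim s) \<cdot> e (Inl s) = e (Inr s)"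
  using assms unfolding cone2_iff cone1_iff by blast+

lemma sub_fst_in_cyl:
  assumes "s \<in> M" "t \<in> Prism (sdim s)"
  shows "sub_fst s t \<in> cyl n M"
proof -
  have s: "s \<in> Simp n" using assms(1) M(2) by blast
  have "flat (sub_fst s t) \<in> M"
    unfolding flat_sub_fst[OF s assms(2)] by (rule subcxD(2)[OF M(1) assms(1) mono_fst_nth[OF assms(2)]])
  then show ?thesis using sub_fst_in_Prism[OF SimpD(1)[OF s] assms(2)] by (simp add: cyl_def)
qed

lemma M_in_cyl: "s \<in> M \<Longrightarrow> s \<in> cyl n M"
  using M(2) flat_Simp SimpD(1) by (fastforce simp: cyl_def)

text \<open>By naturality of \<open>b\<close>, restricting the path over \<open>s\<close> along the
  first coordinate of \<open>t\<close> gives the path over \<open>flat (sub_fst s t)\<close>. The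
  value therefore depends only on the image of \<open>t\<close> in the cylinder, not on
  \<open>s\<close> and \<open>t\<close> separately.\<close>

lemma path_val_sub_fst:
  assumes e: "coneP (M <+> Simp n) U e" and s: "s \<in> M" and t: "t \<in> Prism (sdim s)"
  shows "\<rho> (sdim s) t \<cdot> b (sdim s) \<cdot> e (Inl s) = path_val e (sub_fst s t)"
proof -
  have sS: "s \<in> Simp n" using s M(2) by blast
  let ?\<theta> = "\<lambda>l. fst (t ! l)"
  note \<theta> = mono_fst_nth[OF t] and tn = PrismD(2)[OF t]
  have g: "graph_of t \<in> Prism (sdim t)" by (rule graph_of_in_Prism[OF t])
  have "\<rho> (sdim s) t \<cdot> b (sdim s) = \<rho> (sdim t) (graph_of t) \<cdot> b (sdim t) \<cdot> Act P ?\<theta> (sdim t) (sdim s)"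
    using \<rho>_b_Act[OF \<theta> g] unfolding map_lower_graph_of[OF tn] .
  then have "\<rho> (sdim s) t \<cdot> b (sdim s) \<cdot> e (Inl s)
      = \<rho> (sdim t) (graph_of t) \<cdot> b (sdim t) \<cdot> (Act P ?\<theta> (sdim t) (sdim s) \<cdot> e (Inl s))"
    using comp_assoc[OF conePD(2)[OF e s] simplicialD(2)[OF P \<theta>] \<rho>_b_hom[OF g]] by simp
  also have "\<dots> = path_val e (sub_fst s t)"
    unfolding conePD(4)[OF e s \<theta>] path_val_def flat_sub_fst[OF sS t] graph_of_sub_fst[OF tn] by simp
  finally show ?thesis .
qed

lemma arr_val_on_top:
  assumes e: "coneP (M <+> Simp n) U e" and t: "t \<in> Prism n" "on_top t"
  shows "arr (Inr t) \<cdot> e (idx (Inr t)) = e (Inr (flat t))"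
  using comp_id(2)[OF conePD(3)[OF e flat_in_Simp[OF t(1)]]] t(2) by (simp add: arr_def idx_def)

text \<open>On simplices of the cylinder at level 1 both prescriptions are in force; they agree
  because \<open>q\<close> is evaluation at \<open>e1\<close>.\<close>

lemma arr_val_cyl:
  assumes e: "coneP (M <+> Simp n) U e" and t: "t \<in> cyl n M"
  shows "arr (Inr t) \<cdot> e (idx (Inr t)) = path_val e t"
proof (cases "on_top t")
  case True
  have tP: "t \<in> Prism n" and fM: "flat t \<in> M" using t by (auto simp: cyl_def)
  show ?thesis
    unfolding arr_val_on_top[OF e tP True] path_val_def graph_of_on_top[OF PrismD(2)[OF tP] True]
    using conePD(6)[OF e fM] by (simp add: q_def)
next
  case False
  then show ?thesis by (simp add: arr_def idx_def path_val_def)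
qed

text \<open>Exponential adjunction: an element of \<open>P(f)\<close> in dimension \<open>k\<close>
  is a \<open>k\<close>-simplex of \<open>X\<close> with a prism in \<open>Y\<close> that starts at
  its image. A compatible family of these over \<open>M\<close> is a map from \<open>M\<close> times
  the interval to \<open>Y\<close> that extends \<open>f\<close> on the bottom, and prescribing its
  image under \<open>q\<close> on the whole simplex amounts to prescribing the lid.\<close>

lemma path_cone_equiv:
  "cone_equiv (objs2 X Y) (arrs2 X Y f) (M <+> (cyl n M \<union> lid n)) (objs2 P Y) (arrs2 P Y q) (M <+> Simp n) idx arr"
  unfolding cone_equiv_def
proof (intro conjI ballI allI impI)
  fix i assume i: "i \<in> M <+> (cyl n M \<union> lid n)"
  show "idx i \<in> M <+> Simp n"
    using i flat_in_Simp by (fastforce simp: idx_def cyl_def lid_def)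
  show "arr i \<in> hom C (objs2 P Y (idx i)) (objs2 X Y i)"
  proof (cases i)
    case (Inl s)
    then show ?thesis using ah by (simp add: idx_def arr_def)
  next
    case (Inr t)
    then have "t \<in> Prism n" using i by (auto simp: cyl_def lid_def)
    then show ?thesis
      using Inr \<rho>_b_hom[OF graph_of_in_Prism, of t n] id_in_hom[OF simplicialD(1)[OF Y]]
      by (simp add: idx_def arr_def)
  qed
next
  fix U e assume e: "coneP (M <+> Simp n) U e"
  have ae: "arr (Inl s) \<cdot> e (idx (Inl s)) = a (sdim s) \<cdot> e (Inl s)" for s
    by (simp add: arr_def idx_def)
  note D = conePD[OF e]
  show "coneX (M <+> (cyl n M \<union> lid n)) U (\<lambda>i. arr i \<cdot> e (idx i))"
    unfolding cone2_iff cone1_iff ae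
  proof (intro conjI ballI allI impI)
    show "U \<in> Obj C" by (rule D(1))
    then show "U \<in> Obj C" .
    fix s assume s: "s \<in> M"
    have sS: "s \<in> Simp n" using s M(2) by blast
    show "a (sdim s) \<cdot> e (Inl s) \<in> hom C U (Lev X (sdim s))" by (rule comp_in_hom[OF D(2)[OF s] ah])
    show "Act X \<theta> m (sdim s) \<cdot> (a (sdim s) \<cdot> e (Inl s)) = a (sdim (sact \<theta> m s)) \<cdot> e (Inl (sact \<theta> m s))"
      if \<theta>: "mono_map m (sdim s) \<theta>" for \<theta> m
      using comp_assoc[OF D(2)[OF s] ah simplicialD(2)[OF X \<theta>]] comp_assoc[OF D(2)[OF s] simplicialD(2)[OF P \<theta>] ah]
        smorD(2)[OF a \<theta>] D(4)[OF s \<theta>] by simp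
    have "arr (Inr s) \<cdot> e (idx (Inr s)) = path_val e s" by (rule arr_val_cyl[OF e M_in_cyl[OF s]])
    also have "\<dots> = f (sdim s) \<cdot> a (sdim s) \<cdot> e (Inl s)"
      unfolding path_val_def graph_of_Simp[OF sS] flat_Simp[OF sS] f_a ..
    finally show "f (sdim s) \<cdot> (a (sdim s) \<cdot> e (Inl s)) = arr (Inr s) \<cdot> e (idx (Inr s))"
      using comp_assoc[OF D(2)[OF s] ah fh] by simp
  next
    fix t assume t: "t \<in> cyl n M \<union> lid n"
    then have tP: "t \<in> Prism n" by (auto simp: cyl_def lid_def)
    note tn = PrismD(2)[OF tP]
    have cases: "on_top t \<or> t \<in> cyl n M" using t by (auto simp: lid_def)
    note g = graph_of_in_Prism[OF tP]
    show "arr (Inr t) \<cdot> e (idx (Inr t)) \<in> hom C U (Lev Y (sdim t))"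
      using cases
    proof
      assume "on_top t"
      then show ?thesis using arr_val_on_top[OF e tP] D(3)[OF flat_in_Simp[OF tP]] by simp
    next
      assume tc: "t \<in> cyl n M"
      then have "flat t \<in> M" by (simp add: cyl_def)
      then have "e (Inl (flat t)) \<in> hom C U (Lev P (sdim t))" using D(2)[of "flat t"] by simp
      then show ?thesis
        unfolding arr_val_cyl[OF e tc] path_val_def using comp_in_hom[OF _ \<rho>_b_hom[OF g]] by simp
    qed
    fix \<theta> m assume \<theta>: "mono_map m (sdim t) \<theta>"
    note sP = sact_in_Prism[OF tP \<theta>]
    show "Act Y \<theta> m (sdim t) \<cdot> (arr (Inr t) \<cdot> e (idx (Inr t))) = arr (Inr (sact \<theta> m t)) \<cdot> e (idx (Inr (sact \<theta> m t)))"
      using cases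
    proof
      assume top: "on_top t"
      show ?thesis
        unfolding arr_val_on_top[OF e tP top] arr_val_on_top[OF e sP on_top_sact[OF tn top \<theta>]] flat_sact[OF tn \<theta>]
        using D(5)[OF flat_in_Simp[OF tP], of m \<theta>] \<theta> by simp
    next
      assume tc: "t \<in> cyl n M"
      then have fM: "flat t \<in> M" by (simp add: cyl_def)
      have eh: "e (Inl (flat t)) \<in> hom C U (Lev P (sdim t))" using D(2)[OF fM] by simp
      have sc: "sact \<theta> m t \<in> cyl n M"
        using sP flat_sact[OF tn \<theta>] subcxD(2)[OF M(1) fM, of m \<theta>] \<theta> by (simp add: cyl_def)
      have \<theta>g: "mono_map m (sdim (graph_of t)) \<theta>" using \<theta> by simp
      have gP: "sact \<theta> m (graph_of t) \<in> Prism (sdim t)" by (rule sact_in_Prism[OF g \<theta>g])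
      have "Act Y \<theta> m (sdim t) \<cdot> path_val e t = Act Y \<theta> m (sdim t) \<cdot> (\<rho> (sdim t) (graph_of t) \<cdot> b (sdim t)) \<cdot> e (Inl (flat t))"
        unfolding path_val_def
        using comp_assoc[OF eh \<rho>_b_hom[OF g]] simplicialD(2)[OF Y \<theta>] by simp
      also have "Act Y \<theta> m (sdim t) \<cdot> (\<rho> (sdim t) (graph_of t) \<cdot> b (sdim t)) = \<rho> (sdim t) (sact \<theta> m (graph_of t)) \<cdot> b (sdim t)"
        using comp_assoc[OF bh \<rho>_hom[OF g]] simplicialD(2)[OF Y \<theta>] \<rho>_Act[OF g \<theta>g] by simp
      also have "\<dots> \<cdot> e (Inl (flat t)) = path_val e (sub_fst (flat t) (sact \<theta> m (graph_of t)))"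
        using path_val_sub_fst[OF e fM, of "sact \<theta> m (graph_of t)"] gP by simp
      also have "sub_fst (flat t) (sact \<theta> m (graph_of t)) = sact \<theta> m t"
        using sub_fst_sact[of "graph_of t" m \<theta> "flat t"] \<theta>g tn by (simp add: sub_fst_graph_of)
      finally show ?thesis
        unfolding arr_val_cyl[OF e tc] arr_val_cyl[OF e sc] .
    qed
  qed
next
  fix U e assume e: "coneX (M <+> (cyl n M \<union> lid n)) U e"
  note D = coneXD[OF e]
  \<comment> \<open>For the inverse passage, the cylinder values are restricted along
    \<open>s\<close> times the identity. This gives an element of \<open>Q\<close> in dimension
    \<open>sdim s\<close> that starts at the image of the given simplex of \<open>X\<close>, hence
    an element of the pullback \<open>P\<close>.\<close>
  have "\<forall>s\<in>M. \<exists>p. p \<in> hom C U (Lev P (sdim s)) \<and> a (sdim s) \<cdot> p = e (Inl s) \<and>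
      (\<forall>t\<in>Prism (sdim s). \<rho> (sdim s) t \<cdot> (b (sdim s) \<cdot> p) = e (Inr (sub_fst s t)))"
  proof
    fix s assume s: "s \<in> M"
    let ?k = "sdim s"
    have c: "sub_fst s t \<in> cyl n M \<union> lid n" if "t \<in> Prism ?k" for t using sub_fst_in_cyl[OF s that] by blast
    have "cone (objs1 Y) (arrs1 Y) (Prism ?k) U (\<lambda>t. e (Inr (sub_fst s t)))"
      unfolding cone1_iff
    proof (intro conjI ballI allI impI)
      show "U \<in> Obj C" by (rule D(1))
      fix t assume t: "t \<in> Prism ?k"
      show "e (Inr (sub_fst s t)) \<in> hom C U (Lev Y (sdim t))" using D(3)[OF c[OF t]] by simp
      fix \<theta> m assume \<theta>: "mono_map m (sdim t) \<theta>"
      show "Act Y \<theta> m (sdim t) \<cdot> e (Inr (sub_fst s t)) = e (Inr (sub_fst s (sact \<theta> m t)))"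
        using D(5)[OF c[OF t], of m \<theta>] \<theta> sub_fst_sact[OF PrismD(2)[OF t] \<theta>] by simp
    qed
    from limit_ex[OF Ql this]
    obtain h where h: "h \<in> hom C U (Lev Q ?k)" "\<forall>t\<in>Prism ?k. \<rho> ?k t \<cdot> h = e (Inr (sub_fst s t))" by blast
    have sS: "s \<in> Simp n" using s M(2) by blast
    have "f ?k \<cdot> e (Inl s) = \<rho> ?k (e0 ?k) \<cdot> h"
      using D(6)[OF s] bspec[OF h(2) e_in_Prism(1)] by (simp add: sub_fst_e0[OF sS])
    from pullback_ex[OF pb fh \<rho>_e_hom(1) D(2)[OF s] h(1) this]
    obtain p where p: "p \<in> hom C U (Lev P ?k)" "a ?k \<cdot> p = e (Inl s)" "b ?k \<cdot> p = h" by blast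
    then show "\<exists>p. p \<in> hom C U (Lev P ?k) \<and> a ?k \<cdot> p = e (Inl s) \<and>
      (\<forall>t\<in>Prism ?k. \<rho> ?k t \<cdot> (b ?k \<cdot> p) = e (Inr (sub_fst s t)))" using h(2) by blast
  qed
  from bchoice[OF this] obtain p where p: "\<forall>s\<in>M. p s \<in> hom C U (Lev P (sdim s)) \<and> a (sdim s) \<cdot> p s = e (Inl s) \<and>
      (\<forall>t\<in>Prism (sdim s). \<rho> (sdim s) t \<cdot> (b (sdim s) \<cdot> p s) = e (Inr (sub_fst s t)))" ..
  have ph: "p s \<in> hom C U (Lev P (sdim s))" and pa: "a (sdim s) \<cdot> p s = e (Inl s)"
    and pb': "t \<in> Prism (sdim s) \<Longrightarrow> \<rho> (sdim s) t \<cdot> (b (sdim s) \<cdot> p s) = e (Inr (sub_fst s t))" if "s \<in> M" for s t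
    using p that by blast+
  define e' where "e' = case_sum p (\<lambda>s. e (Inr (lift s)))"
  have e'_simps: "e' (Inl s) = p s" "e' (Inr s) = e (Inr (lift s))" for s by (simp_all add: e'_def)
  have lid: "lift s \<in> cyl n M \<union> lid n" if "s \<in> Simp n" for s using lift_in_lid[OF that] by blast
  have "coneP (M <+> Simp n) U e'"
    unfolding cone2_iff cone1_iff e'_simps
  proof (intro conjI ballI allI impI)
    show "U \<in> Obj C" by (rule D(1))
    then show "U \<in> Obj C" .
    fix s assume s: "s \<in> M"
    have sS: "s \<in> Simp n" using s M(2) by blast
    show "p s \<in> hom C U (Lev P (sdim s))" by (rule ph[OF s])
    have "q (sdim s) \<cdot> p s = \<rho> (sdim s) (e1 (sdim s)) \<cdot> (b (sdim s) \<cdot> p s)"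
      unfolding q_def by (rule comp_assoc[OF ph[OF s] bh \<rho>_e_hom(2), symmetric])
    then show "q (sdim s) \<cdot> p s = e (Inr (lift s))"
      unfolding pb'[OF s e_in_Prism(2)] sub_fst_e1[OF SimpD(3)[OF sS]] .
    fix \<theta> m assume \<theta>: "mono_map m (sdim s) \<theta>"
    have s': "sact \<theta> m s \<in> M" by (rule subcxD(2)[OF M(1) s \<theta>])
    have ph': "p (sact \<theta> m s) \<in> hom C U (Lev P m)" using ph[OF s'] by simp
    have AP: "Act P \<theta> m (sdim s) \<in> hom C (Lev P (sdim s)) (Lev P m)" by (rule simplicialD(2)[OF P \<theta>])
    have AQ: "Act Q \<theta> m (sdim s) \<in> hom C (Lev Q (sdim s)) (Lev Q m)" by (rule simplicialD(2)[OF Q \<theta>])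
    have Ap: "Act P \<theta> m (sdim s) \<cdot> p s \<in> hom C U (Lev P m)" by (rule comp_in_hom[OF ph[OF s] AP])
    have bp: "b (sdim s) \<cdot> p s \<in> hom C U (Lev Q (sdim s))" by (rule comp_in_hom[OF ph[OF s] bh])
    \<comment> \<open>The \<open>p s\<close> are chosen one by one, yet compatible: an element of
      \<open>P\<close> is determined by its image under \<open>a\<close> and all prism components of
      its image under \<open>b\<close>.\<close>
    show "Act P \<theta> m (sdim s) \<cdot> p s = p (sact \<theta> m s)"
    proof (rule pullback_eqI[OF pb fh \<rho>_e_hom(1) Ap ph'])
      show "a m \<cdot> (Act P \<theta> m (sdim s) \<cdot> p s) = a m \<cdot> p (sact \<theta> m s)"
        using comp_assoc[OF ph[OF s] AP ah] comp_assoc[OF ph[OF s] ah simplicialD(2)[OF X \<theta>]] smorD(2)[OF a \<theta>]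
          pa[OF s] pa[OF s'] D(4)[OF s \<theta>] by simp
      show "b m \<cdot> (Act P \<theta> m (sdim s) \<cdot> p s) = b m \<cdot> p (sact \<theta> m s)"
      proof (rule limit_eqI[OF wY Ql comp_in_hom[OF Ap bh] comp_in_hom[OF ph' bh]])
        fix t assume t: "t \<in> Prism m"
        have "\<rho> m t \<cdot> (b m \<cdot> (Act P \<theta> m (sdim s) \<cdot> p s)) = \<rho> m t \<cdot> (Act Q \<theta> m (sdim s) \<cdot> (b (sdim s) \<cdot> p s))"
          using comp_assoc[OF ph[OF s] AP bh] comp_assoc[OF ph[OF s] bh AQ] smorD(2)[OF b \<theta>] by simp
        also have "\<dots> = e (Inr (sub_fst s (map (lower \<theta>) t)))"
          using comp_assoc[OF bp AQ \<rho>_hom[OF t]] \<rho>_lower[OF \<theta> t] pb'[OF s map_lower_in_Prism[OF t \<theta>]] by simp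
        also have "\<dots> = \<rho> m t \<cdot> (b m \<cdot> p (sact \<theta> m s))"
          using pb'[OF s', of t] t sub_fst_lower[OF t] by simp
        finally show "\<rho> m t \<cdot> (b m \<cdot> (Act P \<theta> m (sdim s) \<cdot> p s)) = \<rho> m t \<cdot> (b m \<cdot> p (sact \<theta> m s))" .
      qed
    qed
  next
    fix s assume s: "s \<in> Simp n"
    show "e (Inr (lift s)) \<in> hom C U (Lev Y (sdim s))" using D(3)[OF lid[OF s]] by simp
    fix \<theta> m assume \<theta>: "mono_map m (sdim s) \<theta>"
    show "Act Y \<theta> m (sdim s) \<cdot> e (Inr (lift s)) = e (Inr (lift (sact \<theta> m s)))"
      using D(5)[OF lid[OF s], of m \<theta>] \<theta> lift_sact[OF SimpD(3)[OF s] \<theta>] by simp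
  qed
  moreover have "arr i \<cdot> e' (idx i) = e i" if i: "i \<in> M <+> (cyl n M \<union> lid n)" for i
  proof (cases i)
    case (Inl s)
    then show ?thesis using pa[of s] i by (auto simp: arr_def idx_def e'_simps)
  next
    case (Inr t)
    then have t: "t \<in> cyl n M \<union> lid n" using i by auto
    then have tP: "t \<in> Prism n" by (auto simp: cyl_def lid_def)
    note tn = PrismD(2)[OF tP]
    show ?thesis
    proof (cases "on_top t")
      case True
      then show ?thesis
        using Inr comp_id(2)[OF D(3)[OF t]] lift_flat[OF tn True] by (simp add: arr_def idx_def e'_simps)
    next
      case False
      then have fM: "flat t \<in> M" using t by (auto simp: cyl_def lid_def)
      note g = graph_of_in_Prism[OF tP]
      have "\<rho> (sdim t) (graph_of t) \<cdot> b (sdim t) \<cdot> p (flat t) = e (Inr t)"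
        using pb'[OF fM, of "graph_of t"] g comp_assoc[OF ph[OF fM] bh] \<rho>_hom[OF g] sub_fst_graph_of[OF tn] by simp
      then show ?thesis using Inr False by (simp add: arr_def idx_def e'_simps)
    qed
  qed
  ultimately show "\<exists>e'. coneP (M <+> Simp n) U e' \<and> (\<forall>i\<in>M <+> (cyl n M \<union> lid n). arr i \<cdot> e' (idx i) = e i)" by blast
next
  fix U e e' i
  assume e: "coneP (M <+> Simp n) U e" and e': "coneP (M <+> Simp n) U e'"
    and eq: "\<forall>i\<in>M <+> (cyl n M \<union> lid n). arr i \<cdot> e (idx i) = arr i \<cdot> e' (idx i)" and i: "i \<in> M <+> Simp n"
  show "e i = e' i"
  proof (cases i)
    case (Inl s)
    then have s: "s \<in> M" using i by auto
    let ?k = "sdim s"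
    have "e (Inl s) = e' (Inl s)"
    proof (rule pullback_eqI[OF pb fh \<rho>_e_hom(1) conePD(2)[OF e s] conePD(2)[OF e' s]])
      show "a ?k \<cdot> e (Inl s) = a ?k \<cdot> e' (Inl s)"
        using bspec[OF eq InlI[OF s]] by (simp add: arr_def idx_def)
      show "b ?k \<cdot> e (Inl s) = b ?k \<cdot> e' (Inl s)"
      proof (rule limit_eqI[OF wY Ql comp_in_hom[OF conePD(2)[OF e s] bh] comp_in_hom[OF conePD(2)[OF e' s] bh]])
        fix t assume t: "t \<in> Prism ?k"
        note c = sub_fst_in_cyl[OF s t]
        show "\<rho> ?k t \<cdot> (b ?k \<cdot> e (Inl s)) = \<rho> ?k t \<cdot> (b ?k \<cdot> e' (Inl s))"
          using bspec[OF eq InrI[OF UnI1[OF c]]] arr_val_cyl[OF e c] arr_val_cyl[OF e' c]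
            path_val_sub_fst[OF e s t] path_val_sub_fst[OF e' s t]
            comp_assoc[OF conePD(2)[OF e s] bh \<rho>_hom[OF t]] comp_assoc[OF conePD(2)[OF e' s] bh \<rho>_hom[OF t]] by simp
      qed
    qed
    then show ?thesis using Inl by simp
  next
    case (Inr s)
    then have s: "s \<in> Simp n" using i by auto
    have l: "lift s \<in> lid n" by (rule lift_in_lid[OF s])
    then have lP: "lift s \<in> Prism n" by (simp add: lid_def)
    have "e (Inr s) = e' (Inr s)"
      using bspec[OF eq InrI[OF UnI2[OF l]]] arr_val_on_top[OF e lP on_top_lift] arr_val_on_top[OF e' lP on_top_lift]
        flat_lift[OF s] by simp
    then show ?thesis using Inr by simp
  qed
qed

end

lemma cyl_Simp: "cyl n (Simp n) \<union> lid n = Prism n"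
  using flat_in_Simp by (auto simp: cyl_def lid_def)

text \<open>The projection \<open>flat t\<close> lies in the boundary exactly when the vertices of
  \<open>t\<close> miss a column.\<close>

lemma cyl_Bdry: "cyl n (Bdry n) \<union> lid n = nerve (prism_bdry n)"
proof -
  have "t \<in> cyl n (Bdry n) \<union> lid n \<longleftrightarrow> t \<in> nerve (prism_bdry n)" if t: "t \<in> Prism n" for t
  proof -
    have "set (flat t) = (\<lambda>x. (fst x, 0)) ` set t" by (simp add: flat_def split_beta)
    then have "(j,0) \<in> set (flat t) \<longleftrightarrow> j \<in> fst ` set t" for j by auto
    then have 1: "flat t \<in> Bdry n \<longleftrightarrow> \<not> {0..n} \<subseteq> fst ` set t"
      using flat_in_Simp[OF t] by (auto simp: Bdry_def subset_iff)
    have 2: "on_top t \<longleftrightarrow> set t \<subseteq> {0..n} \<times> {1}"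
      using t by (fastforce simp: on_top_def Prism_def)
    show ?thesis using t 1 2 by (auto simp: cyl_def lid_def nerve_def prism_bdry_def Prism_def)
  qed
  moreover have "nerve (prism_bdry n) \<subseteq> Prism n"
    unfolding Prism_nerve by (rule nerve_mono) (auto simp: prism_bdry_def)
  ultimately show ?thesis by (auto simp: cyl_def lid_def)
qed

lemma hypercover_iff:
  "hypercover C cov P Y q \<longleftrightarrow>
    (\<forall>n. rel_cover (objs2 X Y) (arrs2 X Y f) (Bdry n <+> nerve (prism_bdry n)) (Simp n <+> Prism n))"
proof -
  have sub: "subcx (Bdry n)" "subcx (Simp n)" for n using fincx_Bdry fincx_Simp fincx_subcx by blast+
  have "rel_prop C P Y q (Simp n) (Simp n) (Bdry n) (Simp n) (\<lambda>r. r \<in> cov) \<longleftrightarrow>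
    rel_cover (objs2 X Y) (arrs2 X Y f) (Bdry n <+> nerve (prism_bdry n)) (Simp n <+> Prism n)" (is "?l \<longleftrightarrow> ?r") for n
  proof -
    note eB = path_cone_equiv[OF sub(1) Bdry_subset_Simp, of n, unfolded cyl_Bdry]
    note eS = path_cone_equiv[OF sub(2) subset_refl, of n, unfolded cyl_Simp]
    note wX = wf_graph2[OF X Y f] and wP = wf_graph2[OF P Y q_smor]
    have nP: "nerve (prism_bdry n) \<subseteq> Prism n"
      unfolding Prism_nerve by (rule nerve_mono) (auto simp: prism_bdry_def)
    have s1: "Bdry n <+> nerve (prism_bdry n) \<subseteq> Simp n <+> Prism n" using nP Bdry_subset_Simp by auto
    have s2: "Bdry n <+> Simp n \<subseteq> Simp n <+> Simp n" using Bdry_subset_Simp by auto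
    have c1: "closed (arrs2 X Y f) (Bdry n <+> nerve (prism_bdry n))"
      by (rule closed2[OF sub(1) subcx_nerve[OF downclosed_prism_bdry] Bdry_subset_prism_bdry])
    have c2: "closed (arrs2 X Y f) (Simp n <+> Prism n)"
      by (rule closed2[OF sub(2) subcx_Prism Simp_subset_Prism])
    have "?l \<longleftrightarrow> rel_cover (objs2 P Y) (arrs2 P Y q) (Bdry n <+> Simp n) (Simp n <+> Simp n)"
      using rel_prop_if_rel_cover[OF P Y q_smor subset_refl Bdry_subset_Simp Bdry_subset_Simp subset_refl]
        rel_cover_if_rel_prop[OF P Y q_smor subset_refl Bdry_subset_Simp Bdry_subset_Simp subset_refl
          fincx_Bdry fincx_Simp fincx_Simp fincx_Simp] by blast
    also have "\<dots> \<longleftrightarrow> ?r"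
      using cone_equiv_rel_cover[OF wX wP s1 s2 eB eS] cone_equiv_rel_cover'[OF wX wP s1 s2 c1 c2 eB eS] by blast
    finally show ?thesis .
  qed
  then show ?thesis unfolding hypercover_def by simp
qed

end

section \<open>Existence of path objects, and the final equivalence\<close>

context descent
begin

text \<open>\<open>weak_equivalence\<close> ranges over all choices of path objects and would hold
  vacuously if there were none. The structure maps are picked from the universal property of the
  limits, and its uniqueness part yields the simplicial identities.\<close>

lemma path_simplicial_exists:
  assumes Y: "simplicial C Y"
  shows "\<exists>Q \<rho>. simplicial C Q \<and> (\<forall>m. is_map_limit C Y (Prism m) (Lev Q m) (\<rho> m)) \<and>
    (\<forall>m' m \<theta>. mono_map m' m \<theta> \<longrightarrow>
      is_induced C (Lev Q m) (\<rho> m) (Lev Q m') (\<rho> m') (Prism m') (lower \<theta>) (Act Q \<theta> m' m))"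
proof -
  have "\<forall>m. \<exists>L \<pi>. is_map_limit C Y (Prism m) L \<pi>" using map_limit_exists[OF Y fincx_Prism] by blast
  then obtain L \<rho> where L0: "\<And>m. is_map_limit C Y (Prism m) (L m) (\<rho> m)" by metis
  note L = L0[unfolded map_limit_iff] and wY = wf_graph1[OF Y]
  let ?ind = "\<lambda>\<theta> m' m h. is_induced C (L m) (\<rho> m) (L m') (\<rho> m') (Prism m') (lower \<theta>) h"
  have ex: "\<exists>h. ?ind \<theta> m' m h" if \<theta>: "mono_map m' m \<theta>" for m' m \<theta>
  proof -
    note c = limit_cone[OF L, of m, unfolded cone1_iff]
    have "cone (objs1 Y) (arrs1 Y) (Prism m') (L m) (\<lambda>t. \<rho> m (map (lower \<theta>) t))"
      unfolding cone1_iff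
    proof (intro conjI ballI allI impI)
      show "L m \<in> Obj C" using c by blast
      fix t assume t: "t \<in> Prism m'"
      note tP = map_lower_in_Prism[OF t \<theta>]
      show "\<rho> m (map (lower \<theta>) t) \<in> hom C (L m) (Lev Y (sdim t))" using c tP by fastforce
      fix \<phi> k assume \<phi>: "mono_map k (sdim t) \<phi>"
      then have "mono_map k (sdim (map (lower \<theta>) t)) \<phi>" by simp
      then have "Act Y \<phi> k (sdim (map (lower \<theta>) t)) \<cdot> \<rho> m (map (lower \<theta>) t) = \<rho> m (sact \<phi> k (map (lower \<theta>) t))"
        using c tP by blast
      then show "Act Y \<phi> k (sdim t) \<cdot> \<rho> m (map (lower \<theta>) t) = \<rho> m (map (lower \<theta>) (sact \<phi> k t))"
        using map_sact[OF PrismD(2)[OF t] \<phi>] by simp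
    qed
    from limit_ex[OF L this] show ?thesis by (auto simp: is_induced_def)
  qed
  have uniq: "h = h'" if "h \<in> hom C (L m) (L m')" "h' \<in> hom C (L m) (L m')"
    "\<And>t. t \<in> Prism m' \<Longrightarrow> \<rho> m' t \<cdot> h = \<rho> m' t \<cdot> h'" for m m' h h'
    by (rule limit_eqI[OF wY L that])
  define Q :: "('o,'m) sobj" where "Q = \<lparr>Lev = L, Act = \<lambda>\<theta> m' m. SOME h. ?ind \<theta> m' m h\<rparr>"
  have QL: "Lev Q m = L m" for m by (simp add: Q_def)
  have QA: "?ind \<theta> m' m (Act Q \<theta> m' m)" if "mono_map m' m \<theta>" for \<theta> m' m
    using someI_ex[OF ex[OF that]] by (simp add: Q_def)
  have QAh: "Act Q \<theta> m' m \<in> hom C (L m) (L m')"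
    and QAe: "\<And>t. t \<in> Prism m' \<Longrightarrow> \<rho> m' t \<cdot> Act Q \<theta> m' m = \<rho> m (map (lower \<theta>) t)"
    if "mono_map m' m \<theta>" for \<theta> m' m
    using QA[OF that] by (auto simp: is_induced_def)
  have \<rho>h: "\<rho> m t \<in> hom C (L m) (Lev Y (sdim t))" if "t \<in> Prism m" for m t
    using limit_cone[OF L, of m, unfolded cone1_iff] that by blast
  have Lo: "L m \<in> Obj C" for m using limit_cone[OF L, of m, unfolded cone1_iff] by blast
  have "simplicial C Q"
    unfolding simplicial_def QL
  proof (intro conjI allI impI)
    show "L m \<in> Obj C" for m by (rule Lo)
    show "Act Q \<theta> m n \<in> hom C (L n) (L m)" if "mono_map m n \<theta>" for m n \<theta> by (rule QAh[OF that])
  next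
    fix m n and \<theta> \<theta>' :: "nat \<Rightarrow> nat" assume \<theta>: "mono_map m n \<theta>" and eq: "\<forall>i\<le>m. \<theta> i = \<theta>' i"
    have \<theta>': "mono_map m n \<theta>'" using \<theta> eq by (auto simp: mono_map_def)
    show "Act Q \<theta>' m n = Act Q \<theta> m n"
    proof (rule uniq[OF QAh[OF \<theta>'] QAh[OF \<theta>]])
      fix t assume t: "t \<in> Prism m"
      have "map (lower \<theta>') t = map (lower \<theta>) t"
        using t eq by (intro map_cong) (auto simp: lower_def Prism_def)
      then show "\<rho> m t \<cdot> Act Q \<theta>' m n = \<rho> m t \<cdot> Act Q \<theta> m n"
        unfolding QAe[OF \<theta> t] QAe[OF \<theta>' t] by (rule arg_cong)
    qed
  next
    fix n
    show "Act Q id n n = Idm C (L n)"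
    proof (rule uniq[OF QAh[OF mono_map_id] id_in_hom[OF Lo]])
      fix t assume t: "t \<in> Prism n"
      have "map (lower id) t = t" by (rule map_idI) (auto simp: lower_def)
      then show "\<rho> n t \<cdot> Act Q id n n = \<rho> n t \<cdot> Idm C (L n)"
        using QAe[OF mono_map_id t] comp_id(1)[OF \<rho>h[OF t]] by simp
    qed
  next
    fix l m n \<phi> \<theta> assume \<phi>: "mono_map l m \<phi>" and \<theta>: "mono_map m n \<theta>"
    note c = mono_map_comp[OF \<phi> \<theta>]
    show "Act Q (\<theta> \<circ> \<phi>) l n = Act Q \<phi> l m \<cdot> Act Q \<theta> m n"
    proof (rule uniq[OF QAh[OF c] comp_in_hom[OF QAh[OF \<theta>] QAh[OF \<phi>]]])
      fix t assume t: "t \<in> Prism l"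
      have "lower (\<theta> \<circ> \<phi>) = lower \<theta> \<circ> lower \<phi>" by (auto simp: lower_def)
      then show "\<rho> l t \<cdot> Act Q (\<theta> \<circ> \<phi>) l n = \<rho> l t \<cdot> (Act Q \<phi> l m \<cdot> Act Q \<theta> m n)"
        using QAe[OF c t] comp_assoc[OF QAh[OF \<theta>] QAh[OF \<phi>] \<rho>h[OF t]] QAe[OF \<phi> t]
          QAe[OF \<theta> map_lower_in_Prism[OF t \<phi>]] by simp
    qed
  qed
  then show ?thesis using L0 QA by (intro exI[of _ Q] exI[of _ \<rho>]) (simp add: QL)
qed

lemma pullback_simplicial_exists:
  assumes X: "simplicial C X" and Q: "simplicial C Q" and Y: "simplicial C Y"
    and f: "smor C X Y f" and v: "smor C Q Y v"
  shows "\<exists>P a b. simplicial C P \<and> smor C P X a \<and> smor C P Q b \<and> (\<forall>m. is_pullback C (f m) (v m) (Lev P m) (a m) (b m))"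
proof -
  note fh = smorD(1)[OF f] and vh = smorD(1)[OF v]
  have "\<forall>m. \<exists>L p r. is_pullback C (f m) (v m) L p r" using pullback_exists[OF fh vh] by blast
  then obtain L a b where pb: "\<And>m. is_pullback C (f m) (v m) (L m) (a m) (b m)" by metis
  note ah = pullback_hom(1)[OF pb fh vh] and bh = pullback_hom(2)[OF pb fh vh] and ab = pullback_hom(3)[OF pb fh vh]
  let ?ind = "\<lambda>\<theta> m n h. h \<in> hom C (L n) (L m) \<and> a m \<cdot> h = Act X \<theta> m n \<cdot> a n \<and> b m \<cdot> h = Act Q \<theta> m n \<cdot> b n"
  have ex: "\<exists>h. ?ind \<theta> m n h" if \<theta>: "mono_map m n \<theta>" for \<theta> m n
  proof -
    note AX = simplicialD(2)[OF X \<theta>] and AQ = simplicialD(2)[OF Q \<theta>] and AY = simplicialD(2)[OF Y \<theta>]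
    have "f m \<cdot> (Act X \<theta> m n \<cdot> a n) = v m \<cdot> (Act Q \<theta> m n \<cdot> b n)"
      using comp_assoc[OF ah AX fh] comp_assoc[OF bh AQ vh] smorD(2)[OF f \<theta>] smorD(2)[OF v \<theta>]
        comp_assoc[OF ah fh AY] comp_assoc[OF bh vh AY] ab[of n] by simp
    from pullback_ex[OF pb fh vh comp_in_hom[OF ah AX] comp_in_hom[OF bh AQ] this] show ?thesis by blast
  qed
  define P :: "('o,'m) sobj" where "P = \<lparr>Lev = L, Act = \<lambda>\<theta> m n. SOME h. ?ind \<theta> m n h\<rparr>"
  have PL: "Lev P m = L m" for m by (simp add: P_def)
  have PA: "?ind \<theta> m n (Act P \<theta> m n)" if "mono_map m n \<theta>" for \<theta> m n
    using someI_ex[OF ex[OF that]] by (simp add: P_def)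
  have Ph: "Act P \<theta> m n \<in> hom C (L n) (L m)" and Pa: "a m \<cdot> Act P \<theta> m n = Act X \<theta> m n \<cdot> a n"
    and Pb: "b m \<cdot> Act P \<theta> m n = Act Q \<theta> m n \<cdot> b n" if "mono_map m n \<theta>" for \<theta> m n
    using PA[OF that] by blast+
  note uniq = pullback_eqI[OF pb fh vh]
  have Lo: "L m \<in> Obj C" for m using hom_obj(1)[OF ah] .
  have "simplicial C P"
    unfolding simplicial_def PL
  proof (intro conjI allI impI)
    show "L m \<in> Obj C" for m by (rule Lo)
    show "Act P \<theta> m n \<in> hom C (L n) (L m)" if "mono_map m n \<theta>" for m n \<theta> by (rule Ph[OF that])
  next
    fix m n and \<theta> \<theta>' :: "nat \<Rightarrow> nat" assume \<theta>: "mono_map m n \<theta>" and eq: "\<forall>i\<le>m. \<theta> i = \<theta>' i"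
    have \<theta>': "mono_map m n \<theta>'" using \<theta> eq by (auto simp: mono_map_def)
    have "Act X \<theta>' m n = Act X \<theta> m n" "Act Q \<theta>' m n = Act Q \<theta> m n"
      using simplicialD(3)[OF X \<theta>] simplicialD(3)[OF Q \<theta>] eq by blast+
    then show "Act P \<theta>' m n = Act P \<theta> m n"
      using uniq[OF Ph[OF \<theta>'] Ph[OF \<theta>]] Pa[OF \<theta>] Pa[OF \<theta>'] Pb[OF \<theta>] Pb[OF \<theta>'] by simp
  next
    fix n
    note i = mono_map_id[of n]
    show "Act P id n n = Idm C (L n)"
      by (rule uniq[OF Ph[OF i] id_in_hom[OF Lo]])
        (simp_all add: Pa[OF i] Pb[OF i] simplicialD(4)[OF X] simplicialD(4)[OF Q] comp_id[OF ah] comp_id[OF bh])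
  next
    fix l m n \<phi> \<theta> assume \<phi>: "mono_map l m \<phi>" and \<theta>: "mono_map m n \<theta>"
    note c = mono_map_comp[OF \<phi> \<theta>]
    show "Act P (\<theta> \<circ> \<phi>) l n = Act P \<phi> l m \<cdot> Act P \<theta> m n"
    proof (rule uniq[OF Ph[OF c] comp_in_hom[OF Ph[OF \<theta>] Ph[OF \<phi>]]])
      show "a l \<cdot> Act P (\<theta> \<circ> \<phi>) l n = a l \<cdot> (Act P \<phi> l m \<cdot> Act P \<theta> m n)"
        using comp_assoc[OF Ph[OF \<theta>] Ph[OF \<phi>] ah] Pa[OF c] Pa[OF \<phi>] Pa[OF \<theta>] simplicialD(5)[OF X \<phi> \<theta>]
          comp_assoc[OF Ph[OF \<theta>] ah simplicialD(2)[OF X \<phi>]]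
          comp_assoc[OF ah simplicialD(2)[OF X \<theta>] simplicialD(2)[OF X \<phi>]] by simp
      show "b l \<cdot> Act P (\<theta> \<circ> \<phi>) l n = b l \<cdot> (Act P \<phi> l m \<cdot> Act P \<theta> m n)"
        using comp_assoc[OF Ph[OF \<theta>] Ph[OF \<phi>] bh] Pb[OF c] Pb[OF \<phi>] Pb[OF \<theta>] simplicialD(5)[OF Q \<phi> \<theta>]
          comp_assoc[OF Ph[OF \<theta>] bh simplicialD(2)[OF Q \<phi>]]
          comp_assoc[OF bh simplicialD(2)[OF Q \<theta>] simplicialD(2)[OF Q \<phi>]] by simp
    qed
  qed
  moreover have "smor C P X a" "smor C P Q b"
    unfolding smor_def PL using ah bh Pa Pb by blast+
  ultimately show ?thesis using pb by (intro exI[of _ P] exI[of _ a] exI[of _ b]) (simp add: PL)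
qed

lemma path_object_exists:
  assumes X: "simplicial C X" and Y: "simplicial C Y" and f: "smor C X Y f"
  shows "\<exists>Q \<rho> P a b. path_object C cov X Y f Q \<rho> P a b"
proof -
  obtain Q \<rho> where Q: "simplicial C Q" and l: "\<And>m. is_map_limit C Y (Prism m) (Lev Q m) (\<rho> m)"
    and i: "\<And>m' m \<theta>. mono_map m' m \<theta> \<Longrightarrow>
      is_induced C (Lev Q m) (\<rho> m) (Lev Q m') (\<rho> m') (Prism m') (lower \<theta>) (Act Q \<theta> m' m)"
    using path_simplicial_exists[OF Y] by blast
  have "smor C Q Y (\<lambda>m. \<rho> m (e0 m))"
    unfolding smor_def
  proof (intro conjI allI impI)
    have c: "\<And>m t. t \<in> Prism m \<Longrightarrow> \<rho> m t \<in> hom C (Lev Q m) (Lev Y (sdim t))"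
      "\<And>m t k \<theta>. t \<in> Prism m \<Longrightarrow> mono_map k (sdim t) \<theta> \<Longrightarrow> Act Y \<theta> k (sdim t) \<cdot> \<rho> m t = \<rho> m (sact \<theta> k t)"
      using limit_cone[OF l[unfolded map_limit_iff], unfolded cone1_iff] by blast+
    show "\<rho> n (e0 n) \<in> hom C (Lev Q n) (Lev Y n)" for n using c(1)[OF e_in_Prism(1)] by simp
    fix m n \<theta> assume \<theta>: "mono_map m n \<theta>"
    have "\<rho> m (e0 m) \<cdot> Act Q \<theta> m n = \<rho> n (map (lower \<theta>) (e0 m))"
      using i[OF \<theta>] e_in_Prism(1) by (simp add: is_induced_def)
    then show "\<rho> m (e0 m) \<cdot> Act Q \<theta> m n = Act Y \<theta> m n \<cdot> \<rho> n (e0 n)"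
      using c(2)[OF e_in_Prism(1), of m n \<theta>] \<theta> sact_e(1)[OF \<theta>] by simp
  qed
  from pullback_simplicial_exists[OF X Q Y f this] obtain P a b where "simplicial C P" "smor C P X a" "smor C P Q b"
    "\<And>m. is_pullback C (f m) (\<rho> m (e0 m)) (Lev P m) (a m) (b m)" by blast
  then have "path_object C cov X Y f Q \<rho> P a b"
    by unfold_locales (use X Y f Q l i in blast)+
  then show ?thesis by blast
qed

text \<open>The right-hand side does not mention the path object, so all choices give the same
  condition, and one choice exists by \<open>path_object_exists\<close>.\<close>

lemma weak_equivalence_iff:
  assumes X: "simplicial C X" and Y: "simplicial C Y" and f: "smor C X Y f"
  shows "weak_equivalence C cov X Y f \<longleftrightarrow>
    (\<forall>n. rel_cover (objs2 X Y) (arrs2 X Y f) (Bdry n <+> nerve (prism_bdry n)) (Simp n <+> Prism n))" (is "_ \<longleftrightarrow> ?R")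
proof -
  have po: "weak_equivalence C cov X Y f \<longleftrightarrow> (\<forall>Q \<rho> P a b. path_object C cov X Y f Q \<rho> P a b \<longrightarrow>
      hypercover C cov P Y (\<lambda>m. \<rho> m (e1 m) \<cdot> b m))"
    unfolding weak_equivalence_def path_object_def path_object_axioms_def lower_def[symmetric]
    using X Y f descent_axioms by simp
  have hc: "hypercover C cov P Y (\<lambda>m. \<rho> m (e1 m) \<cdot> b m) \<longleftrightarrow> ?R" if "path_object C cov X Y f Q \<rho> P a b" for Q \<rho> P a b
  proof -
    interpret path_object C cov X Y f Q \<rho> P a b by (rule that)
    have "q = (\<lambda>m. \<rho> m (e1 m) \<cdot> b m)" by (simp add: q_def fun_eq_iff)
    then show ?thesis using hypercover_iff by simp
  qed
  show ?thesis unfolding po using hc path_object_exists[OF X Y f] by blast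
qed

end

theorem theorem5p1:
  fixes C :: "('o,'m) category" and cov :: "'m set" and k :: nat
    and X Y :: "('o,'m) sobj" and f :: "nat \<Rightarrow> 'm"
  assumes "descent_category C cov"
    and "kgroupoid C cov k X" and "kgroupoid C cov k Y"
    and "smor C X Y f"
  shows "weak_equivalence C cov X Y f \<longleftrightarrow>
    (\<forall>n. rel_prop C X Y f (Simp n) (Simp (Suc n)) (Bdry n) (Horn (Suc n) (Suc n)) (\<lambda>r. r \<in> cov))"
proof -
  have X: "simplicial C X" and Y: "simplicial C Y"
    using assms(2,3) by (simp_all add: kgroupoid_def)
  interpret kan_target C cov X Y f
  proof
    show "restr_prop C Y (Simp n) (Horn n i) (\<lambda>h. h \<in> cov)" if "0 < n" "i \<le> n" for n i
      using assms(3) that unfolding kgroupoid_def restr_prop_def by blast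
  qed (use assms X Y in simp_all)
  have "rel_prop C X Y f (Simp n) (Simp (Suc n)) (Bdry n) (Horn (Suc n) (Suc n)) (\<lambda>r. r \<in> cov) \<longleftrightarrow>
      rc (Bdry n) (Horn (Suc n) (Suc n)) (Simp n) (Simp (Suc n))" for n
    using rel_prop_if_rel_cover[OF X Y f Simp_subset_Suc Bdry_subset_Horn Bdry_subset_Simp Horn_subset_Simp]
      rel_cover_if_rel_prop[OF X Y f Simp_subset_Suc Bdry_subset_Horn Bdry_subset_Simp Horn_subset_Simp
        fincx_Bdry fincx_Simp fincx_Horn fincx_Simp] by blast
  then show ?thesis
    unfolding weak_equivalence_iff[OF X Y f] using hypercover_map_if hypercover_map_only_if by blast
qed

end
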